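(* Let $U^*\in (V_{N_g})^N\cap\mathcal M^N$, with $\delta_1,\delta_c,\delta_a,\delta_b,\tilde\delta_L,\tilde L$ as in the context; in particular $[U^*]$ is a local minimizer of $E$ and the unique critical point in $B([U^*],\delta_c)$, and $\nabla E$ is Lipschitz near $U^*$. Then there exist $\tilde\delta_e>0$ and $\tilde\delta_T>0$ such that the following holds. If $U_0\in (V_{N_g})^N\cap\mathcal M^N$ with $[U_0]\in B([U^*],\tilde\delta_e)$, and the time steps $\Delta t_n>0$ satisfy $\sum_n\Delta t_n=+\infty$ and $\sup\{\Delta t_n:n\in\mathbb N\}\le\tilde\delta_T$, then for any $p_n\in\mathbb N_+$ the sequence $\{U_n\}$ produced by the orthogonality preserving iteration $$U_{n+1/2}^{(0)}=U_n,\qquad U_{n+1/2}^{(k)}=\Big(I+\frac{\Delta t_n}2\mathcal A_{U_{n+1/2}^{(k-1)}}\Big)^{-1}U_n\ (k=1,\dots,p_n),\qquad U_{n+1}=2U_{n+1/2}^{(p_n)}-U_n$$ satisfies $$\lim_{n\to\infty}|||\nabla_G E(U_n)|||=0,\qquad\lim_{n\to\infty}E(U_n)=E(U^* ),\qquad\lim_{n\to\infty}\mathrm{dist}([U_n],[U^*])=0 .$$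
   Context: Setting. $N\ge 1$; $V_{N_g}\subset H^1(\mathbb R^3)$ is a finite-dimensional space (dimension $N_g$) of real-valued functions. For $N$-tuples $\Psi,\Phi$ of functions, $\langle\Psi^\top\Phi\rangle=((\psi_i,\varphi_j)_{L^2(\mathbb R^3)})_{i,j=1}^N$, $(\Psi,\Phi)=\mathrm{tr}\langle\Psi^\top\Phi\rangle$, $|||\Psi|||=(\Psi,\Psi)^{1/2}$. For $P\in\mathbb R^{N\times N}$, $UP$ is the $N$-tuple with $i$-th entry $\sum_j p_{ji}u_j$. $\mathcal M^N=\{U\in (H^1(\mathbb R^3))^N:\langle U^\top U\rangle=I_N\}$; $\mathcal O^N$ is the group of orthogonal $N\times N$ matrices; $[U]=\{UP:P\in\mathcal O^N\}$ for $U\in\mathcal M^N$; $\mathrm{dist}([U],[\hat U])=\inf_{P\in\mathcal O^N}|||U-\hat UP|||$. Closed neighborhoods: $B(U,\delta)=\{\hat U\in (V_{N_g})^N:|||U-\hat U|||\le\delta\}$ and $B([U],\delta)=\{[\hat U]:\hat U\in (V_{N_g})^N\cap\mathcal M^N,\ \mathrm{dist}([U],[\hat U])\le\delta\}$. Energy. $E$ is the Kohn-Sham energy $$E(U)=\sum_{i=1}^N\int_{\mathbb R^3}|\nabla u_i|^2\,dr+\int_{\mathbb R^3}V_{ext}\rho_U\,dr+\frac12\iint\frac{\rho_U(r)\rho_U(r')}{|r-r'|}\,dr\,dr'+\int_{\mathbb R^3}\varepsilon_{xc}(\rho_U)\rho_U\,dr,\qquad \rho_U=2\sum_{i=1}^N|u_i|^2,$$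 where $V_{ext}$ is the external potential (for full potential calculations $V_{ext}(r)=-\sum_{I=1}^M Z_I/|r-R_I|$). Standing assumptions: $E$ is bounded from below on $\mathcal M^N$; the exchange-correlation term is differentiable, with potential $v_{xc}(\rho)=\delta(\rho\,\varepsilon_{xc}(\rho))/\delta\rho$. Thus $E$ is differentiable on $(V_{N_g})^N$, and $\nabla E(U)\in (V_{N_g})^N$ denotes its gradient with respect to $(\cdot,\cdot)$, i.e. for every $v\in V_{N_g}$ $$((\nabla E(U))_i,v)_{L^2}=4\Big(\tfrac12(\nabla u_i,\nabla v)_{L^2}+(V_{ext}u_i,v)_{L^2}+\Big(\int\frac{\rho_U(r')}{|\cdot-r'|}dr'\,u_i,v\Big)_{L^2}+(v_{xc}(\rho_U)u_i,v)_{L^2}\Big).$$ One has $E(UP)=E(U)$ for $P\in\mathcal O^N$, and $\langle U^\top\nabla E(U)\rangle$ is symmetric. Operators. For $U,V\in (V_{N_g})^N$, $\mathcal A_UV=\nabla E(U)\langle U^\top V\rangle-U\langle(\nabla E(U))^\top V\rangle$ (a skew-symmetric linear operator in $V$, so $I+s\mathcal A_U$ is invertible for all real $s$), and $\nabla_G E(U)=\mathcal A_UU=\nabla E(U)\langle U^\top U\rangle-U\langle U^\top\nabla E(U)\rangle$. For $U\in (V_{N_g})^N\cap\mathcal M^N$, $[U]$ is a critical point if $\nabla_G E(U)=0$; $[U^*]$ is a local minimizer if $E(U^* )\le E(U)$ for all $[U]\in B([U^*],r)$, for some $r>0$. Standing assumptions near $U^*$. $\nabla E$ is Lipschitz on $B(U^*,\delta_1)$,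 $\delta_1>0$. $\delta_a,\delta_b,\delta^*>0$ are constants for which there is a unique function $g:B(U^*,\delta_a)\times[-\delta^*,\delta^*]\to B(U^*,\delta_b)$ with $g(U,s)-U=-s\nabla_G E\big(\frac{g(U,s)+U}2\big)$. $\nabla E$ is Lipschitz with constant $\tilde L$ on $B(U^*,\tilde\delta_L)$, where $\tilde\delta_L>\max\{\delta_a,\delta_b\}$. $[U^*]$ is a local minimizer and the unique critical point in $B([U^*],\delta_c)$, $\delta_c\in(0,\delta_1]$. The iteration is run without stopping. *)

theory Defs
  imports "HOL-Analysis.Analysis" "HOL-Library.Function_Algebras" "HOL-Library.FuncSet"
begin

text \<open>
  Functions form a real vector space under the pointwise operations, and so do tuples
  \<open>U :: (real^3 \<Rightarrow> real)^'n\<close>, where the number \<open>N\<close> of entries is \<open>CARD('n)\<close>.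
\<close>

instantiation "fun" :: (type, scaleR) scaleR
begin

definition scaleR_fun_def: "c *\<^sub>R f = (\<lambda>x. c *\<^sub>R f x)"

instance ..

end

lemma scaleR_fun_apply [simp]: "(c *\<^sub>R f) x = c *\<^sub>R f x"
  by (simp add: scaleR_fun_def)

instance "fun" :: (type, real_vector) real_vector
  by standard (simp_all add: fun_eq_iff scaleR_add_right scaleR_add_left)


subsection \<open>The Sobolev space\<close>

definition square_integrable :: "(real^3 \<Rightarrow> 'b::euclidean_space) \<Rightarrow> bool" where
  "square_integrable f \<longleftrightarrow>
     f \<in> borel_measurable lborel \<and> integrable lborel (\<lambda>x. (norm (f x))\<^sup>2)"

text \<open>
  Test functions are continuously differentiable with compact support, which gives the same weak
  gradients as smooth ones.
\<close>

definition test_function :: "(real^3 \<Rightarrow> real) \<Rightarrow> (real^3 \<Rightarrow> real^3) \<Rightarrow> bool" where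
  "test_function \<phi> D\<phi> \<longleftrightarrow>
     (\<forall>x. GDERIV \<phi> x :> D\<phi> x) \<and> continuous_on UNIV D\<phi> \<and> compact (closure {x. \<phi> x \<noteq> 0})"

definition weak_gradient :: "(real^3 \<Rightarrow> real) \<Rightarrow> (real^3 \<Rightarrow> real^3) \<Rightarrow> bool" where
  "weak_gradient u g \<longleftrightarrow>
     (\<forall>\<phi> D\<phi>. test_function \<phi> D\<phi> \<longrightarrow>
        (LINT x|lborel. u x *\<^sub>R D\<phi> x) = - (LINT x|lborel. \<phi> x *\<^sub>R g x))"

definition H1 :: "(real^3 \<Rightarrow> real) set" where
  "H1 = {u. square_integrable u \<and> (\<exists>g. square_integrable g \<and> weak_gradient u g)}"

text \<open>The weak gradient is unique only up to null sets; the choice does not affect integrals.\<close>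

definition wgrad :: "(real^3 \<Rightarrow> real) \<Rightarrow> real^3 \<Rightarrow> real^3" where
  "wgrad u = (SOME g. square_integrable g \<and> weak_gradient u g)"

text \<open>
  A finite-dimensional subspace of \<open>H\<^sup>1\<close>.  Elements of \<open>H\<^sup>1\<close> are classes of functions modulo null
  sets, whereas elements of \<open>V\<close> are functions: the last conjunct says that \<open>V\<close> contains exactly one
  representative of each of its classes.
\<close>

definition fin_dim_H1_space :: "nat \<Rightarrow> (real^3 \<Rightarrow> real) set \<Rightarrow> bool" where
  "fin_dim_H1_space Ng V \<longleftrightarrow>
     V \<subseteq> H1 \<and>
     (\<exists>B. finite B \<and> card B = Ng \<and> independent B \<and> span B = V) \<and>
     (\<forall>v\<in>V. (AE x in lborel. v x = 0) \<longrightarrow> v = 0)"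


subsection \<open>Tuples of functions\<close>

type_synonym 'n tuple = "(real^3 \<Rightarrow> real)^'n"

definition tuples :: "(real^3 \<Rightarrow> real) set \<Rightarrow> ('n::finite) tuple set" where
  "tuples V = {U. \<forall>i. U $ i \<in> V}"

definition L2_inner :: "(real^3 \<Rightarrow> real) \<Rightarrow> (real^3 \<Rightarrow> real) \<Rightarrow> real" where
  "L2_inner f g = (LINT x|lborel. f x * g x)"

definition gram :: "('n::finite) tuple \<Rightarrow> 'n tuple \<Rightarrow> real^'n^'n" where
  "gram U W = (\<chi> i j. L2_inner (U $ i) (W $ j))"

definition tinner :: "('n::finite) tuple \<Rightarrow> 'n tuple \<Rightarrow> real" where
  "tinner U W = trace (gram U W)"

definition tnorm :: "('n::finite) tuple \<Rightarrow> real" where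
  "tnorm U = sqrt (tinner U U)"

definition tmul :: "('n::finite) tuple \<Rightarrow> real^'n^'n \<Rightarrow> 'n tuple" where
  "tmul U P = (\<chi> i. \<Sum>j\<in>UNIV. (P $ j $ i) *\<^sub>R (U $ j))"

definition stiefel :: "('n::finite) tuple set" where
  "stiefel = {U \<in> tuples H1. gram U U = mat 1}"

definition orbit :: "('n::finite) tuple \<Rightarrow> 'n tuple set" where
  "orbit U = {tmul U P | P. orthogonal_matrix P}"

text \<open>The distance of the classes \<open>[U]\<close> and \<open>[W]\<close>, in terms of representatives.\<close>

definition orbit_dist :: "('n::finite) tuple \<Rightarrow> 'n tuple \<Rightarrow> real" where
  "orbit_dist U W = (INF P\<in>{P. orthogonal_matrix P}. tnorm (U - tmul W P))"

definition tball :: "(real^3 \<Rightarrow> real) set \<Rightarrow> ('n::finite) tuple \<Rightarrow> real \<Rightarrow> 'n tuple set" where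
  "tball V U \<delta> = {W \<in> tuples V. tnorm (U - W) \<le> \<delta>}"

definition orbit_ball :: "(real^3 \<Rightarrow> real) set \<Rightarrow> ('n::finite) tuple \<Rightarrow> real \<Rightarrow> 'n tuple set set"
  where "orbit_ball V U \<delta> = {orbit W | W. W \<in> tuples V \<inter> stiefel \<and> orbit_dist U W \<le> \<delta>}"


subsection \<open>The Kohn-Sham energy\<close>

text \<open>
  \<open>exc\<close> and \<open>vxc\<close> map a density to a function on space, so nonlocal functionals are allowed; the local
  density approximation is the case \<open>exc \<rho> = (\<lambda>r. e (\<rho> r))\<close>.
\<close>

type_synonym density_map = "(real^3 \<Rightarrow> real) \<Rightarrow> real^3 \<Rightarrow> real"

definition density :: "('n::finite) tuple \<Rightarrow> real^3 \<Rightarrow> real" where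
  "density U r = 2 * (\<Sum>i\<in>UNIV. \<bar>(U $ i) r\<bar>\<^sup>2)"

definition xc_energy :: "density_map \<Rightarrow> ('n::finite) tuple \<Rightarrow> real" where
  "xc_energy exc U = (LINT r|lborel. exc (density U) r * density U r)"

definition ks_energy :: "(real^3 \<Rightarrow> real) \<Rightarrow> density_map \<Rightarrow> ('n::finite) tuple \<Rightarrow> real" where
  "ks_energy Vext exc U =
     (\<Sum>i\<in>UNIV. LINT r|lborel. (norm (wgrad (U $ i) r))\<^sup>2)
     + (LINT r|lborel. Vext r * density U r)
     + 1/2 * (LINT (r, r')|(lborel \<Otimes>\<^sub>M lborel). density U r * density U r' / norm (r - r'))
     + xc_energy exc U"

text \<open>
  The integrals in the energy that involve the unspecified data converge on \<open>(H\<^sup>1)\<^sup>N\<close>; the kinetic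
  and Hartree integrals always do.
\<close>

definition energy_well_defined ::
    "('n::finite) itself \<Rightarrow> (real^3 \<Rightarrow> real) \<Rightarrow> density_map \<Rightarrow> bool" where
  "energy_well_defined _ Vext exc \<longleftrightarrow>
     (\<forall>U \<in> (tuples H1 :: 'n tuple set).
        integrable lborel (\<lambda>r. Vext r * density U r) \<and>
        integrable lborel (\<lambda>r. exc (density U) r * density U r))"

text \<open>Frechet differentiability at \<open>U\<close> along \<open>V\<^sup>N\<close>; \<open>F'\<close> is meant to be linear on \<open>V\<^sup>N\<close>.\<close>

definition frechet_on ::
    "(real^3 \<Rightarrow> real) set \<Rightarrow> (('n::finite) tuple \<Rightarrow> real) \<Rightarrow> 'n tuple \<Rightarrow> ('n tuple \<Rightarrow> real) \<Rightarrow> bool"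
  where "frechet_on V F U F' \<longleftrightarrow>
     (\<forall>\<epsilon>>0. \<exists>d>0. \<forall>H \<in> tuples V. tnorm H < d \<longrightarrow> \<bar>F (U + H) - F U - F' H\<bar> \<le> \<epsilon> * tnorm H)"

text \<open>
  The exchange-correlation term is differentiable on \<open>V\<^sup>N\<close>, and \<open>vxc \<rho>\<close> is the functional derivative
  of \<open>\<rho> \<mapsto> \<integral> exc \<rho> \<sqdot> \<rho>\<close>: the derivative at \<open>U\<close> in direction \<open>H\<close> is the integral of \<open>vxc (density U)\<close>
  against the first variation \<open>4 \<Sum>\<^sub>i U\<^sub>i H\<^sub>i\<close> of the density.
\<close>

definition xc_differentiable ::
    "('n::finite) itself \<Rightarrow> (real^3 \<Rightarrow> real) set \<Rightarrow> density_map \<Rightarrow> density_map \<Rightarrow> bool" where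
  "xc_differentiable _ V exc vxc \<longleftrightarrow>
     (\<forall>U \<in> (tuples V :: 'n tuple set).
        (\<forall>i. \<forall>v\<in>V. integrable lborel (\<lambda>r. vxc (density U) r * (U $ i) r * v r)) \<and>
        frechet_on V (xc_energy exc) U
          (\<lambda>H. LINT r|lborel. vxc (density U) r * (4 * (\<Sum>i\<in>UNIV. (U $ i) r * (H $ i) r))))"

text \<open>
  The gradient of \<open>E\<close> on \<open>V\<^sup>N\<close> with respect to \<open>tinner\<close>.  For the Kohn-Sham energy its \<open>i\<close>-th entry is
  the element of \<open>V\<close> whose inner product with \<open>v \<in> V\<close> is
  \<open>4 (1/2 (\<nabla>u\<^sub>i, \<nabla>v) + (Vext u\<^sub>i, v) + ((\<integral> \<rho>(r') / |\<cdot> - r'| dr') u\<^sub>i, v) + (vxc \<rho> u\<^sub>i, v))\<close>.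
\<close>

definition grad ::
    "(real^3 \<Rightarrow> real) set \<Rightarrow> (('n::finite) tuple \<Rightarrow> real) \<Rightarrow> 'n tuple \<Rightarrow> 'n tuple" where
  "grad V E U = (THE G. G \<in> tuples V \<and> frechet_on V E U (tinner G))"

definition lipschitz_grad ::
    "(real^3 \<Rightarrow> real) set \<Rightarrow> (('n::finite) tuple \<Rightarrow> real) \<Rightarrow> real \<Rightarrow> 'n tuple set \<Rightarrow> bool" where
  "lipschitz_grad V E L S \<longleftrightarrow>
     (\<forall>X\<in>S. \<forall>Y\<in>S. tnorm (grad V E X - grad V E Y) \<le> L * tnorm (X - Y))"

definition skew_op ::
    "(real^3 \<Rightarrow> real) set \<Rightarrow> (('n::finite) tuple \<Rightarrow> real) \<Rightarrow> 'n tuple \<Rightarrow> 'n tuple \<Rightarrow> 'n tuple" where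
  "skew_op V E U W = tmul (grad V E U) (gram U W) - tmul U (gram (grad V E U) W)"

definition grad_G ::
    "(real^3 \<Rightarrow> real) set \<Rightarrow> (('n::finite) tuple \<Rightarrow> real) \<Rightarrow> 'n tuple \<Rightarrow> 'n tuple" where
  "grad_G V E U = skew_op V E U U"

definition local_minimizer ::
    "(real^3 \<Rightarrow> real) set \<Rightarrow> (('n::finite) tuple \<Rightarrow> real) \<Rightarrow> 'n tuple \<Rightarrow> bool" where
  "local_minimizer V E U \<longleftrightarrow> (\<exists>r>0. \<forall>W. orbit W \<in> orbit_ball V U r \<longrightarrow> E U \<le> E W)"

definition unique_critical_in_ball ::
    "(real^3 \<Rightarrow> real) set \<Rightarrow> (('n::finite) tuple \<Rightarrow> real) \<Rightarrow> 'n tuple \<Rightarrow> real \<Rightarrow> bool" where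
  "unique_critical_in_ball V E U \<delta> \<longleftrightarrow>
     grad_G V E U = 0 \<and>
     (\<forall>W. orbit W \<in> orbit_ball V U \<delta> \<and> grad_G V E W = 0 \<longrightarrow> orbit W = orbit U)"


subsection \<open>The orthogonality preserving iteration\<close>

primrec half_step ::
    "(real^3 \<Rightarrow> real) set \<Rightarrow> (('n::finite) tuple \<Rightarrow> real) \<Rightarrow> real \<Rightarrow> 'n tuple \<Rightarrow> nat \<Rightarrow> 'n tuple" where
  "half_step V E \<tau> U 0 = U"
| "half_step V E \<tau> U (Suc k) =
     inv_into (tuples V) (\<lambda>X. X + (\<tau>/2) *\<^sub>R skew_op V E (half_step V E \<tau> U k) X) U"

primrec iterate ::
    "(real^3 \<Rightarrow> real) set \<Rightarrow> (('n::finite) tuple \<Rightarrow> real) \<Rightarrow> (nat \<Rightarrow> real) \<Rightarrow> (nat \<Rightarrow> nat) \<Rightarrow>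
     'n tuple \<Rightarrow> nat \<Rightarrow> 'n tuple" where
  "iterate V E \<tau> p U\<^sub>0 0 = U\<^sub>0"
| "iterate V E \<tau> p U\<^sub>0 (Suc n) =
     2 *\<^sub>R half_step V E (\<tau> n) (iterate V E \<tau> p U\<^sub>0 n) (p n) - iterate V E \<tau> p U\<^sub>0 n"

end

theory Submission
  imports Defs
begin

text \<open>
  The energy is differentiable along \<open>V\<^sup>N\<close>: the kinetic and external terms are quadratic forms, and
  the Hartree term is a quartic form that is finite because functions with square integrable weak
  gradient are in \<open>L\<^sup>3\<close>.  One step of the iteration is the Cayley transform of a skew-symmetric
  operator, so it preserves the Gram matrix.  Since \<open>\<langle>\<nabla>E(U)\<^sup>T U\<rangle>\<close> is symmetric by orthogonal
  invariance, the part of the gradient normal to the Stiefel manifold contributes only to second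
  order, and for small time steps \<open>E(U\<^sub>n\<^sub>+\<^sub>1) \<le> E(U\<^sub>n) - (\<Delta>t\<^sub>n/2) |||\<nabla>\<^sub>G E(U\<^sub>n)|||\<^sup>2\<close>.  A point near
  \<open>[U\<^sup>*]\<close> whose energy does not exceed \<open>E(U\<^sup>*)\<close> is critical by this inequality, hence in \<open>[U\<^sup>*]\<close>; by
  compactness there is an energy barrier around \<open>[U\<^sup>*]\<close> that traps the iterates.  As the time steps
  sum to infinity, \<open>\<nabla>\<^sub>G E\<close> vanishes along a subsequence, so the energies decrease to \<open>E(U\<^sup>*)\<close>, and
  every limit point of the iterates lies in \<open>[U\<^sup>*]\<close>.
\<close>

subsection \<open>Finite-dimensional inner product spaces\<close>

text \<open>The L^2 product is additive only where products are integrable, and definite only on a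
  set with one representative of each class; hence all linear algebra is done relative to a carrier
  set. The obstacle in the descent inequality is uniformity: the number of inner iterations is
  arbitrary, and the reference point is known only up to a rotation. Every half step, whatever its
  index, lies within \<tau> times |||grad_G E(U_n)||| of U_n. So all errors are of order \<tau>^2
  times the square of that norm, and they are small relative to the gain even where the norm itself
  is small. Rotations are isometries that commute with the gradient, so constants found at
  \<open>Ustar\<close> hold on its whole orbit. The barrier is an annulus in the orbit distance, and
  the bound on the time steps keeps a single step from jumping across it. Cube integrability is
  derived from L^2 estimates of translates; the exponent 3 is the one that the splitting of the
  Coulomb integrand asks for.\<close>

locale ip_space =
  fixes S :: "'a::real_vector set" and ip :: "'a \<Rightarrow> 'a \<Rightarrow> real"
  assumes subspace: "subspace S"
    and ip_commute: "\<And>x y. ip x y = ip y x"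
    and ip_add_left: "\<And>x y z. x \<in> S \<Longrightarrow> y \<in> S \<Longrightarrow> z \<in> S \<Longrightarrow> ip (x + y) z = ip x z + ip y z"
    and ip_scaleR_left: "\<And>c x y. x \<in> S \<Longrightarrow> y \<in> S \<Longrightarrow> ip (c *\<^sub>R x) y = c * ip x y"
    and ip_pos: "\<And>x. x \<in> S \<Longrightarrow> x \<noteq> 0 \<Longrightarrow> ip x x > 0"
begin

definition nrm :: "'a \<Rightarrow> real" where "nrm x = sqrt (ip x x)"

lemma mem_zero [simp]: "0 \<in> S"
  and mem_add [simp]: "x \<in> S \<Longrightarrow> y \<in> S \<Longrightarrow> x + y \<in> S"
  and mem_diff [simp]: "x \<in> S \<Longrightarrow> y \<in> S \<Longrightarrow> x - y \<in> S"
  and mem_scaleR [simp]: "x \<in> S \<Longrightarrow> c *\<^sub>R x \<in> S"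
  and mem_sum [simp]: "(\<And>i. i \<in> I \<Longrightarrow> f i \<in> S) \<Longrightarrow> sum f I \<in> S"
  using subspace by (auto simp: subspace_0 subspace_add subspace_diff subspace_scale subspace_sum)

lemma mem_uminus [simp]: "x \<in> S \<Longrightarrow> - x \<in> S"
  using subspace by (rule subspace_neg)

lemma ip_add_right: "x \<in> S \<Longrightarrow> y \<in> S \<Longrightarrow> z \<in> S \<Longrightarrow> ip z (x + y) = ip z x + ip z y"
  by (metis ip_add_left ip_commute)

lemma ip_scaleR_right: "x \<in> S \<Longrightarrow> y \<in> S \<Longrightarrow> ip y (c *\<^sub>R x) = c * ip y x"
  by (metis ip_scaleR_left ip_commute)

lemma ip_zero_left [simp]: "x \<in> S \<Longrightarrow> ip 0 x = 0"
  using ip_scaleR_left[of 0 x 0] by simp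

lemma ip_zero_right [simp]: "x \<in> S \<Longrightarrow> ip x 0 = 0"
  by (simp add: ip_commute[of x])

lemma ip_minus_left: "x \<in> S \<Longrightarrow> y \<in> S \<Longrightarrow> ip (- x) y = - ip x y"
  using ip_scaleR_left[of x y "-1"] by simp

lemma ip_diff_left: "x \<in> S \<Longrightarrow> y \<in> S \<Longrightarrow> z \<in> S \<Longrightarrow> ip (x - y) z = ip x z - ip y z"
  using ip_add_left[of x "- y" z] by (simp add: ip_minus_left)

lemma ip_minus_right: "x \<in> S \<Longrightarrow> y \<in> S \<Longrightarrow> ip y (- x) = - ip y x"
  by (metis ip_minus_left ip_commute)

lemma ip_diff_right: "x \<in> S \<Longrightarrow> y \<in> S \<Longrightarrow> z \<in> S \<Longrightarrow> ip z (x - y) = ip z x - ip z y"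
  by (metis ip_diff_left ip_commute)

lemma ip_sum_left:
  "(\<And>i. i \<in> I \<Longrightarrow> f i \<in> S) \<Longrightarrow> y \<in> S \<Longrightarrow> ip (sum f I) y = (\<Sum>i\<in>I. ip (f i) y)"
  by (induction I rule: infinite_finite_induct) (auto simp: ip_add_left)

lemma ip_sum_right:
  "(\<And>i. i \<in> I \<Longrightarrow> f i \<in> S) \<Longrightarrow> y \<in> S \<Longrightarrow> ip y (sum f I) = (\<Sum>i\<in>I. ip y (f i))"
  by (metis (mono_tags, lifting) ip_commute ip_sum_left sum.cong)

lemmas ip_simps = ip_add_left ip_add_right ip_diff_left ip_diff_right ip_scaleR_left
  ip_scaleR_right ip_minus_left ip_minus_right

lemma ip_ge_0: "x \<in> S \<Longrightarrow> ip x x \<ge> 0"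
  by (cases "x = 0") (auto intro: less_imp_le ip_pos)

lemma ip_eq_0_iff: "x \<in> S \<Longrightarrow> ip x x = 0 \<longleftrightarrow> x = 0"
  using ip_pos by fastforce

lemma nrm_ge_0 [simp]: "x \<in> S \<Longrightarrow> nrm x \<ge> 0"
  by (simp add: nrm_def ip_ge_0)

lemma nrm_power2: "x \<in> S \<Longrightarrow> (nrm x)\<^sup>2 = ip x x"
  by (simp add: nrm_def ip_ge_0)

lemma nrm_zero [simp]: "nrm 0 = 0"
  by (simp add: nrm_def)

lemma nrm_eq_0_iff: "x \<in> S \<Longrightarrow> nrm x = 0 \<longleftrightarrow> x = 0"
  by (simp add: nrm_def ip_eq_0_iff)

lemma nrm_scaleR: "x \<in> S \<Longrightarrow> nrm (c *\<^sub>R x) = \<bar>c\<bar> * nrm x"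
  by (simp add: nrm_def ip_simps real_sqrt_mult flip: mult.assoc)

lemma nrm_minus: "x \<in> S \<Longrightarrow> nrm (- x) = nrm x"
  using nrm_scaleR[of x "-1"] by simp

lemma nrm_minus_commute: "x \<in> S \<Longrightarrow> y \<in> S \<Longrightarrow> nrm (x - y) = nrm (y - x)"
  using nrm_minus[of "x - y"] by simp

lemma Cauchy_Schwarz:
  assumes "x \<in> S" "y \<in> S"
  shows "\<bar>ip x y\<bar> \<le> nrm x * nrm y"
proof (cases "y = 0")
  case False
  then have y: "ip y y > 0" using assms ip_pos by auto
  \<comment> \<open>The component of \<open>x\<close> orthogonal to \<open>y\<close>, multiplied by
    \<open>ip y y\<close> to avoid a division.\<close>
  have "0 \<le> ip (ip y y *\<^sub>R x - ip x y *\<^sub>R y) (ip y y *\<^sub>R x - ip x y *\<^sub>R y)"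
    using assms by (intro ip_ge_0) simp
  also have "\<dots> = ip y y * (ip x x * ip y y - (ip x y)\<^sup>2)"
    using assms by (simp add: ip_simps ip_commute[of y x] algebra_simps power2_eq_square)
  finally have "(ip x y)\<^sup>2 \<le> (nrm x * nrm y)\<^sup>2"
    using y assms by (simp add: zero_le_mult_iff power_mult_distrib nrm_power2)
  then show ?thesis
    using assms by (metis abs_le_square_iff abs_of_nonneg mult_nonneg_nonneg nrm_ge_0)
qed (use assms in simp)

lemma nrm_triangle:
  assumes "x \<in> S" "y \<in> S"
  shows "nrm (x + y) \<le> nrm x + nrm y"
proof (rule power2_le_imp_le)
  show "(nrm (x + y))\<^sup>2 \<le> (nrm x + nrm y)\<^sup>2"
    using assms Cauchy_Schwarz[OF assms]
    by (simp add: nrm_power2 ip_simps power2_sum ip_commute[of y x])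
qed (use assms in simp)

lemma nrm_triangle_diff: "x \<in> S \<Longrightarrow> y \<in> S \<Longrightarrow> nrm (x - y) \<le> nrm x + nrm y"
  using nrm_triangle[of x "- y"] by (simp add: nrm_minus)

lemma nrm_triangle3: "x \<in> S \<Longrightarrow> y \<in> S \<Longrightarrow> z \<in> S \<Longrightarrow> nrm (x - z) \<le> nrm (x - y) + nrm (y - z)"
  using nrm_triangle[of "x - y" "y - z"] by simp

lemma nrm_sum: "(\<And>i. i \<in> I \<Longrightarrow> f i \<in> S) \<Longrightarrow> nrm (sum f I) \<le> (\<Sum>i\<in>I. nrm (f i))"
proof (induction I rule: infinite_finite_induct)
  case (insert i I)
  then show ?case using nrm_triangle[of "f i" "sum f I"] by (auto intro: order_trans)
qed auto

text \<open>Gram-Schmidt, one vector of \<open>C\<close> at a time: the residual \<open>z\<close> of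
  the projection is normalized and added; if it is zero, the new vector already lies in the
  span.\<close>

lemma orthonormal_extension:
  assumes "finite C" "C \<subseteq> S"
  shows "\<exists>B. finite B \<and> B \<subseteq> S \<and> (\<forall>b\<in>B. \<forall>c\<in>B. ip b c = (if b = c then 1 else 0)) \<and> C \<subseteq> span B"
  using assms
proof (induction C rule: finite_induct)
  case empty
  show ?case by (rule exI[of _ "{}"]) auto
next
  case (insert x C)
  then obtain B where B: "finite B" "B \<subseteq> S" "\<forall>b\<in>B. \<forall>c\<in>B. ip b c = (if b = c then 1 else 0)"
    "C \<subseteq> span B" by (meson insert_subset)
  have x: "x \<in> S" using insert by auto
  define z where "z = x - (\<Sum>b\<in>B. ip x b *\<^sub>R b)"
  have zS: "z \<in> S" unfolding z_def using x B(2) by (intro mem_diff mem_sum mem_scaleR) auto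
  have orth: "ip z c = 0" if "c \<in> B" for c
  proof -
    have "ip z c = ip x c - (\<Sum>b\<in>B. ip x b * ip b c)"
      unfolding z_def using x B(2) that by (subst ip_diff_left) (auto simp: ip_sum_left subset_iff ip_simps)
    also have "(\<Sum>b\<in>B. ip x b * ip b c) = (\<Sum>b\<in>B. if b = c then ip x b else 0)"
      using B(3) that by (intro sum.cong) auto
    finally show ?thesis using B(1) that by simp
  qed
  have xz: "x = z + (\<Sum>b\<in>B. ip x b *\<^sub>R b)" by (simp add: z_def)
  have sB: "(\<Sum>b\<in>B. ip x b *\<^sub>R b) \<in> span B"
    by (simp add: span_base span_scale span_sum)
  show ?case
  proof (cases "z = 0")
    case True
    then have "x \<in> span B" using xz sB by simp
    then show ?thesis using B by (intro exI[of _ B]) auto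
  next
    case False
    define e where "e = (1 / nrm z) *\<^sub>R z"
    have nz: "nrm z > 0" using zS False by (metis nrm_eq_0_iff nrm_ge_0 order_le_less)
    have eS: "e \<in> S" using zS by (simp add: e_def)
    have ee: "ip e e = 1"
      using zS nz eS nrm_power2[OF eS] by (simp add: e_def nrm_scaleR)
    have eo: "ip e c = 0" if "c \<in> B" for c
      using orth that zS B(2) by (auto simp: e_def ip_simps subset_iff)
    have eo': "ip c e = 0" if "c \<in> B" for c
      using eo[OF that] by (simp add: ip_commute)
    have "z = nrm z *\<^sub>R e" using nz by (simp add: e_def)
    then have "z \<in> span (insert e B)" by (metis insertI1 span_base span_scale)
    moreover have "span B \<subseteq> span (insert e B)" by (rule span_mono) auto
    ultimately have "z + (\<Sum>b\<in>B. ip x b *\<^sub>R b) \<in> span (insert e B)" "span B \<subseteq> span (insert e B)"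
      using sB by (auto intro: span_add)
    then have "insert x C \<subseteq> span (insert e B)" using B(4) xz by auto
    moreover have "\<forall>b\<in>insert e B. \<forall>c\<in>insert e B. ip b c = (if b = c then 1 else 0)"
      using ee eo eo' B(3) by auto
    ultimately show ?thesis using B(1,2) eS by (intro exI[of _ "insert e B"]) blast
  qed
qed

end

section \<open>Coordinates, compactness and linear equations in finite dimension\<close>

locale fin_ip_space = ip_space +
  assumes finite_spanning: "\<exists>C. finite C \<and> C \<subseteq> S \<and> S \<subseteq> span C"
begin

definition onb :: "'a set" where
  "onb = (SOME B. finite B \<and> B \<subseteq> S \<and> (\<forall>b\<in>B. \<forall>c\<in>B. ip b c = (if b = c then 1 else 0)) \<and> S \<subseteq> span B)"

lemma onb: "finite onb" "onb \<subseteq> S" "\<forall>b\<in>onb. \<forall>c\<in>onb. ip b c = (if b = c then 1 else 0)" "S \<subseteq> span onb"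
proof -
  obtain C where C: "finite C" "C \<subseteq> S" "S \<subseteq> span C" using finite_spanning by blast
  obtain B where "finite B \<and> B \<subseteq> S \<and> (\<forall>b\<in>B. \<forall>c\<in>B. ip b c = (if b = c then 1 else 0)) \<and> C \<subseteq> span B"
    using orthonormal_extension[OF C(1,2)] by blast
  moreover from this have "S \<subseteq> span B" using C(3) span_minimal[OF _ subspace_span, of C B] by auto
  ultimately have "\<exists>B. finite B \<and> B \<subseteq> S \<and> (\<forall>b\<in>B. \<forall>c\<in>B. ip b c = (if b = c then 1 else 0)) \<and> S \<subseteq> span B"
    by blast
  from someI_ex[OF this] show "finite onb" "onb \<subseteq> S" "\<forall>b\<in>onb. \<forall>c\<in>onb. ip b c = (if b = c then 1 else 0)" "S \<subseteq> span onb"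
    unfolding onb_def by blast+
qed

lemma onb_mem [simp]: "b \<in> onb \<Longrightarrow> b \<in> S"
  using onb by auto

lemma onb_expansion:
  assumes "x \<in> S" shows "x = (\<Sum>b\<in>onb. ip x b *\<^sub>R b)"
proof -
  obtain u where u: "x = (\<Sum>b\<in>onb. u b *\<^sub>R b)"
    using assms onb(4) span_finite[OF onb(1)] by auto
  have "ip x c = u c" if "c \<in> onb" for c
  proof -
    have "ip x c = (\<Sum>b\<in>onb. u b * ip b c)"
      unfolding u using that by (simp add: ip_sum_left ip_simps)
    also have "\<dots> = (\<Sum>b\<in>onb. if b = c then u b else 0)"
      using onb(3) that by (intro sum.cong) auto
    finally show ?thesis using onb(1) that by simp
  qed
  then show ?thesis using u by simp
qed

lemma nrm_onb: "b \<in> onb \<Longrightarrow> nrm b = 1"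
  using onb(3) by (simp add: nrm_def)

lemma abs_ip_onb_le: "x \<in> S \<Longrightarrow> b \<in> onb \<Longrightarrow> \<bar>ip x b\<bar> \<le> nrm x"
  using Cauchy_Schwarz[of x b] by (simp add: nrm_onb)

text \<open>The representing vector has the coordinates \<open>F b\<close>. This later turns a
  derivative that is linear on the carrier into a gradient vector.\<close>

lemma Riesz:
  assumes add: "\<And>x y. x \<in> S \<Longrightarrow> y \<in> S \<Longrightarrow> F (x + y) = F x + F y"
    and scale: "\<And>c x. x \<in> S \<Longrightarrow> F (c *\<^sub>R x) = c * (F x :: real)"
  shows "\<exists>g\<in>S. \<forall>x\<in>S. F x = ip g x"
proof
  let ?g = "\<Sum>b\<in>onb. F b *\<^sub>R b"
  have Fsum: "F (\<Sum>i\<in>I. f i) = (\<Sum>i\<in>I. F (f i))" if "\<And>i. i \<in> I \<Longrightarrow> f i \<in> S" for I and f :: "'a \<Rightarrow> 'a"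
    using that
  proof (induction I rule: infinite_finite_induct)
    case (insert i I)
    then show ?case by (simp add: add)
  qed (use scale[of 0 0] in auto)
  show "?g \<in> S" by simp
  show "\<forall>x\<in>S. F x = ip ?g x"
  proof
    fix x assume x: "x \<in> S"
    have "F x = F (\<Sum>b\<in>onb. ip x b *\<^sub>R b)"
      using onb_expansion[OF x] by simp
    also have "\<dots> = (\<Sum>b\<in>onb. ip x b * F b)"
      using x by (subst Fsum) (auto simp: scale)
    also have "\<dots> = ip ?g x"
      using x by (subst ip_sum_left) (auto simp: ip_simps mult.commute ip_commute intro!: sum.cong)
    finally show "F x = ip ?g x" .
  qed
qed

text \<open>Bolzano-Weierstrass in coordinates: each of the finitely many coordinates is bounded by
  the norm, so one subsequence works for all of them, and the norm of the difference is at most the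
  sum of the coordinate errors.\<close>

lemma bounded_imp_convergent_subsequence:
  fixes f :: "nat \<Rightarrow> 'a"
  assumes S: "\<And>n. f n \<in> S" and bdd: "\<And>n. nrm (f n) \<le> M"
  shows "\<exists>x\<in>S. \<exists>r. strict_mono r \<and> (\<lambda>n. nrm (f (r n) - x)) \<longlonglongrightarrow> 0"
proof -
  let ?c = "\<lambda>n b. ip (f n) b"
  have "\<forall>\<delta>\<subseteq>onb. \<exists>l. \<exists>r. strict_mono r \<and> (\<forall>e>0. eventually (\<lambda>n. \<forall>b\<in>\<delta>. dist (?c (r n) b) (l b) < e) sequentially)"
  proof (rule compact_lemma_general[where unproj = "\<lambda>x. x" and proj = "\<lambda>x. x" and f = "\<lambda>n. ip (f n)"])
    show "finite onb" by (rule onb)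
    fix k assume "k \<in> onb"
    then show "bounded ((\<lambda>x. x k) ` range (\<lambda>n. ip (f n)))"
      unfolding bounded_iff using order_trans[OF abs_ip_onb_le[OF S] bdd] by (intro exI[of _ M]) auto
  qed auto
  then obtain l and r where r: "strict_mono r"
    and ev: "\<And>e. e > 0 \<Longrightarrow> eventually (\<lambda>n. \<forall>b\<in>onb. dist (?c (r n) b) (l b) < e) sequentially" by blast
  have lim: "(\<lambda>n. ?c (r n) b) \<longlonglongrightarrow> l b" if "b \<in> onb" for b
    by (rule tendstoI) (rule eventually_mono[OF ev], use that in auto)
  let ?x = "\<Sum>b\<in>onb. l b *\<^sub>R b"
  have diff: "f (r n) - ?x = (\<Sum>b\<in>onb. (?c (r n) b - l b) *\<^sub>R b)" for n
    by (subst onb_expansion[OF S]) (simp add: scaleR_diff_left sum_subtractf)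
  have le: "nrm (f (r n) - ?x) \<le> (\<Sum>b\<in>onb. \<bar>?c (r n) b - l b\<bar>)" for n
    unfolding diff by (rule order_trans[OF nrm_sum]) (auto simp: nrm_scaleR nrm_onb)
  have "(\<lambda>n. nrm (f (r n) - ?x)) \<longlonglongrightarrow> 0"
  proof (rule tendsto_sandwich[of "\<lambda>_. 0" _ _ "\<lambda>n. (\<Sum>b\<in>onb. \<bar>?c (r n) b - l b\<bar>)"])
    have "(\<lambda>n. (\<Sum>b\<in>onb. \<bar>?c (r n) b - l b\<bar>)) \<longlonglongrightarrow> (\<Sum>b\<in>onb. \<bar>l b - l b\<bar>)"
      by (intro tendsto_intros lim)
    then show "(\<lambda>n. (\<Sum>b\<in>onb. \<bar>?c (r n) b - l b\<bar>)) \<longlonglongrightarrow> 0" by simp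
  qed (use le S in auto)
  then show ?thesis using r by (intro bexI[of _ ?x]) auto
qed

text \<open>This yields the existence of the half steps. \<open>T\<close> maps the orthonormal basis
  to an independent family of the same size; a vector outside the span of that family would give
  more independent vectors than the basis has elements.\<close>

lemma injective_imp_surjective:
  assumes T: "\<And>x. x \<in> S \<Longrightarrow> T x \<in> S"
    and add: "\<And>x y. x \<in> S \<Longrightarrow> y \<in> S \<Longrightarrow> T (x + y) = T x + T y"
    and scale: "\<And>c x. x \<in> S \<Longrightarrow> T (c *\<^sub>R x) = c *\<^sub>R T x"
    and inj: "\<And>x. x \<in> S \<Longrightarrow> T x = 0 \<Longrightarrow> x = 0"
  shows "T ` S = S"
proof
  show "S \<subseteq> T ` S"
  proof
    fix y assume y: "y \<in> S"
    have T0: "T 0 = 0" using scale[of 0 0] by simp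
    have Tsum: "T (\<Sum>i\<in>I. f i) = (\<Sum>i\<in>I. T (f i))" if "\<And>i. i \<in> I \<Longrightarrow> f i \<in> S" for I and f :: "'a \<Rightarrow> 'a"
      using that by (induction I rule: infinite_finite_induct) (auto simp: add T0)
    have injT: "inj_on T onb"
    proof (rule inj_onI)
      fix b c assume bc: "b \<in> onb" "c \<in> onb" "T b = T c"
      have "T (b - c) = 0" using add[of b "- c"] scale[of c "-1"] bc by simp
      then show "b = c" using inj[of "b - c"] bc by simp
    qed
    have "T (\<Sum>b\<in>onb. u b *\<^sub>R b) = (\<Sum>b\<in>onb. u b *\<^sub>R T b)" for u
      by (subst Tsum) (auto simp: scale)
    have ind: "independent (T ` onb)"
    proof (rule independent_if_scalars_zero)
      show "finite (T ` onb)" using onb(1) by simp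
      fix f x assume s0: "(\<Sum>x\<in>T ` onb. f x *\<^sub>R x) = 0" and x: "x \<in> T ` onb"
      then obtain c where c: "c \<in> onb" "x = T c" by auto
      have "T (\<Sum>b\<in>onb. f (T b) *\<^sub>R b) = 0"
        using s0 by (subst Tsum) (auto simp: scale sum.reindex[OF injT])
      then have z: "(\<Sum>b\<in>onb. f (T b) *\<^sub>R b) = 0" using inj by simp
      have "0 = (\<Sum>b\<in>onb. f (T b) * ip b c)"
        using arg_cong[OF z, of "\<lambda>v. ip v c"] c by (simp add: ip_sum_left ip_simps)
      also have "\<dots> = (\<Sum>b\<in>onb. if b = c then f (T b) else 0)"
        using onb(3) c by (intro sum.cong) auto
      finally show "f x = 0" using onb(1) c by simp
    qed
    have "y \<in> span (T ` onb)"
    proof (rule ccontr)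
      assume ny: "y \<notin> span (T ` onb)"
      have "independent (insert y (T ` onb))" using ind ny by (simp add: independent_insert)
      moreover have "insert y (T ` onb) \<subseteq> span onb" using y T onb(2,4) by auto
      ultimately have "card (insert y (T ` onb)) \<le> card onb"
        using independent_span_bound[OF onb(1)] by blast
      moreover have "y \<notin> T ` onb" using ny span_base[of y "T ` onb"] by metis
      ultimately show False using injT onb(1) by (simp add: card_image)
    qed
    then obtain u where "y = (\<Sum>v\<in>T ` onb. u v *\<^sub>R v)"
      using span_finite[of "T ` onb"] onb(1) by auto
    then have "y = T (\<Sum>b\<in>onb. u (T b) *\<^sub>R b)"
      by (subst Tsum) (auto simp: scale sum.reindex[OF injT])
    then show "y \<in> T ` S" by auto
  qed
qed (use T in auto)

end

subsection \<open>Test functions\<close>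

text \<open>Test functions without the support condition, so that products and compositions can be
  formed before the support is considered.\<close>

definition C1_gradient :: "(real^3 \<Rightarrow> real) \<Rightarrow> (real^3 \<Rightarrow> real^3) \<Rightarrow> bool" where
  "C1_gradient f Df \<longleftrightarrow> (\<forall>x. GDERIV f x :> Df x) \<and> continuous_on UNIV Df"

lemma C1_gradient_imp_continuous:
  assumes "C1_gradient f Df" shows "continuous_on UNIV f"
  using assms by (auto simp: C1_gradient_def gderiv_def continuous_on_eq_continuous_at
    dest: has_derivative_continuous)

lemma C1_gradient_component: "C1_gradient (\<lambda>x. x $ i) (\<lambda>x. axis i 1)"
proof -
  have "((\<lambda>x. x $ i) has_derivative (\<lambda>h. h $ i)) (at x)" for x :: "real^3"
    by (rule bounded_linear_imp_has_derivative) (rule bounded_linear_vec_nth)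
  then show ?thesis by (simp add: C1_gradient_def gderiv_def inner_axis)
qed

lemma C1_gradient_mult:
  assumes "C1_gradient f Df" "C1_gradient g Dg"
  shows "C1_gradient (\<lambda>x. f x * g x) (\<lambda>x. f x *\<^sub>R Dg x + g x *\<^sub>R Df x)"
  using assms C1_gradient_imp_continuous[OF assms(1)] C1_gradient_imp_continuous[OF assms(2)]
  by (auto simp: C1_gradient_def intro!: GDERIV_mult continuous_intros)

text \<open>The set \<open>T\<close> admits outer functions such as \<open>t / (t + e)\<close>,
  which is differentiable only away from \<open>- e\<close> but is applied to nonnegative
  values.\<close>

lemma C1_gradient_compose:
  assumes "C1_gradient f Df" "\<And>t. t \<in> T \<Longrightarrow> DERIV h t :> h' t" "continuous_on T h'" "\<And>x. f x \<in> T"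
  shows "C1_gradient (\<lambda>x. h (f x)) (\<lambda>x. h' (f x) *\<^sub>R Df x)"
  unfolding C1_gradient_def
proof (intro conjI allI)
  show "GDERIV (\<lambda>x. h (f x)) x :> h' (f x) *\<^sub>R Df x" for x
    using assms by (intro GDERIV_DERIV_compose) (auto simp: C1_gradient_def)
  show "continuous_on UNIV (\<lambda>x. h' (f x) *\<^sub>R Df x)"
    using assms C1_gradient_imp_continuous[OF assms(1)]
    by (intro continuous_intros continuous_on_compose2[OF assms(3)]) (auto simp: C1_gradient_def)
qed

text \<open>The squared positive part has a continuous derivative, which is the smoothness that
  \<open>test_function\<close> asks for. At zero the difference quotient lies between
  \<open>- \<bar>h\<bar>\<close> and \<open>\<bar>h\<bar>\<close>.\<close>

lemma DERIV_max_0_square: "DERIV (\<lambda>t::real. (max 0 t)\<^sup>2) t :> 2 * max 0 t"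
proof -
  consider "t < 0" | "t = 0" | "t > 0" by linarith
  then show ?thesis
  proof cases
    case 1
    have "((\<lambda>t. 0) has_real_derivative 0) (at t)" by simp
    then have "((\<lambda>t. (max 0 t)\<^sup>2) has_real_derivative 0) (at t)"
      by (rule has_field_derivative_transform_within_open[where S = "{..<0}"]) (use 1 in auto)
    then show ?thesis using 1 by simp
  next
    case 3
    have "((\<lambda>t. t\<^sup>2) has_real_derivative 2 * t) (at t)"
      by (auto intro!: derivative_eq_intros)
    then have "((\<lambda>t. (max 0 t)\<^sup>2) has_real_derivative 2 * t) (at t)"
      by (rule has_field_derivative_transform_within_open[where S = "{0<..}"]) (use 3 in auto)
    then show ?thesis using 3 by simp
  next
    case 2
    have "((\<lambda>h::real. (max 0 h)\<^sup>2 / h) \<longlongrightarrow> 0) (at 0)"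
    proof (rule tendsto_sandwich)
      show "\<forall>\<^sub>F h in at (0::real). - \<bar>h\<bar> \<le> (max 0 h)\<^sup>2 / h"
        by (rule always_eventually) (auto simp: max_def power2_eq_square)
      show "\<forall>\<^sub>F h in at (0::real). (max 0 h)\<^sup>2 / h \<le> \<bar>h\<bar>"
        by (rule always_eventually) (auto simp: max_def power2_eq_square)
      show "((\<lambda>h::real. - \<bar>h\<bar>) \<longlongrightarrow> 0) (at 0)" "((\<lambda>h::real. \<bar>h\<bar>) \<longlongrightarrow> 0) (at 0)"
        by (auto intro!: tendsto_eq_intros)
    qed
    then show ?thesis using 2 by (simp add: DERIV_def)
  qed
qed

text \<open>The squared positive parts of the signed distances to the six faces: their product is
  continuously differentiable and positive exactly in the open box.\<close>

definition box_bump :: "real^3 \<Rightarrow> real^3 \<Rightarrow> real^3 \<Rightarrow> real" where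
  "box_bump a b y = (\<Prod>i\<in>UNIV. (max 0 (y $ i - a $ i))\<^sup>2 * (max 0 (b $ i - y $ i))\<^sup>2)"

lemma box_bump_nonneg: "box_bump a b y \<ge> 0"
  by (simp add: box_bump_def prod_nonneg)

lemma box_bump_eq_0_iff: "box_bump a b y = 0 \<longleftrightarrow> y \<notin> box a b"
proof -
  have "(max 0 s)\<^sup>2 * (max 0 t)\<^sup>2 = 0 \<longleftrightarrow> \<not> (0 < s \<and> 0 < t)" for s t :: real
    by (auto simp: max_def)
  then show ?thesis by (simp add: box_bump_def mem_box_cart)
qed

lemma prod_UNIV_3:
  fixes f :: "3 \<Rightarrow> 'a::comm_semiring_1" shows "(\<Prod>i\<in>UNIV. f i) = f 1 * f 2 * f 3"
  unfolding UNIV_3 by (simp add: ac_simps)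

lemma C1_gradient_box_bump: "\<exists>D. C1_gradient (box_bump a b) D"
proof -
  define h where "h = (\<lambda>(i::3) t. (max 0 (t - a $ i))\<^sup>2 * (max 0 (b $ i - t))\<^sup>2)"
  have *: "\<exists>D. C1_gradient (\<lambda>y. h i (y $ i)) D" for i
  proof
    let ?h' = "\<lambda>t. 2 * max 0 (t - a $ i) * (max 0 (b $ i - t))\<^sup>2 - (max 0 (t - a $ i))\<^sup>2 * (2 * max 0 (b $ i - t))"
    have "DERIV (h i) t :> ?h' t" for t
      unfolding h_def by (rule derivative_eq_intros DERIV_chain2[OF DERIV_max_0_square] refl | simp)+
    then show "C1_gradient (\<lambda>y. h i (y $ i)) (\<lambda>y. ?h' (y $ i) *\<^sub>R axis i 1)"
      by (intro C1_gradient_compose[where T = UNIV, OF C1_gradient_component]) (auto intro!: continuous_intros)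
  qed
  define D where "D i = (SOME D. C1_gradient (\<lambda>y. h i (y $ i)) D)" for i
  have D: "C1_gradient (\<lambda>y. h i (y $ i)) (D i)" for i
    unfolding D_def using * by (rule someI_ex)
  have "box_bump a b = (\<lambda>y. h 1 (y $ 1) * h 2 (y $ 2) * h 3 (y $ 3))"
    by (rule ext) (simp only: box_bump_def h_def prod_UNIV_3)
  then show ?thesis
    using C1_gradient_mult[OF C1_gradient_mult[OF D[of 1] D[of 2]] D[of 3]] by auto
qed

lemma test_function_iff:
  "test_function \<phi> D \<longleftrightarrow> C1_gradient \<phi> D \<and> bounded {x. \<phi> x \<noteq> 0}"
  by (auto simp: test_function_def C1_gradient_def)

lemma box_approximation:
  fixes e :: real assumes "e > 0"
  shows "\<exists>D. test_function (\<lambda>y. box_bump a b y / (box_bump a b y + e)) D"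
proof -
  obtain D where D: "C1_gradient (box_bump a b) D" using C1_gradient_box_bump by blast
  have "DERIV (\<lambda>t. t / (t + e)) t :> e / (t + e)\<^sup>2" if "t \<in> {0..}" for t
    using that assms by (auto intro!: derivative_eq_intros simp: power2_eq_square)
  then have "C1_gradient (\<lambda>y. box_bump a b y / (box_bump a b y + e)) (\<lambda>y. (e / (box_bump a b y + e)\<^sup>2) *\<^sub>R D y)"
    using assms by (intro C1_gradient_compose[where T = "{0..}" and h = "\<lambda>t. t / (t + e)", OF D])
      (auto intro!: continuous_intros box_bump_nonneg)
  moreover have "{y. box_bump a b y / (box_bump a b y + e) \<noteq> 0} \<subseteq> box a b"
    using box_bump_eq_0_iff[of a b] by auto
  ultimately show ?thesis
    unfolding test_function_iff by (meson bounded_box bounded_subset)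
qed

text \<open>
  For a bump \<open>F\<close> the test functions \<open>F / (F + 1/k)\<close> converge to the indicator of a box, and a
  function whose integrals over all small cubes vanish is zero almost everywhere by Lebesgue's
  differentiation theorem.
\<close>

lemma fundamental_lemma:
  fixes f :: "real^3 \<Rightarrow> real"
  assumes loc: "\<And>a b. set_integrable lborel (cbox a b) f"
    and test: "\<And>\<phi> D. test_function \<phi> D \<Longrightarrow> (LBINT x. \<phi> x * f x) = 0"
  shows "AE x in lborel. f x = 0"
proof -
  have locb: "set_integrable lborel (box a b) f" for a b
    by (rule set_integrable_subset[OF loc[of a b]]) (auto simp: box_subset_cbox)
  have zero: "integral (cbox a b) f = 0" for a b
  proof -
    define p where "p k y = box_bump a b y / (box_bump a b y + 1 / real (Suc k))" for k y
    have "\<exists>D. test_function (p k) D" for k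
      unfolding p_def by (rule box_approximation) simp
    then have p0: "(LBINT y. p k y * f y) = 0"
      and m: "p k \<in> borel_measurable lborel" for k
      using test C1_gradient_imp_continuous borel_measurable_continuous_onI
      unfolding test_function_iff by (blast, fastforce)
    have out: "p k y = 0" if "y \<notin> box a b" for k y
      using that box_bump_eq_0_iff[of a b y] by (simp add: p_def)
    have le1: "\<bar>p k y\<bar> \<le> 1" for k y
    proof -
      have "\<bar>x / (x + e)\<bar> \<le> 1" if "x \<ge> 0" "e > 0" for x e :: real
        using that by (auto simp: divide_le_eq_1 abs_divide)
      from this[of "box_bump a b y" "1 / real (Suc k)"] show ?thesis
        by (simp add: box_bump_nonneg p_def)
    qed
    have lim: "(\<lambda>k. p k y) \<longlonglongrightarrow> indicator (box a b) y" for y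
    proof (cases "y \<in> box a b")
      case True
      then have pos: "box_bump a b y > 0"
        using box_bump_eq_0_iff[of a b y] box_bump_nonneg[of a b y] by linarith
      have "(\<lambda>k. 1 / real (Suc k)) \<longlonglongrightarrow> 0" by (rule LIMSEQ_Suc[OF lim_1_over_n])
      then have "(\<lambda>k. p k y) \<longlonglongrightarrow> box_bump a b y / (box_bump a b y + 0)"
        unfolding p_def using pos by (intro tendsto_intros) auto
      then show ?thesis using pos True by simp
    qed (simp add: out)
    have fi: "integrable lborel (\<lambda>y. indicator (box a b) y * f y)"
      using locb by (simp add: set_integrable_def)
    then have fm: "(\<lambda>y. indicator (box a b) y * f y) \<in> borel_measurable lborel" by auto
    \<comment> \<open>As \<open>p k\<close> vanishes off the box, \<open>f\<close> may be cut off
      there; the cut-off function is integrable and its modulus serves as the dominating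
      function.\<close>
    have eq: "p k y * f y = p k y * (indicator (box a b) y * f y)" for k y
      by (cases "y \<in> box a b") (auto simp: out)
    have "(\<lambda>k. LBINT y. p k y * f y) \<longlonglongrightarrow> (LBINT y. indicator (box a b) y * f y)"
    proof (rule integral_dominated_convergence[where w = "\<lambda>y. \<bar>indicator (box a b) y * f y\<bar>"])
      show "(\<lambda>y. p k y * f y) \<in> borel_measurable lborel" for k
        unfolding eq using m fm by (rule borel_measurable_times)
      show "integrable lborel (\<lambda>y. \<bar>indicator (box a b) y * f y\<bar>)" using fi by auto
      have "norm (p k y * f y) \<le> \<bar>indicator (box a b) y * f y\<bar>" for k y
        unfolding eq abs_mult[of "p k y"] real_norm_def using le1[of k y] by (intro mult_left_le_one_le) auto
      then show "AE y in lborel. norm (p k y * f y) \<le> \<bar>indicator (box a b) y * f y\<bar>" for k by simp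
      show "AE y in lborel. (\<lambda>k. p k y * f y) \<longlonglongrightarrow> indicator (box a b) y * f y"
        by (intro always_eventually allI tendsto_mult lim tendsto_const)
    qed (rule fm)
    then have "(LBINT y. indicator (box a b) y * f y) = 0"
      by (simp add: LIMSEQ_const_iff p0)
    then show ?thesis
      using set_borel_integral_eq_integral(2)[OF locb[of a b]]
      by (simp add: set_lebesgue_integral_def integral_open_interval)
  qed
  have int: "f integrable_on cbox a b" for a b
    using set_borel_integral_eq_integral(1)[OF loc] .
  obtain N where N: "negligible N" "\<And>x e. \<lbrakk>x \<notin> N; 0 < e\<rbrakk> \<Longrightarrow>
     \<exists>d>0. \<forall>h. 0 < h \<and> h < d \<longrightarrow> norm(integral (cbox x (x + h *\<^sub>R One)) f /\<^sub>R h ^ DIM(real^3) - f x) < e"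
    using integrable_ccontinuous_explicit[OF int] by blast
  have "f x = 0" if x: "x \<notin> N" for x
  proof (rule ccontr)
    assume "f x \<noteq> 0"
    then obtain d :: real where "d > 0" "\<forall>h. 0 < h \<and> h < d \<longrightarrow> norm (f x) < \<bar>f x\<bar>"
      using N(2)[OF x, of "\<bar>f x\<bar>"] by (auto simp: zero)
    then show False by (auto dest: spec[of _ "d/2"])
  qed
  then have "AE x in lebesgue. f x = 0"
    using N(1) unfolding negligible_iff_null_sets by (intro AE_I'[of N]) auto
  then show ?thesis by (simp add: AE_completion_iff)
qed

subsection \<open>Translates of functions with a weak gradient\<close>

lemma nn_integral_lborel_shift:
  fixes v :: "'a::euclidean_space"
  assumes [measurable]: "f \<in> borel_measurable borel"
  shows "(\<integral>\<^sup>+x. f (x + v) \<partial>lborel) = (\<integral>\<^sup>+x. f x \<partial>lborel)"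
proof -
  have "(\<integral>\<^sup>+x. f x \<partial>lborel) = (\<integral>\<^sup>+x. f x \<partial>distr lborel borel ((+) v))"
    by (simp add: lborel_distr_plus)
  also have "\<dots> = (\<integral>\<^sup>+x. f (v + x) \<partial>lborel)"
    by (subst nn_integral_distr) auto
  finally show ?thesis by (simp add: add.commute)
qed

lemma integral_lborel_shift:
  fixes v :: "'a::euclidean_space" and f :: "'a \<Rightarrow> 'b::{banach, second_countable_topology}"
  assumes [measurable]: "f \<in> borel_measurable borel"
  shows "(LBINT x. f (x + v)) = (LBINT x. f x)"
proof -
  have "(LBINT x. f x) = (LINT x|distr lborel borel ((+) v). f x)"
    by (simp add: lborel_distr_plus)
  also have "\<dots> = (LBINT x. f (v + x))"
    by (subst integral_distr) auto
  finally show ?thesis by (simp add: add.commute)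
qed

text \<open>Both functions are continuous, hence bounded on the compact closure of the set where
  \<phi> is nonzero. On its open complement \<phi> is locally zero, and so its gradient vanishes
  there as well.\<close>

lemma test_function_bounds:
  assumes "test_function \<phi> D"
  shows "\<exists>M r. M \<ge> 0 \<and> (\<forall>x. \<bar>\<phi> x\<bar> \<le> M * indicator (cball 0 r) x) \<and> (\<forall>x. norm (D x) \<le> M * indicator (cball 0 r) x)"
proof -
  define K where "K = closure {x. \<phi> x \<noteq> 0}"
  have D: "C1_gradient \<phi> D" and b: "bounded {x. \<phi> x \<noteq> 0}"
    using assms by (auto simp: test_function_iff)
  then have K: "compact K" by (simp add: K_def)
  obtain r where r: "K \<subseteq> cball 0 r"
    using bounded_subset_ballD[OF compact_imp_bounded[OF K], of 0] ball_subset_cball by blast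
  have "bounded (D ` K)"
    using D K by (intro compact_imp_bounded compact_continuous_image)
      (auto simp: C1_gradient_def intro: continuous_on_subset)
  then obtain M1 where M1: "\<And>x. x \<in> K \<Longrightarrow> norm (D x) \<le> M1" by (auto simp: bounded_iff)
  have "bounded (\<phi> ` K)"
    using C1_gradient_imp_continuous[OF D] K by (intro compact_imp_bounded compact_continuous_image)
      (auto intro: continuous_on_subset)
  then obtain M2 where M2: "\<And>x. x \<in> K \<Longrightarrow> \<bar>\<phi> x\<bar> \<le> M2" by (auto simp: bounded_iff)
  have phi0: "\<phi> x = 0" if "x \<notin> K" for x using that closure_subset[of "{x. \<phi> x \<noteq> 0}"] unfolding K_def by blast
  have D0: "D x = 0" if "x \<notin> K" for x
  proof -
    have "(\<phi> has_derivative (\<lambda>h. h \<bullet> D x)) (at x)"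
      using D by (simp add: C1_gradient_def gderiv_def)
    moreover have "(\<phi> has_derivative (\<lambda>h. 0)) (at x)"
      by (rule has_derivative_transform_within_open[where f = "\<lambda>_. 0" and s = "- K"]) (use that phi0 K in \<open>auto intro: compact_imp_closed\<close>)
    ultimately have "(\<lambda>h. h \<bullet> D x) = (\<lambda>h. 0)" by (rule has_derivative_unique)
    then show ?thesis by (metis inner_eq_zero_iff)
  qed
  let ?M = "max 0 (max M1 M2)"
  have "\<bar>\<phi> x\<bar> \<le> ?M * indicator (cball 0 r) x" "norm (D x) \<le> ?M * indicator (cball 0 r) x" for x
    using M1[of x] M2[of x] phi0[of x] D0[of x] r by (cases "x \<in> K"; force simp: indicator_def)+
  then show ?thesis by (intro exI[of _ ?M] exI[of _ r]) auto
qed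

lemma test_function_shift:
  assumes "test_function \<phi> D"
  shows "test_function (\<lambda>y. \<phi> (y - v)) (\<lambda>y. D (y - v))"
proof -
  have "GDERIV (\<lambda>y. \<phi> (y - v)) x :> D (x - v)" for x
  proof -
    have "((\<lambda>y. y - v) has_derivative (\<lambda>h. h)) (at x)"
      by (auto intro!: derivative_eq_intros)
    then show ?thesis
      using assms has_derivative_compose[of "\<lambda>y. y - v" "\<lambda>h. h" x UNIV \<phi> "\<lambda>h. h \<bullet> D (x - v)"]
      by (simp add: test_function_def gderiv_def)
  qed
  moreover have "continuous_on UNIV D" using assms by (simp add: test_function_def)
  then have "continuous_on UNIV (\<lambda>y. D (y - v))"
    by (rule continuous_on_compose2) (auto intro: continuous_intros)
  moreover have "bounded {x. \<phi> (x - v) \<noteq> 0}"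
  proof -
    obtain B where B: "\<And>y. \<phi> y \<noteq> 0 \<Longrightarrow> norm y \<le> B"
      using assms unfolding test_function_iff bounded_iff by blast
    have "norm x \<le> B + norm v" if "\<phi> (x - v) \<noteq> 0" for x
      using B[OF that] norm_triangle_sub[of x v] by linarith
    then show ?thesis unfolding bounded_iff by blast
  qed
  ultimately show ?thesis
    by (simp add: test_function_iff C1_gradient_def)
qed

text \<open>From t \<le> 1 + t^2 a local L^1 bound is obtained that depends on \<open>f\<close> only
  through its L^2 norm. It is therefore the same for all translates of \<open>f\<close>, which is
  the uniformity that Fubini's theorem needs below.\<close>

lemma nn_integral_local_bound:
  fixes f :: "real^3 \<Rightarrow> 'b::euclidean_space" and k :: "real^3 \<Rightarrow> 'c::euclidean_space"
  assumes [measurable]: "f \<in> borel_measurable borel"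
    and le: "\<And>x. norm (k x) \<le> M * indicator (cball 0 R) x * norm (f x)" and M: "M \<ge> 0"
  shows "(\<integral>\<^sup>+x. ennreal (norm (k x)) \<partial>lborel) \<le>
     ennreal M * (emeasure lborel (cball (0::real^3) R) + (\<integral>\<^sup>+x. ennreal ((norm (f x))\<^sup>2) \<partial>lborel))"
proof -
  have [measurable]: "cball (0::real^3) R \<in> sets borel" by simp
  have "ennreal (norm (k x)) \<le> ennreal M * (indicator (cball 0 R) x + ennreal ((norm (f x))\<^sup>2))" for x
  proof -
    have "norm (f x) \<le> 1 + (norm (f x))\<^sup>2"
      using sum_power2_ge_zero[of "norm (f x) - 1/2" 0] by (simp add: power2_eq_square algebra_simps)
    then have "norm (k x) \<le> M * (indicator (cball 0 R) x + (norm (f x))\<^sup>2)"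
      using M le[of x] by (cases "x \<in> cball 0 R") (auto intro: order_trans mult_left_mono)
    then have "ennreal (norm (k x)) \<le> ennreal (M * (indicator (cball 0 R) x + (norm (f x))\<^sup>2))"
      by (rule ennreal_leI)
    also have "\<dots> = ennreal M * (indicator (cball 0 R) x + ennreal ((norm (f x))\<^sup>2))"
      using M by (subst ennreal_mult) (auto simp: ennreal_indicator)
    finally show ?thesis .
  qed
  then have "(\<integral>\<^sup>+x. ennreal (norm (k x)) \<partial>lborel) \<le> (\<integral>\<^sup>+x. ennreal M * (indicator (cball 0 R) x + ennreal ((norm (f x))\<^sup>2)) \<partial>lborel)"
    by (rule nn_integral_mono)
  also have "\<dots> = ennreal M * (\<integral>\<^sup>+x. indicator (cball 0 R) x + ennreal ((norm (f x))\<^sup>2) \<partial>lborel)"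
    by (rule nn_integral_cmult) measurable
  also have "(\<integral>\<^sup>+x. indicator (cball 0 R) x + ennreal ((norm (f x))\<^sup>2) \<partial>lborel) =
      emeasure lborel (cball (0::real^3) R) + (\<integral>\<^sup>+x. ennreal ((norm (f x))\<^sup>2) \<partial>lborel)"
    by (subst nn_integral_add) auto
  finally show ?thesis .
qed

lemma square_integrable_nn_integral:
  "square_integrable f \<Longrightarrow> (\<integral>\<^sup>+x. ennreal ((norm (f x))\<^sup>2) \<partial>lborel) < \<infinity>"
  by (auto simp: square_integrable_def integrable_iff_bounded)

lemma integrable_local_bound:
  fixes f :: "real^3 \<Rightarrow> 'b::euclidean_space" and k :: "real^3 \<Rightarrow> 'c::euclidean_space"
  assumes f: "square_integrable f" and k: "k \<in> borel_measurable borel"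
    and le: "\<And>x. norm (k x) \<le> M * indicator (cball 0 R) x * norm (f x)" and M: "M \<ge> 0"
  shows "integrable lborel k"
proof (rule integrableI_bounded)
  have "f \<in> borel_measurable borel" using f by (simp add: square_integrable_def)
  note nn_integral_local_bound[OF this le M]
  also have "ennreal M * (emeasure lborel (cball (0::real^3) R) + (\<integral>\<^sup>+x. ennreal ((norm (f x))\<^sup>2) \<partial>lborel)) < \<infinity>"
    using square_integrable_nn_integral[OF f] emeasure_lborel_cball_finite[of "0::real^3" R]
    by (simp add: ennreal_mult_less_top less_top)
  finally show "(\<integral>\<^sup>+x. ennreal (norm (k x)) \<partial>lborel) < \<infinity>" .
qed (use k in simp)

lemma test_function_measurable:
  assumes "test_function \<phi> D"
  shows "\<phi> \<in> borel_measurable borel" "D \<in> borel_measurable borel"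
  using assms C1_gradient_imp_continuous borel_measurable_continuous_onI
  unfolding test_function_iff C1_gradient_def by blast+

lemma test_function_integrable:
  assumes t: "test_function \<phi> D"
  shows "square_integrable f \<Longrightarrow> integrable lborel (\<lambda>x. \<phi> x *\<^sub>R f x)"
    and "square_integrable u \<Longrightarrow> integrable lborel (\<lambda>x. u x *\<^sub>R D x)"
proof -
  obtain M r where M: "M \<ge> 0" "\<And>x. \<bar>\<phi> x\<bar> \<le> M * indicator (cball 0 r) x"
    "\<And>x. norm (D x) \<le> M * indicator (cball 0 r) x"
    using test_function_bounds[OF t] by blast
  note [measurable] = test_function_measurable[OF t]
  show "integrable lborel (\<lambda>x. \<phi> x *\<^sub>R f x)" if f: "square_integrable f"
    using M(1) M(2)[THEN mult_right_mono] f
    by (intro integrable_local_bound[OF f, of _ M r]) (auto simp: square_integrable_def)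
  show "integrable lborel (\<lambda>x. u x *\<^sub>R D x)" if u: "square_integrable u"
    using M(1) M(3)[THEN mult_right_mono] u
    by (intro integrable_local_bound[OF u, of _ M r]) (auto simp: square_integrable_def mult.commute[of "\<bar>u _\<bar>"])
qed

text \<open>The parameter interval has length one, so a bound \<open>C\<close> on all slices is also
  a bound on the double integral of the modulus.\<close>

lemma slab_Fubini:
  fixes K :: "real \<Rightarrow> real^3 \<Rightarrow> real"
  assumes [measurable]: "(\<lambda>(s, x). K s x) \<in> borel_measurable (lborel \<Otimes>\<^sub>M lborel)"
    and C: "C < \<infinity>" and le: "\<And>s. s \<in> {0..1} \<Longrightarrow> (\<integral>\<^sup>+x. ennreal \<bar>K s x\<bar> \<partial>lborel) \<le> C"
  shows "(LBINT s:{0..1}. (LBINT x. K s x)) = (LBINT x. (LBINT s:{0..1}. K s x))"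
    and "integrable lborel (\<lambda>x. LBINT s:{0..1}. K s x)"
proof -
  let ?K = "\<lambda>s x. indicator {0..1} s * K s x"
  have int: "integrable (lborel \<Otimes>\<^sub>M lborel) (\<lambda>(s, x). ?K s x)"
  proof (rule integrableI_bounded)
    show "(\<lambda>(s, x). ?K s x) \<in> borel_measurable (lborel \<Otimes>\<^sub>M lborel)" by measurable
    have "(\<integral>\<^sup>+z. ennreal (norm (case z of (s, x) \<Rightarrow> ?K s x)) \<partial>(lborel \<Otimes>\<^sub>M lborel)) =
      (\<integral>\<^sup>+s. (\<integral>\<^sup>+x. ennreal (norm (?K s x)) \<partial>lborel) \<partial>lborel)"
      by (subst lborel.nn_integral_fst[symmetric]) auto
    also have "\<dots> \<le> (\<integral>\<^sup>+s. C * indicator {0..1::real} s \<partial>lborel)"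
      by (rule nn_integral_mono) (use le in \<open>auto simp: abs_mult split: split_indicator\<close>)
    also have "\<dots> = C" by (simp add: nn_integral_cmult_indicator)
    finally show "(\<integral>\<^sup>+z. ennreal (norm (case z of (s, x) \<Rightarrow> ?K s x)) \<partial>(lborel \<Otimes>\<^sub>M lborel)) < \<infinity>"
      using C by simp
  qed
  show "(LBINT s:{0..1}. (LBINT x. K s x)) = (LBINT x. (LBINT s:{0..1}. K s x))"
    using lborel_pair.integral_fst[OF int] lborel_pair.integral_snd[OF int]
    by (simp add: set_lebesgue_integral_def)
  show "integrable lborel (\<lambda>x. LBINT s:{0..1}. K s x)"
    using lborel_pair.integrable_snd[OF int] by (simp add: set_lebesgue_integral_def)
qed

text \<open>The fundamental theorem of calculus along the segment from x to x + v, for a weak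
  gradient. Tested against \<phi>, the translation moves onto \<phi>, the weak gradient turns into
  the gradient of the shifted test function, and the integral over s of that gradient in direction v
  is \<phi>(y) - \<phi>(y - v). The classical theorem is thus applied to \<phi> only.\<close>

lemma translation_identity:
  assumes u: "square_integrable u" and g: "square_integrable g" and w: "weak_gradient u g"
  shows "AE x in lborel. u (x + v) - u x = (LBINT s:{0..1}. g (x + s *\<^sub>R v) \<bullet> v)"
proof -
  have [measurable]: "u \<in> borel_measurable borel" "g \<in> borel_measurable borel"
    using u g by (auto simp: square_integrable_def)
  define h where "h x = (LBINT s:{0..1}. g (x + s *\<^sub>R v) \<bullet> v)" for x
  have gshift: "square_integrable (\<lambda>x. g (x + c))" for c
    using g nn_integral_lborel_shift[of "\<lambda>x. ennreal ((norm (g x))\<^sup>2)" c]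
    by (auto simp: square_integrable_def integrable_iff_bounded)
  have ushift: "square_integrable (\<lambda>x. u (x + c))" for c
    using u nn_integral_lborel_shift[of "\<lambda>x. ennreal ((u x)\<^sup>2)" c]
    by (auto simp: square_integrable_def integrable_iff_bounded)
  have A: "(LBINT s:{0..1}. (LBINT x. \<phi> x * (g (x + s *\<^sub>R v) \<bullet> v))) = (LBINT x. \<phi> x * h x)"
    "integrable lborel (\<lambda>x. \<phi> x * h x)"
    \<comment> \<open>Only boundedness and support of \<phi> enter, so this serves both the test
      functions and, with the indicator of a box as \<phi>, the local integrability of
      \<open>h\<close>.\<close>
    if [measurable]: "\<phi> \<in> borel_measurable borel" and M: "M \<ge> 0" "\<And>x. \<bar>\<phi> x\<bar> \<le> M * indicator (cball 0 r) x" for \<phi> M r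
  proof -
    let ?C = "ennreal (M * norm v) * (emeasure lborel (cball (0::real^3) r) + (\<integral>\<^sup>+x. ennreal ((norm (g x))\<^sup>2) \<partial>lborel))"
    have C: "?C < \<infinity>"
      using square_integrable_nn_integral[OF g] emeasure_lborel_cball_finite[of "0::real^3" r]
      by (simp add: ennreal_mult_less_top less_top)
    have le: "(\<integral>\<^sup>+x. ennreal \<bar>\<phi> x * (g (x + s *\<^sub>R v) \<bullet> v)\<bar> \<partial>lborel) \<le> ?C" for s
    proof -
      have "\<bar>\<phi> x * (g (x + s *\<^sub>R v) \<bullet> v)\<bar> \<le> (M * norm v) * indicator (cball 0 r) x * norm (g (x + s *\<^sub>R v))" for x
        using mult_mono[OF M(2)[of x] Cauchy_Schwarz_ineq2[of "g (x + s *\<^sub>R v)" v]] M(1)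
        by (simp add: abs_mult mult_ac)
      from nn_integral_local_bound[where f = "\<lambda>x. g (x + s *\<^sub>R v)" and k = "\<lambda>x. \<phi> x * (g (x + s *\<^sub>R v) \<bullet> v)" and M = "M * norm v" and R = r] this
      show ?thesis
        using M(1) nn_integral_lborel_shift[of "\<lambda>x. ennreal ((norm (g x))\<^sup>2)" "s *\<^sub>R v"] by simp
    qed
    note * = slab_Fubini[of "\<lambda>s x. \<phi> x * (g (x + s *\<^sub>R v) \<bullet> v)", OF _ C le]
    show "(LBINT s:{0..1}. (LBINT x. \<phi> x * (g (x + s *\<^sub>R v) \<bullet> v))) = (LBINT x. \<phi> x * h x)"
      by (subst *(1)) (auto simp: h_def)
    show "integrable lborel (\<lambda>x. \<phi> x * h x)"
      using *(2) by (simp add: h_def)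
  qed
  have "AE x in lborel. u (x + v) - u x - h x = 0"
  proof (rule fundamental_lemma)
    fix a b :: "real^3"
    obtain r where r: "cbox a b \<subseteq> cball 0 r"
      using bounded_subset_ballD[OF bounded_cbox, of a b 0] ball_subset_cball by blast
    then have ind: "\<bar>indicator (cbox a b) x\<bar> \<le> (1::real) * indicator (cball 0 r) x" for x :: "real^3"
      by (auto simp: indicator_def)
    have "integrable lborel (\<lambda>x. indicator (cbox a b) x * h x)"
      using A(2)[of "indicator (cbox a b)" 1 r] ind by auto
    moreover have "integrable lborel (\<lambda>x. indicator (cbox a b) x * u (x + c))" for c
      using ind by (intro integrable_local_bound[OF ushift[of c], of _ 1 r])
        (auto simp: abs_mult intro!: mult_right_mono)
    note this[of v] this[of 0]
    ultimately show "set_integrable lborel (cbox a b) (\<lambda>x. u (x + v) - u x - h x)"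
      by (simp add: set_integrable_def algebra_simps)
  next
    fix \<phi> D assume t: "test_function \<phi> D"
    then obtain M r where M: "M \<ge> 0" "\<And>x. \<bar>\<phi> x\<bar> \<le> M * indicator (cball 0 r) x"
      "\<And>x. norm (D x) \<le> M * indicator (cball 0 r) x"
      using test_function_bounds[OF t] by blast
    note [measurable] = test_function_measurable[OF t]
    have cont: "continuous_on UNIV D" using t by (simp add: test_function_iff C1_gradient_def)
    \<comment> \<open>The supports of all shifts by \<open>s *\<^sub>R v\<close> with s between 0
      and 1 lie in one ball of this radius.\<close>
    let ?r = "r + norm v"
    have ind: "(indicator (cball 0 r) (y - s *\<^sub>R v) :: real) \<le> indicator (cball 0 ?r) y" if "s \<in> {0..1}" for s and y :: "real^3"
    proof -
      have "norm y \<le> norm (y - s *\<^sub>R v) + norm (s *\<^sub>R v)"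
        using norm_triangle_ineq[of "y - s *\<^sub>R v" "s *\<^sub>R v"] by simp
      also have "norm (s *\<^sub>R v) \<le> norm v" using that by (simp add: mult_left_le_one_le)
      finally show ?thesis by (auto simp: indicator_def)
    qed
    have Dle: "norm (D (y - s *\<^sub>R v)) \<le> M * indicator (cball 0 ?r) y" if "s \<in> {0..1}" for s y
      using order_trans[OF M(3) mult_left_mono[OF ind[OF that] M(1)]] .
    note t_shift = test_function_integrable[OF test_function_shift[OF t]]
    have int_u: "integrable lborel (\<lambda>y. \<phi> (y - c) * u y)" for c
      using t_shift(1)[OF u, of c] by simp
    have weak: "(LBINT x. \<phi> x * (g (x + s *\<^sub>R v) \<bullet> v)) = - (LBINT y. u y * (D (y - s *\<^sub>R v) \<bullet> v))"
      if s: "s \<in> {0..1}" for s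
    proof -
      have "(LBINT x. \<phi> x * (g (x + s *\<^sub>R v) \<bullet> v)) = (LBINT y. \<phi> (y - s *\<^sub>R v) * (g y \<bullet> v))"
        using integral_lborel_shift[of "\<lambda>y. \<phi> (y - s *\<^sub>R v) * (g y \<bullet> v)" "s *\<^sub>R v"] by simp
      also have "\<dots> = (LBINT y. \<phi> (y - s *\<^sub>R v) *\<^sub>R g y) \<bullet> v"
        using t_shift(1)[OF g, of "s *\<^sub>R v"] by (subst integral_inner_left[symmetric]) auto
      also have "(LBINT y. \<phi> (y - s *\<^sub>R v) *\<^sub>R g y) = - (LBINT y. u y *\<^sub>R D (y - s *\<^sub>R v))"
        using w test_function_shift[OF t, of "s *\<^sub>R v"] unfolding weak_gradient_def by fastforce
      also have "\<dots> \<bullet> v = - (LBINT y. u y * (D (y - s *\<^sub>R v) \<bullet> v))"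
        using t_shift(2)[OF u, of "s *\<^sub>R v"]
        by (subst inner_minus_left, subst integral_inner_left[symmetric]) auto
      finally show ?thesis .
    qed
    have FTC: "(LBINT s:{0..1}. D (y - s *\<^sub>R v) \<bullet> v) = \<phi> y - \<phi> (y - v)" for y
    proof -
      have "((\<lambda>s. - \<phi> (y - s *\<^sub>R v)) has_real_derivative D (y - s *\<^sub>R v) \<bullet> v) (at s)" for s
      proof -
        have "((\<lambda>s. y - s *\<^sub>R v) has_derivative (\<lambda>t. - (t *\<^sub>R v))) (at s)"
          by (auto intro!: derivative_eq_intros)
        moreover have "(\<phi> has_derivative (\<lambda>h. h \<bullet> D (y - s *\<^sub>R v))) (at (y - s *\<^sub>R v))"
          using t by (simp add: test_function_def gderiv_def)
        ultimately have "((\<lambda>s. \<phi> (y - s *\<^sub>R v)) has_derivative (\<lambda>t. - (t *\<^sub>R v) \<bullet> D (y - s *\<^sub>R v))) (at s)"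
          by (rule has_derivative_compose)
        from has_derivative_minus[OF this] show ?thesis
          by (simp add: has_field_derivative_def inner_commute mult_commute_abs)
      qed
      moreover have "isCont (\<lambda>s. D (y - s *\<^sub>R v) \<bullet> v) s" for s
      proof -
        have "continuous_on UNIV (\<lambda>s. D (y - s *\<^sub>R v) \<bullet> v)"
          by (intro continuous_intros continuous_on_compose2[OF cont]) auto
        then show ?thesis by (simp add: continuous_on_eq_continuous_at)
      qed
      ultimately have "(LBINT s. D (y - s *\<^sub>R v) \<bullet> v * indicator {0..1} s) = - \<phi> (y - 1 *\<^sub>R v) - - \<phi> (y - 0 *\<^sub>R v)"
        by (intro integral_FTC_Icc_real) auto
      then show ?thesis by (simp add: set_lebesgue_integral_def mult.commute)
    qed
    have "(LBINT x. \<phi> x * h x) = (LBINT s:{0..1}. (LBINT x. \<phi> x * (g (x + s *\<^sub>R v) \<bullet> v)))"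
      using A(1)[OF _ M(1,2)] by simp
    also have "\<dots> = (LBINT s:{0..1}. - (LBINT y. u y * (D (y - s *\<^sub>R v) \<bullet> v)))"
      by (intro set_lebesgue_integral_cong) (auto simp: weak)
    also have "\<dots> = - (LBINT s:{0..1}. (LBINT y. u y * (D (y - s *\<^sub>R v) \<bullet> v)))"
      by (simp add: set_lebesgue_integral_def)
    also have "(LBINT s:{0..1}. (LBINT y. u y * (D (y - s *\<^sub>R v) \<bullet> v))) =
       (LBINT y. (LBINT s:{0..1}. u y * (D (y - s *\<^sub>R v) \<bullet> v)))"
    proof (rule slab_Fubini)
      let ?C = "ennreal (M * norm v) * (emeasure lborel (cball (0::real^3) ?r) + (\<integral>\<^sup>+x. ennreal ((norm (u x))\<^sup>2) \<partial>lborel))"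
      show "?C < \<infinity>"
        using square_integrable_nn_integral[OF u] emeasure_lborel_cball_finite[of "0::real^3" ?r]
        by (simp add: ennreal_mult_less_top less_top)
      show "(\<integral>\<^sup>+y. ennreal \<bar>u y * (D (y - s *\<^sub>R v) \<bullet> v)\<bar> \<partial>lborel) \<le> ?C" if s: "s \<in> {0..1}" for s
      proof -
        have "\<bar>u y * (D (y - s *\<^sub>R v) \<bullet> v)\<bar> \<le> (M * norm v) * indicator (cball 0 ?r) y * norm (u y)" for y
        proof -
          have "\<bar>D (y - s *\<^sub>R v) \<bullet> v\<bar> \<le> (M * indicator (cball 0 ?r) y) * norm v"
            using order_trans[OF Cauchy_Schwarz_ineq2 mult_right_mono[OF Dle[OF s]]] by simp
          from mult_left_mono[OF this, of "\<bar>u y\<bar>"] show ?thesis by (simp add: abs_mult mult_ac)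
        qed
        from nn_integral_local_bound[where f = u and k = "\<lambda>y. u y * (D (y - s *\<^sub>R v) \<bullet> v)" and M = "M * norm v" and R = ?r] this
        show ?thesis using M(1) by simp
      qed
    qed measurable
    also have "\<dots> = (LBINT y. \<phi> y * u y - \<phi> (y - v) * u y)"
      by (simp add: FTC algebra_simps)
    also have "\<dots> = (LBINT y. \<phi> y * u y) - (LBINT y. \<phi> (y - v) * u y)"
      using int_u[of 0] int_u[of v] by simp
    also have "(LBINT y. \<phi> (y - v) * u y) = (LBINT x. \<phi> x * u (x + v))"
      using integral_lborel_shift[of "\<lambda>y. \<phi> (y - v) * u y" v] by simp
    finally have *: "(LBINT x. \<phi> x * h x) = (LBINT x. \<phi> x * u (x + v)) - (LBINT x. \<phi> x * u x)"
      by simp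
    have "integrable lborel (\<lambda>x. \<phi> x * u (x + c))" for c
      using test_function_integrable(1)[OF t ushift[of c]] by simp
    note this[of v] this[of 0]
    moreover have "integrable lborel (\<lambda>x. \<phi> x * h x)" using A(2)[OF _ M(1,2)] by simp
    ultimately show "(LBINT x. \<phi> x * (u (x + v) - u x - h x)) = 0"
      using * by (simp add: algebra_simps)
  qed
  then show ?thesis by (simp add: h_def)
qed

text \<open>Each component of the difference integrates to zero against every test function. This
  makes the arbitrary choice in \<open>wgrad\<close> harmless and gives its linearity up to null
  sets.\<close>

lemma weak_gradient_unique:
  assumes g: "square_integrable g" "weak_gradient u g" and h: "square_integrable h" "weak_gradient u h"
  shows "AE x in lborel. g x = h x"
proof -
  have [measurable]: "g \<in> borel_measurable borel" "h \<in> borel_measurable borel"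
    using g h by (auto simp: square_integrable_def)
  have "AE x in lborel. g x $ i - h x $ i = 0" for i
  proof (rule fundamental_lemma)
    fix a b :: "real^3"
    obtain r where r: "cbox a b \<subseteq> cball 0 r"
      using bounded_subset_ballD[OF bounded_cbox, of a b 0] ball_subset_cball by blast
    have "integrable lborel (\<lambda>x. (indicator (cbox a b) x *\<^sub>R f x) \<bullet> axis i 1)" if "square_integrable f" for f :: "real^3 \<Rightarrow> real^3"
      using that r by (intro integrable_inner_left integrable_local_bound[OF that, of _ 1 r])
        (auto simp: square_integrable_def indicator_def)
    from this[OF g(1)] this[OF h(1)]
    show "set_integrable lborel (cbox a b) (\<lambda>x. g x $ i - h x $ i)"
      by (simp add: set_integrable_def inner_axis right_diff_distrib)
  next
    fix \<phi> D assume t: "test_function \<phi> D"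
    note I = test_function_integrable(1)[OF t g(1)] test_function_integrable(1)[OF t h(1)]
    have "(LBINT x. u x *\<^sub>R D x) = - (LBINT x. \<phi> x *\<^sub>R k x)" if "weak_gradient u k" for k
      using that t unfolding weak_gradient_def by blast
    from this[OF g(2)] this[OF h(2)] have "(LBINT x. \<phi> x *\<^sub>R g x) \<bullet> axis i 1 = (LBINT x. \<phi> x *\<^sub>R h x) \<bullet> axis i 1"
      by simp
    then have "(LBINT x. (\<phi> x *\<^sub>R g x) \<bullet> axis i 1) = (LBINT x. (\<phi> x *\<^sub>R h x) \<bullet> axis i 1)"
      by (simp only: integral_inner_left[OF I(1)] integral_inner_left[OF I(2)])
    moreover have "integrable lborel (\<lambda>x. (\<phi> x *\<^sub>R g x) \<bullet> axis i 1)" "integrable lborel (\<lambda>x. (\<phi> x *\<^sub>R h x) \<bullet> axis i 1)"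
      using I by (intro integrable_inner_left; simp)+
    ultimately show "(LBINT x. \<phi> x * (g x $ i - h x $ i)) = 0"
      by (simp add: inner_axis right_diff_distrib)
  qed
  then have "AE x in lborel. \<forall>i\<in>UNIV. g x $ i - h x $ i = 0"
    by (intro AE_finite_allI) auto
  then show ?thesis by (auto simp: vec_eq_iff)
qed

section \<open>Cube integrability from estimates of translates\<close>

lemma square_LINT_le:
  fixes F :: "real \<Rightarrow> real"
  assumes [measurable]: "F \<in> borel_measurable borel"
  shows "ennreal ((LBINT s:{0..1}. F s)\<^sup>2) \<le> (\<integral>\<^sup>+s. ennreal ((F s)\<^sup>2) * indicator {0..1} s \<partial>lborel)"
proof -
  have "ennreal \<bar>LBINT s:{0..1}. F s\<bar> \<le> (\<integral>\<^sup>+s. (ennreal \<bar>F s\<bar> * indicator {0..1} s) * indicator {0..1} s \<partial>lborel)"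
  proof (cases "set_integrable lborel {0..1} F")
    case True
    then have "ennreal (norm (LBINT s:{0..1}. F s)) \<le> (\<integral>\<^sup>+s. ennreal (norm (indicator {0..1} s *\<^sub>R F s)) \<partial>lborel)"
      unfolding set_lebesgue_integral_def set_integrable_def by (rule integral_norm_bound_ennreal)
    also have "\<dots> = (\<integral>\<^sup>+s. (ennreal \<bar>F s\<bar> * indicator {0..1} s) * indicator {0..1} s \<partial>lborel)"
      by (intro nn_integral_cong) (auto split: split_indicator)
    finally show ?thesis by simp
  next
    \<comment> \<open>The Bochner integral of a function that is not integrable is zero by
      convention, so the left-hand side vanishes.\<close>
    case False
    then show ?thesis by (simp add: set_lebesgue_integral_def set_integrable_def not_integrable_integral_eq)
  qed
  then have "(ennreal \<bar>LBINT s:{0..1}. F s\<bar>)\<^sup>2 \<le> (\<integral>\<^sup>+s. (ennreal \<bar>F s\<bar> * indicator {0..1} s) * indicator {0..1} s \<partial>lborel)\<^sup>2"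
    by (intro power_mono) auto
  also have "\<dots> \<le> (\<integral>\<^sup>+s. (ennreal \<bar>F s\<bar> * indicator {0..1} s)\<^sup>2 \<partial>lborel) * (\<integral>\<^sup>+s. (indicator {0..1::real} s)\<^sup>2 \<partial>lborel)"
    by (rule Cauchy_Schwarz_nn_integral) measurable
  also have "(\<integral>\<^sup>+s. (indicator {0..1::real} s)\<^sup>2 \<partial>lborel) = (\<integral>\<^sup>+s. indicator {0..1::real} s \<partial>lborel)"
    by (intro nn_integral_cong) (auto split: split_indicator)
  also have "\<dots> = 1" by simp
  also have "(\<integral>\<^sup>+s. (ennreal \<bar>F s\<bar> * indicator {0..1} s)\<^sup>2 \<partial>lborel) = (\<integral>\<^sup>+s. ennreal ((F s)\<^sup>2) * indicator {0..1} s \<partial>lborel)"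
    by (intro nn_integral_cong) (auto simp: ennreal_power split: split_indicator)
  finally show ?thesis by (simp add: ennreal_power)
qed

text \<open>The translation identity is squared, the square is moved inside the integral over s by
  Cauchy-Schwarz, and the integral over x is taken first: by translation invariance it does not
  depend on s.\<close>

lemma translation_estimate:
  assumes u: "square_integrable u" and g: "square_integrable g" and w: "weak_gradient u g"
  shows "(\<integral>\<^sup>+x. ennreal ((u (x + v) - u x)\<^sup>2) \<partial>lborel) \<le> ennreal ((norm v)\<^sup>2) * (\<integral>\<^sup>+x. ennreal ((norm (g x))\<^sup>2) \<partial>lborel)"
proof -
  have [measurable]: "u \<in> borel_measurable borel" "g \<in> borel_measurable borel"
    using u g by (auto simp: square_integrable_def)
  let ?G = "\<integral>\<^sup>+x. ennreal ((norm (g x))\<^sup>2) \<partial>lborel"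
  have "(\<integral>\<^sup>+x. ennreal ((u (x + v) - u x)\<^sup>2) \<partial>lborel) \<le>
      (\<integral>\<^sup>+x. (\<integral>\<^sup>+s. ennreal ((g (x + s *\<^sub>R v) \<bullet> v)\<^sup>2) * indicator {0..1} s \<partial>lborel) \<partial>lborel)"
  proof (rule nn_integral_mono_AE)
    show "AE x in lborel. ennreal ((u (x + v) - u x)\<^sup>2) \<le>
        (\<integral>\<^sup>+s. ennreal ((g (x + s *\<^sub>R v) \<bullet> v)\<^sup>2) * indicator {0..1} s \<partial>lborel)"
      using translation_identity[OF u g w, of v]
    proof eventually_elim
      case (elim x)
      show ?case unfolding elim by (rule square_LINT_le) measurable
    qed
  qed
  also have "\<dots> = (\<integral>\<^sup>+s. (\<integral>\<^sup>+x. ennreal ((g (x + s *\<^sub>R v) \<bullet> v)\<^sup>2) * indicator {0..1} s \<partial>lborel) \<partial>lborel)"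
    by (rule lborel_pair.Fubini') measurable
  also have "\<dots> \<le> (\<integral>\<^sup>+s. (ennreal ((norm v)\<^sup>2) * ?G) * indicator {0..1::real} s \<partial>lborel)"
  proof (rule nn_integral_mono)
    fix s :: real
    have le: "((g y \<bullet> v)\<^sup>2) \<le> (norm v)\<^sup>2 * (norm (g y))\<^sup>2" for y
      using power_mono[OF Cauchy_Schwarz_ineq2[of "g y" v], of 2] by (simp add: power_mult_distrib mult.commute)
    have "(\<integral>\<^sup>+x. ennreal ((g (x + s *\<^sub>R v) \<bullet> v)\<^sup>2) * indicator {0..1} s \<partial>lborel) =
       (\<integral>\<^sup>+x. ennreal ((g x \<bullet> v)\<^sup>2) * indicator {0..1} s \<partial>lborel)"
      by (rule nn_integral_lborel_shift) measurable
    also have "\<dots> \<le> (\<integral>\<^sup>+x. (ennreal ((norm v)\<^sup>2) * ennreal ((norm (g x))\<^sup>2)) * indicator {0..1} s \<partial>lborel)"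
      using le by (intro nn_integral_mono mult_right_mono) (auto simp: ennreal_mult'[symmetric] intro!: ennreal_leI)
    also have "\<dots> = (ennreal ((norm v)\<^sup>2) * ?G) * indicator {0..1} s"
      by (simp add: nn_integral_multc nn_integral_cmult)
    finally show "(\<integral>\<^sup>+x. ennreal ((g (x + s *\<^sub>R v) \<bullet> v)\<^sup>2) * indicator {0..1} s \<partial>lborel) \<le> (ennreal ((norm v)\<^sup>2) * ?G) * indicator {0..1} s" .
  qed
  also have "\<dots> = ennreal ((norm v)\<^sup>2) * ?G"
    by (simp add: nn_integral_cmult_indicator)
  finally show ?thesis .
qed

lemma emeasure_cube:
  assumes "r \<ge> 0"
  shows "emeasure lborel (cbox c (c + r *\<^sub>R One) :: (real^3) set) = ennreal (r ^ 3)"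
proof -
  have "(\<Prod>b\<in>Basis. (r *\<^sub>R (One :: real^3)) \<bullet> b) = (\<Prod>b\<in>(Basis :: (real^3) set). r)"
    by (intro prod.cong) (auto simp: inner_sum_left inner_Basis)
  then show ?thesis
    using assms by (simp add: emeasure_lborel_cbox_eq inner_add_left inner_Basis inner_sum_left)
qed

lemma norm_cube_le:
  assumes "v \<in> cbox 0 (r *\<^sub>R One :: real^3)"
  shows "(norm v)\<^sup>2 \<le> 3 * r\<^sup>2"
proof -
  have "0 \<le> v $ i \<and> v $ i \<le> r" for i
  proof -
    have "0 \<le> v \<bullet> b \<and> v \<bullet> b \<le> r" if "b \<in> Basis" for b
      using assms that by (simp add: mem_box inner_sum_left inner_Basis)
    from this[of "axis i 1"] show ?thesis by (simp add: inner_axis axis_in_Basis_iff)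
  qed
  then have "(v $ i)\<^sup>2 \<le> r\<^sup>2" for i by (intro power_mono) auto
  note this[of 1] this[of 2] this[of 3]
  then show ?thesis by (simp add: norm_vec_def L2_set_def sum_3 real_sqrt_pow2)
qed

text \<open>
  A function with a square integrable weak gradient is close to its averages over cubes of side
  \<open>r\<close>, which are bounded by \<open>r\<^sup>-\<^sup>3\<^sup>/\<^sup>2\<close>; hence it is small in \<open>L\<^sup>2\<close> where it is large.
\<close>

lemma large_values_estimate:
  assumes u: "square_integrable u" and g: "square_integrable g" and w: "weak_gradient u g"
    and r: "r > 0" and l: "l \<ge> 0" and lr: "4 * (LBINT x. (u x)\<^sup>2) \<le> l\<^sup>2 * r ^ 3"
  shows "(\<integral>\<^sup>+x. ennreal ((u x)\<^sup>2) * indicator {x. \<bar>u x\<bar> \<ge> l} x \<partial>lborel) \<le>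
    ennreal (12 * r\<^sup>2) * (\<integral>\<^sup>+x. ennreal ((norm (g x))\<^sup>2) \<partial>lborel)"
proof -
  have [measurable]: "u \<in> borel_measurable borel" "g \<in> borel_measurable borel"
    using u g by (auto simp: square_integrable_def)
  let ?G = "\<integral>\<^sup>+x. ennreal ((norm (g x))\<^sup>2) \<partial>lborel"
  define W where "W = (LBINT x. (u x)\<^sup>2)"
  have W0: "W \<ge> 0" by (simp add: W_def)
  have W: "(\<integral>\<^sup>+x. ennreal ((u x)\<^sup>2) \<partial>lborel) = ennreal W"
    unfolding W_def using u by (intro nn_integral_eq_integral) (auto simp: square_integrable_def)
  define B where "B = cbox 0 (r *\<^sub>R One :: real^3)"
  have [measurable]: "B \<in> sets borel" by (simp add: B_def)
  have B: "emeasure lborel B = ennreal (r ^ 3)"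
    using emeasure_cube[of r 0] r by (simp add: B_def)
  have pt: "ennreal ((u x)\<^sup>2) * indicator {x. \<bar>u x\<bar> \<ge> l} x \<le> ennreal (4 / r ^ 3) * (\<integral>\<^sup>+v. ennreal ((u (x + v) - u x)\<^sup>2) * indicator B v \<partial>lborel)" for x
  proof (cases "\<bar>u x\<bar> \<ge> l")
    case True
    let ?I = "\<integral>\<^sup>+v. ennreal ((u (x + v) - u x)\<^sup>2) * indicator B v \<partial>lborel"
    have "l\<^sup>2 \<le> (u x)\<^sup>2"
      using power_mono[OF True l, of 2] by simp
    then have "l\<^sup>2 * r ^ 3 \<le> (u x)\<^sup>2 * r ^ 3"
      using r by (intro mult_right_mono) auto
    then have "4 * W \<le> (u x)\<^sup>2 * r ^ 3"
      using lr unfolding W_def by linarith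
    \<comment> \<open>This is the role of the factor 4 in \<open>lr\<close>: the contribution of the
      L^2 norm is at most half of the left-hand side below and can be absorbed.\<close>
    then have W2: "2 * W \<le> (u x)\<^sup>2 * r ^ 3 / 2" by simp
    have "ennreal ((u x)\<^sup>2 * r ^ 3) = (\<integral>\<^sup>+v. ennreal ((u x)\<^sup>2) * indicator B v \<partial>lborel)"
      using r by (simp add: nn_integral_cmult_indicator B ennreal_mult)
    also have "\<dots> \<le> (\<integral>\<^sup>+v. 2 * (ennreal ((u (x + v) - u x)\<^sup>2) * indicator B v) + 2 * ennreal ((u (v + x))\<^sup>2) \<partial>lborel)"
    proof (rule nn_integral_mono)
      fix v
      have "b\<^sup>2 \<le> 2 * (a - b)\<^sup>2 + 2 * a\<^sup>2" for a b :: real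
        \<comment> \<open>The difference of the two sides is exactly the square of 2a - b. Below,
          the term in u(x + v) is integrated over the whole space instead of the cube.\<close>
        using zero_le_power2[of "2 * a - b"] by (simp add: power2_eq_square algebra_simps)
      from this[of "u x" "u (x + v)"]
      have "(u x)\<^sup>2 \<le> 2 * (u (x + v) - u x)\<^sup>2 + 2 * (u (v + x))\<^sup>2"
        by (simp add: add.commute)
      from ennreal_leI[OF this]
      have "ennreal ((u x)\<^sup>2) \<le> 2 * ennreal ((u (x + v) - u x)\<^sup>2) + 2 * ennreal ((u (v + x))\<^sup>2)"
        by (simp add: ennreal_mult)
      then show "ennreal ((u x)\<^sup>2) * indicator B v \<le> 2 * (ennreal ((u (x + v) - u x)\<^sup>2) * indicator B v) + 2 * ennreal ((u (v + x))\<^sup>2)"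
        by (auto split: split_indicator)
    qed
    also have "\<dots> = 2 * ?I + 2 * (\<integral>\<^sup>+v. ennreal ((u (v + x))\<^sup>2) \<partial>lborel)"
      by (simp add: nn_integral_add nn_integral_cmult)
    also have "(\<integral>\<^sup>+v. ennreal ((u (v + x))\<^sup>2) \<partial>lborel) = ennreal W"
      by (subst nn_integral_lborel_shift) (auto simp: W)
    also have "2 * ?I + 2 * ennreal W \<le> 2 * ?I + ennreal ((u x)\<^sup>2 * r ^ 3 / 2)"
    proof (rule add_left_mono)
      have "2 * ennreal W = ennreal (2 * W)" using W0 by (simp add: ennreal_mult)
      then show "2 * ennreal W \<le> ennreal ((u x)\<^sup>2 * r ^ 3 / 2)" using W2 by (simp only: ennreal_leI)
    qed
    also have "ennreal ((u x)\<^sup>2 * r ^ 3) = ennreal ((u x)\<^sup>2 * r ^ 3 / 2) + ennreal ((u x)\<^sup>2 * r ^ 3 / 2)"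
      using r by (subst ennreal_plus[symmetric]) auto
    finally have "ennreal ((u x)\<^sup>2 * r ^ 3 / 2) + ennreal ((u x)\<^sup>2 * r ^ 3 / 2) \<le> 2 * ?I + ennreal ((u x)\<^sup>2 * r ^ 3 / 2)" .
    then have "ennreal ((u x)\<^sup>2 * r ^ 3 / 2) \<le> 2 * ?I"
      by (simp add: add.commute ennreal_add_left_cancel_le)
    then have "ennreal (2 / r ^ 3) * ennreal ((u x)\<^sup>2 * r ^ 3 / 2) \<le> ennreal (2 / r ^ 3) * (2 * ?I)"
      by (rule mult_left_mono) simp
    moreover have "ennreal (2 / r ^ 3) * ennreal ((u x)\<^sup>2 * r ^ 3 / 2) = ennreal ((u x)\<^sup>2)"
      using r by (simp flip: ennreal_mult')
    moreover have "ennreal (2 / r ^ 3) * (2 * ?I) = ennreal (4 / r ^ 3) * ?I"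
    proof -
      have "ennreal (4 / r ^ 3) = ennreal (2 / r ^ 3) * ennreal 2"
        using r by (subst ennreal_mult[symmetric]) auto
      then show ?thesis by (simp add: mult.assoc)
    qed
    ultimately show ?thesis using True by simp
  qed simp
  have "(\<integral>\<^sup>+x. (\<integral>\<^sup>+v. ennreal ((u (x + v) - u x)\<^sup>2) * indicator B v \<partial>lborel) \<partial>lborel) =
     (\<integral>\<^sup>+v. (\<integral>\<^sup>+x. ennreal ((u (x + v) - u x)\<^sup>2) * indicator B v \<partial>lborel) \<partial>lborel)"
    by (rule lborel_pair.Fubini') measurable
  also have "\<dots> \<le> (\<integral>\<^sup>+v. (ennreal (3 * r\<^sup>2) * ?G) * indicator B v \<partial>lborel)"
  proof (rule nn_integral_mono)
    fix v
    have "(\<integral>\<^sup>+x. ennreal ((u (x + v) - u x)\<^sup>2) * indicator B v \<partial>lborel) =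
      (\<integral>\<^sup>+x. ennreal ((u (x + v) - u x)\<^sup>2) \<partial>lborel) * indicator B v"
      by (rule nn_integral_multc) measurable
    also have "\<dots> \<le> (ennreal (3 * r\<^sup>2) * ?G) * indicator B v"
    proof (cases "v \<in> B")
      case True
      then have "(norm v)\<^sup>2 \<le> 3 * r\<^sup>2" unfolding B_def by (rule norm_cube_le)
      then show ?thesis
        using order_trans[OF translation_estimate[OF u g w, of v] mult_right_mono[OF ennreal_leI]] True by simp
    qed simp
    finally show "(\<integral>\<^sup>+x. ennreal ((u (x + v) - u x)\<^sup>2) * indicator B v \<partial>lborel) \<le> (ennreal (3 * r\<^sup>2) * ?G) * indicator B v" .
  qed
  also have "\<dots> = (ennreal (3 * r\<^sup>2) * ?G) * ennreal (r ^ 3)"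
    using B by (simp add: nn_integral_cmult_indicator)
  finally have D: "(\<integral>\<^sup>+x. (\<integral>\<^sup>+v. ennreal ((u (x + v) - u x)\<^sup>2) * indicator B v \<partial>lborel) \<partial>lborel) \<le>
      ennreal (3 * r\<^sup>2) * ?G * ennreal (r ^ 3)" .
  have "(\<integral>\<^sup>+x. ennreal ((u x)\<^sup>2) * indicator {x. \<bar>u x\<bar> \<ge> l} x \<partial>lborel) \<le>
     (\<integral>\<^sup>+x. ennreal (4 / r ^ 3) * (\<integral>\<^sup>+v. ennreal ((u (x + v) - u x)\<^sup>2) * indicator B v \<partial>lborel) \<partial>lborel)"
    by (rule nn_integral_mono) (rule pt)
  also have "\<dots> = ennreal (4 / r ^ 3) * (\<integral>\<^sup>+x. (\<integral>\<^sup>+v. ennreal ((u (x + v) - u x)\<^sup>2) * indicator B v \<partial>lborel) \<partial>lborel)"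
    by (rule nn_integral_cmult) measurable
  also have "\<dots> \<le> ennreal (4 / r ^ 3) * (ennreal (3 * r\<^sup>2) * ?G * ennreal (r ^ 3))"
    using D by (rule mult_left_mono) simp
  also have "\<dots> = (ennreal (4 / r ^ 3) * ennreal (3 * r\<^sup>2) * ennreal (r ^ 3)) * ?G"
    by (simp only: ac_simps)
  \<comment> \<open>The pointwise bound gives 4 / r^3, the square of the diagonal of the cube is 3
    r^2, and the volume of the cube is r^3.\<close>
  also have "ennreal (4 / r ^ 3) * ennreal (3 * r\<^sup>2) * ennreal (r ^ 3) = ennreal (4 / r ^ 3 * (3 * r\<^sup>2) * r ^ 3)"
    using r by (simp only: ennreal_mult zero_le_mult_iff zero_le_divide_iff zero_le_power less_imp_le zero_le_numeral simp_thms)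
  also have "4 / r ^ 3 * (3 * r\<^sup>2) * r ^ 3 = 12 * r\<^sup>2"
    using r by simp
  finally show ?thesis .
qed

text \<open>The L^2 mass of \<open>u\<close> above the level 8^k is estimated with cubes of side R /
  4^k, for which l^2 r^3 = R^3 is the same for all k. This mass is of order 16^(-k), whereas
  \<bar>u\<bar> is at most 8 * 8^k up to the next level, so the levels sum up like a geometric
  series with ratio 1/2.\<close>

lemma H1_imp_cube_integrable:
  assumes u: "square_integrable u" and g: "square_integrable g" and w: "weak_gradient u g"
  shows "(\<integral>\<^sup>+x. ennreal (\<bar>u x\<bar> ^ 3) \<partial>lborel) < \<infinity>"
proof -
  have [measurable]: "u \<in> borel_measurable borel" "g \<in> borel_measurable borel"
    using u g by (auto simp: square_integrable_def)
  let ?G = "\<integral>\<^sup>+x. ennreal ((norm (g x))\<^sup>2) \<partial>lborel"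
  \<comment> \<open>At least one, so that R^3 \<ge> R, and at least four times the squared L^2 norm;
    together this is the smallness condition of \<open>large_values_estimate\<close> at every
    level.\<close>
  define R where "R = 1 + 4 * (LBINT x. (u x)\<^sup>2)"
  have R1: "R \<ge> 1" by (simp add: R_def)
  let ?f = "\<lambda>k x. ennreal (8 * 8 ^ k) * (ennreal ((u x)\<^sup>2) * indicator {x. \<bar>u x\<bar> \<ge> 8 ^ k} x)"
  have pt: "ennreal (\<bar>u x\<bar> ^ 3) \<le> ennreal ((u x)\<^sup>2) + (\<Sum>k. ?f k x)" for x
  proof (cases "\<bar>u x\<bar> \<le> 1")
    case True
    have "\<bar>u x\<bar> ^ 3 = \<bar>u x\<bar> * (u x)\<^sup>2" by (simp add: power3_eq_cube power2_eq_square)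
    also have "\<dots> \<le> 1 * (u x)\<^sup>2" using True by (intro mult_right_mono) auto
    finally show ?thesis by (auto intro: order_trans[OF ennreal_leI] add_increasing2)
  next
    case False
    \<comment> \<open>The least power of 8 exceeding \<bar>u x\<bar>. It is not the zeroth one since
      \<bar>u x\<bar> > 1, so its predecessor is the level to which x belongs.\<close>
    define n where "n = (LEAST n. \<bar>u x\<bar> < 8 ^ n)"
    have n: "\<bar>u x\<bar> < 8 ^ n"
      unfolding n_def by (rule LeastI_ex) (use real_arch_pow[of 8] in auto)
    with False obtain k where k: "n = Suc k" by (cases n) auto
    then have k2: "\<not> \<bar>u x\<bar> < 8 ^ k" using not_less_Least[of k "\<lambda>n. \<bar>u x\<bar> < 8 ^ n"] by (simp add: n_def)
    have "\<bar>u x\<bar> ^ 3 = \<bar>u x\<bar> * (u x)\<^sup>2" by (simp add: power3_eq_cube power2_eq_square)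
    also have "\<dots> \<le> (8 * 8 ^ k) * (u x)\<^sup>2" using n k by (intro mult_right_mono) auto
    finally have "ennreal (\<bar>u x\<bar> ^ 3) \<le> ennreal ((8 * 8 ^ k) * (u x)\<^sup>2)" by (rule ennreal_leI)
    also have "\<dots> = ?f k x" using k2 by (subst ennreal_mult) auto
    also have "\<dots> = (\<Sum>j\<in>{k}. ?f j x)" by simp
    also have "\<dots> \<le> (\<Sum>k. ?f k x)" by (rule sum_le_suminf) auto
    finally show ?thesis by (simp add: add_increasing)
  qed
  have term_le: "(\<integral>\<^sup>+x. ?f k x \<partial>lborel) \<le> ennreal (96 * R\<^sup>2 * (1/2) ^ k) * ?G" for k
  proof -
    have "4 * (LBINT x. (u x)\<^sup>2) \<le> R * 1" by (simp add: R_def)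
    also have "\<dots> \<le> R * R\<^sup>2" using R1 by (intro mult_left_mono) auto
    also have "\<dots> = (8 ^ k)\<^sup>2 * (R / 4 ^ k) ^ 3"
    proof -
      have "((8::real) ^ k)\<^sup>2 = (4 ^ k) ^ 3"
        by (simp add: power_mult[symmetric] mult.commute[of k] power_mult)
      then show ?thesis by (simp add: power_divide power2_eq_square power3_eq_cube)
    qed
    finally have "(\<integral>\<^sup>+x. ennreal ((u x)\<^sup>2) * indicator {x. \<bar>u x\<bar> \<ge> 8 ^ k} x \<partial>lborel) \<le> ennreal (12 * (R / 4 ^ k)\<^sup>2) * ?G"
      using R1 by (intro large_values_estimate[OF u g w]) auto
    then have "ennreal (8 * 8 ^ k) * (\<integral>\<^sup>+x. ennreal ((u x)\<^sup>2) * indicator {x. \<bar>u x\<bar> \<ge> 8 ^ k} x \<partial>lborel) \<le> ennreal (8 * 8 ^ k) * (ennreal (12 * (R / 4 ^ k)\<^sup>2) * ?G)"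
      by (rule mult_left_mono) simp
    also have "\<dots> = ennreal (8 * 8 ^ k * (12 * (R / 4 ^ k)\<^sup>2)) * ?G"
      by (subst ennreal_mult) (auto simp: mult.assoc)
    also have "8 * 8 ^ k * (12 * (R / 4 ^ k)\<^sup>2) = 96 * R\<^sup>2 * (1/2) ^ k"
    proof -
      have "((4::real) ^ k)\<^sup>2 = 8 ^ k * 2 ^ k"
        by (simp add: power_mult[symmetric] mult.commute[of k] power_mult flip: power_mult_distrib)
      then show ?thesis by (simp add: power_divide field_simps)
    qed
    finally show ?thesis by (subst nn_integral_cmult) auto
  qed
  have "(\<integral>\<^sup>+x. ennreal (\<bar>u x\<bar> ^ 3) \<partial>lborel) \<le> (\<integral>\<^sup>+x. ennreal ((u x)\<^sup>2) + (\<Sum>k. ?f k x) \<partial>lborel)"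
    by (rule nn_integral_mono) (rule pt)
  also have "\<dots> = (\<integral>\<^sup>+x. ennreal ((u x)\<^sup>2) \<partial>lborel) + (\<integral>\<^sup>+x. (\<Sum>k. ?f k x) \<partial>lborel)"
    by (rule nn_integral_add) measurable
  also have "(\<integral>\<^sup>+x. (\<Sum>k. ?f k x) \<partial>lborel) = (\<Sum>k. \<integral>\<^sup>+x. ?f k x \<partial>lborel)"
    by (rule nn_integral_suminf) measurable
  also have "(\<integral>\<^sup>+x. ennreal ((u x)\<^sup>2) \<partial>lborel) + (\<Sum>k. \<integral>\<^sup>+x. ?f k x \<partial>lborel) \<le>
      (\<integral>\<^sup>+x. ennreal ((u x)\<^sup>2) \<partial>lborel) + (\<Sum>k. ennreal (96 * R\<^sup>2 * (1/2) ^ k) * ?G)"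
    by (intro add_left_mono suminf_le term_le) auto
  also have "(\<Sum>k. ennreal (96 * R\<^sup>2 * (1/2) ^ k) * ?G) = (\<Sum>k. ennreal (96 * R\<^sup>2 * (1/2) ^ k)) * ?G"
    by (rule ennreal_suminf_multc)
  also have "(\<Sum>k. ennreal (96 * R\<^sup>2 * (1/2) ^ k)) = ennreal (\<Sum>k. 96 * R\<^sup>2 * (1/2) ^ k)"
    by (rule suminf_ennreal2) (auto intro!: summable_mult summable_geometric)
  also have "(\<integral>\<^sup>+x. ennreal ((u x)\<^sup>2) \<partial>lborel) + ennreal (\<Sum>k. 96 * R\<^sup>2 * (1/2) ^ k) * ?G < \<infinity>"
    using square_integrable_nn_integral[OF u] square_integrable_nn_integral[OF g]
    by (simp add: ennreal_mult_less_top less_top)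
  finally show ?thesis .
qed

subsection \<open>Integrability of the Hartree term\<close>

text \<open>Dyadic balls replace polar coordinates: where \<bar>z\<bar> exceeds 2^(-k-1) the
  integrand is at most 4 * 4^k, and the ball of radius 2^(-k) lies in a cube of volume 8 * 8^(-k),
  so the k-th contribution is at most 32 * 2^(-k). At the origin the integrand is 1/0 = 0.\<close>

lemma inverse_square_locally_integrable:
  "(\<integral>\<^sup>+z. ennreal (1 / (norm z)\<^sup>2) * indicator (cball 0 1) z \<partial>(lborel :: (real^3) measure)) < \<infinity>"
proof -
  have [measurable]: "cball (0::real^3) r \<in> sets borel" for r by simp
  let ?f = "\<lambda>k z. ennreal (4 * 4 ^ k) * indicator (cball (0::real^3) ((1/2) ^ k)) z"
  have pt: "ennreal (1 / (norm z)\<^sup>2) * indicator (cball 0 1) z \<le> (\<Sum>k. ?f k z)" for z :: "real^3"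
  proof (cases "0 < norm z \<and> norm z \<le> 1")
    case True
    define n where "n = (LEAST n. (1/2) ^ n < norm z)"
    have n: "(1/2) ^ n < norm z"
      unfolding n_def by (rule LeastI_ex) (use real_arch_pow_inv[of "norm z" "1/2"] True in auto)
    with True obtain k where k: "n = Suc k" by (cases n) auto
    then have k2: "norm z \<le> (1/2) ^ k" using not_less_Least[of k "\<lambda>n. (1/2) ^ n < norm z"] by (simp add: n_def not_less)
    have "1 / norm z \<le> 1 / ((1/2) ^ n)" using n True by (intro divide_left_mono mult_pos_pos) auto
    also have "\<dots> = 2 * 2 ^ k" by (simp add: k power_divide)
    finally have "(1 / norm z)\<^sup>2 \<le> (2 * 2 ^ k)\<^sup>2" by (rule power_mono) simp
    also have "(2 * 2 ^ k)\<^sup>2 = 4 * (4::real) ^ k"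
      by (simp add: power_mult_distrib power_mult[symmetric] mult.commute[of k] power_mult)
    finally have "ennreal (1 / (norm z)\<^sup>2) \<le> ennreal (4 * 4 ^ k)" by (simp add: power_divide ennreal_leI)
    also have "\<dots> = (\<Sum>j\<in>{k}. ?f j z)" using k2 by simp
    also have "\<dots> \<le> (\<Sum>k. ?f k z)" by (rule sum_le_suminf) auto
    finally show ?thesis using True by simp
  qed auto
  have ball: "emeasure lborel (cball (0::real^3) \<rho>) \<le> ennreal (8 * \<rho> ^ 3)" if "\<rho> \<ge> 0" for \<rho>
  proof -
    have "cball (0::real^3) \<rho> \<subseteq> cbox (- \<rho> *\<^sub>R One) (- \<rho> *\<^sub>R One + (2 * \<rho>) *\<^sub>R One)"
    proof
      fix x :: "real^3" assume "x \<in> cball 0 \<rho>"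
      then have "\<bar>x \<bullet> b\<bar> \<le> \<rho>" if "b \<in> Basis" for b using Basis_le_norm[OF that, of x] by simp
      then have "- \<rho> \<le> x \<bullet> b \<and> x \<bullet> b \<le> \<rho>" if "b \<in> Basis" for b using that by (simp add: abs_le_iff minus_le_iff)
      moreover have "- \<rho> *\<^sub>R One + (2 * \<rho>) *\<^sub>R One = \<rho> *\<^sub>R (One :: real^3)"
        by (simp only: scaleR_add_left[symmetric]) simp
      ultimately show "x \<in> cbox (- \<rho> *\<^sub>R One) (- \<rho> *\<^sub>R One + (2 * \<rho>) *\<^sub>R One)"
        by (simp only:) (simp add: mem_box inner_sum_left inner_Basis)
    qed
    then have "emeasure lborel (cball (0::real^3) \<rho>) \<le> emeasure lborel (cbox (- \<rho> *\<^sub>R One) (- \<rho> *\<^sub>R One + (2 * \<rho>) *\<^sub>R One :: real^3))"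
      by (rule emeasure_mono) simp
    also have "\<dots> = ennreal ((2 * \<rho>) ^ 3)" using that by (intro emeasure_cube) auto
    finally show ?thesis by (simp add: power_mult_distrib)
  qed
  have "(\<integral>\<^sup>+z. ennreal (1 / (norm z)\<^sup>2) * indicator (cball 0 1) z \<partial>(lborel :: (real^3) measure)) \<le> (\<integral>\<^sup>+z. (\<Sum>k. ?f k z) \<partial>lborel)"
    by (rule nn_integral_mono) (rule pt)
  also have "\<dots> = (\<Sum>k. \<integral>\<^sup>+z. ?f k z \<partial>lborel)"
    by (rule nn_integral_suminf) measurable
  also have "\<dots> \<le> (\<Sum>k. ennreal (32 * (1/2) ^ k))"
  proof (intro suminf_le)
    fix k
    have "(\<integral>\<^sup>+z. ?f k z \<partial>lborel) = ennreal (4 * 4 ^ k) * emeasure lborel (cball (0::real^3) ((1/2) ^ k))"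
      by (rule nn_integral_cmult_indicator) simp
    also have "\<dots> \<le> ennreal (4 * 4 ^ k) * ennreal (8 * ((1/2) ^ k) ^ 3)"
      using ball[of "(1/2) ^ k"] by (intro mult_left_mono) auto
    also have "\<dots> = ennreal (4 * 4 ^ k * (8 * ((1/2) ^ k) ^ 3))"
      by (subst ennreal_mult) auto
    also have "4 * 4 ^ k * (8 * ((1/2) ^ k) ^ 3) = 32 * (1/2 :: real) ^ k"
    proof -
      have "(4::real) ^ k = 2 ^ k * 2 ^ k" by (simp flip: power_mult_distrib)
      then show ?thesis by (simp add: power_divide power3_eq_cube)
    qed
    finally show "(\<integral>\<^sup>+z. ?f k z \<partial>lborel) \<le> ennreal (32 * (1/2) ^ k)" .
  qed auto
  also have "\<dots> = ennreal (\<Sum>k. 32 * (1/2) ^ k)"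
    by (rule suminf_ennreal2) (auto intro!: summable_mult summable_geometric)
  finally show ?thesis by (rule order_le_less_trans) simp
qed

text \<open>
  With \<open>c = \<bar>w x * w y\<bar>\<close> and \<open>t = 1 / norm (x - y)\<close> the integrand is \<open>c\<^sup>2 t \<le> c t\<^sup>2 + c\<^sup>3\<close>, and \<open>t\<^sup>2\<close>
  is locally integrable in three dimensions.
\<close>

lemma Coulomb_integrable:
  fixes w :: "real^3 \<Rightarrow> real"
  assumes [measurable]: "w \<in> borel_measurable borel"
    and w2: "(\<integral>\<^sup>+x. ennreal ((w x)\<^sup>2) \<partial>lborel) < \<infinity>" and w3: "(\<integral>\<^sup>+x. ennreal (\<bar>w x\<bar> ^ 3) \<partial>lborel) < \<infinity>"
  shows "integrable (lborel \<Otimes>\<^sub>M lborel) (\<lambda>(x, y). (w x)\<^sup>2 * (w y)\<^sup>2 / norm (x - y))"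
proof (rule integrableI_bounded)
  show "(\<lambda>(x, y). (w x)\<^sup>2 * (w y)\<^sup>2 / norm (x - y)) \<in> borel_measurable (lborel \<Otimes>\<^sub>M lborel)"
    by measurable
  let ?k = "\<lambda>z::real^3. ennreal (1 / (norm z)\<^sup>2) * indicator (cball 0 1) z"
  let ?W2 = "\<integral>\<^sup>+x. ennreal ((w x)\<^sup>2) \<partial>lborel" and ?W3 = "\<integral>\<^sup>+x. ennreal (\<bar>w x\<bar> ^ 3) \<partial>lborel"
    and ?K = "\<integral>\<^sup>+z. ?k z \<partial>lborel"
  have cb [measurable]: "cball (0::real^3) 1 \<in> sets borel" by simp
  have [measurable]: "?k \<in> borel_measurable borel" by measurable
  have pt: "ennreal (norm ((w x)\<^sup>2 * (w y)\<^sup>2 / norm (x - y))) \<le>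
      ennreal ((w x)\<^sup>2) * ennreal ((w y)\<^sup>2) + ennreal (\<bar>w x\<bar> ^ 3) * ennreal (\<bar>w y\<bar> ^ 3)
      + (ennreal ((w x)\<^sup>2) * ?k (y - x) + ennreal ((w y)\<^sup>2) * ?k (x - y))" for x y
  proof -
    define t where "t = 1 / norm (x - y)"
    define c where "c = \<bar>w x\<bar> * \<bar>w y\<bar>"
    have t0: "t \<ge> 0" and c0: "c \<ge> 0" by (simp_all add: t_def c_def)
    have c2: "c\<^sup>2 = (w x)\<^sup>2 * (w y)\<^sup>2" by (simp add: c_def power_mult_distrib)
    have c3: "c ^ 3 = \<bar>w x\<bar> ^ 3 * \<bar>w y\<bar> ^ 3" by (simp add: c_def power_mult_distrib)
    have cle: "c \<le> (w x)\<^sup>2 + (w y)\<^sup>2"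
    proof -
      have "2 * c \<le> (w x)\<^sup>2 + (w y)\<^sup>2"
        using sum_squares_bound[of "\<bar>w x\<bar>" "\<bar>w y\<bar>"] by (simp add: c_def mult.assoc)
      then show ?thesis using c0 by linarith
    qed
    have eq: "norm ((w x)\<^sup>2 * (w y)\<^sup>2 / norm (x - y)) = c\<^sup>2 * t" by (simp add: c2 t_def abs_mult)
    have tk: "norm (y - x) = norm (x - y)" by (rule norm_minus_commute)
    have e2: "ennreal ((w x)\<^sup>2) * ennreal ((w y)\<^sup>2) = ennreal (c\<^sup>2)" by (simp add: c2 ennreal_mult)
    have e3: "ennreal (\<bar>w x\<bar> ^ 3) * ennreal (\<bar>w y\<bar> ^ 3) = ennreal (c ^ 3)" by (simp add: c3 ennreal_mult)
    show ?thesis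
    proof (cases "norm (x - y) \<le> 1")
      case True
      have "c * t \<le> t\<^sup>2 + c\<^sup>2"
        using sum_squares_bound[of c t] mult_nonneg_nonneg[OF c0 t0] unfolding mult.assoc by linarith
      then have "c * (c * t) \<le> c * (t\<^sup>2 + c\<^sup>2)" using c0 by (rule mult_left_mono)
      also have "\<dots> = c * t\<^sup>2 + c ^ 3" by (simp add: power3_eq_cube power2_eq_square algebra_simps)
      also have "c * t\<^sup>2 \<le> ((w x)\<^sup>2 + (w y)\<^sup>2) * t\<^sup>2" using cle by (rule mult_right_mono) simp
      finally have "c\<^sup>2 * t \<le> c\<^sup>2 + c ^ 3 + ((w x)\<^sup>2 * t\<^sup>2 + (w y)\<^sup>2 * t\<^sup>2)"
        by (simp add: power2_eq_square algebra_simps add_increasing)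
      then have "ennreal (c\<^sup>2 * t) \<le> ennreal (c\<^sup>2) + ennreal (c ^ 3) + (ennreal ((w x)\<^sup>2) * ennreal (t\<^sup>2) + ennreal ((w y)\<^sup>2) * ennreal (t\<^sup>2))"
      proof -
        have "ennreal (c\<^sup>2 + c ^ 3 + ((w x)\<^sup>2 * t\<^sup>2 + (w y)\<^sup>2 * t\<^sup>2)) =
          ennreal (c\<^sup>2) + ennreal (c ^ 3) + (ennreal ((w x)\<^sup>2) * ennreal (t\<^sup>2) + ennreal ((w y)\<^sup>2) * ennreal (t\<^sup>2))"
          using c0 by (simp add: ennreal_mult)
        moreover assume "c\<^sup>2 * t \<le> c\<^sup>2 + c ^ 3 + ((w x)\<^sup>2 * t\<^sup>2 + (w y)\<^sup>2 * t\<^sup>2)"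
        ultimately show ?thesis using ennreal_leI by metis
      qed
      moreover have "y - x \<in> cball 0 1" "x - y \<in> cball 0 1"
        using True tk by (simp_all only: mem_cball_0)
      ultimately show ?thesis unfolding eq e2 e3 tk by (simp add: tk t_def power_divide del: mem_cball)
    next
      case False
      \<comment> \<open>Away from the diagonal the kernel is at most one, and the term
        \<open>c\<^sup>2\<close> of the bound is enough; its integral is a product of two finite
        integrals.\<close>
      then have "t \<le> 1" by (auto simp: t_def divide_le_eq_1)
      then have "c\<^sup>2 * t \<le> c\<^sup>2 * 1" by (rule mult_left_mono) simp
      then have "ennreal (c\<^sup>2 * t) \<le> ennreal (c\<^sup>2)" by (simp add: ennreal_leI)
      then show ?thesis unfolding eq e2 e3 by (simp add: add_increasing2)
    qed
  qed
  have shift: "(\<integral>\<^sup>+x. k (x - y) \<partial>lborel) = (\<integral>\<^sup>+x. k x \<partial>lborel)"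
    if "k \<in> borel_measurable borel" for k :: "real^3 \<Rightarrow> ennreal" and y
    using nn_integral_lborel_shift[OF that, of "- y"] by simp
  \<comment> \<open>A translation in one variable turns each term of the bound into a product of two
    integrals, so no term has to be estimated as a genuine convolution.\<close>
  have prod: "(\<integral>\<^sup>+z. f (fst z) * g (snd z) \<partial>(lborel \<Otimes>\<^sub>M lborel)) = (\<integral>\<^sup>+x. f x \<partial>lborel) * (\<integral>\<^sup>+y. g y \<partial>lborel)"
    and conv_x: "(\<integral>\<^sup>+z. f (fst z) * g (snd z - fst z) \<partial>(lborel \<Otimes>\<^sub>M lborel)) = (\<integral>\<^sup>+x. f x \<partial>lborel) * (\<integral>\<^sup>+y. g y \<partial>lborel)"
    and conv_y: "(\<integral>\<^sup>+z. f (snd z) * g (fst z - snd z) \<partial>(lborel \<Otimes>\<^sub>M lborel)) = (\<integral>\<^sup>+x. f x \<partial>lborel) * (\<integral>\<^sup>+y. g y \<partial>lborel)"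
    if [measurable]: "f \<in> borel_measurable borel" "g \<in> borel_measurable borel" for f g :: "real^3 \<Rightarrow> ennreal"
  proof -
    show "(\<integral>\<^sup>+z. f (fst z) * g (snd z) \<partial>(lborel \<Otimes>\<^sub>M lborel)) = (\<integral>\<^sup>+x. f x \<partial>lborel) * (\<integral>\<^sup>+y. g y \<partial>lborel)"
      by (subst lborel.nn_integral_fst[symmetric]) (simp_all add: nn_integral_cmult nn_integral_multc)
    show "(\<integral>\<^sup>+z. f (fst z) * g (snd z - fst z) \<partial>(lborel \<Otimes>\<^sub>M lborel)) = (\<integral>\<^sup>+x. f x \<partial>lborel) * (\<integral>\<^sup>+y. g y \<partial>lborel)"
      by (subst lborel.nn_integral_fst[symmetric]) (simp_all add: nn_integral_cmult nn_integral_multc shift[OF that(2)])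
    show "(\<integral>\<^sup>+z. f (snd z) * g (fst z - snd z) \<partial>(lborel \<Otimes>\<^sub>M lborel)) = (\<integral>\<^sup>+x. f x \<partial>lborel) * (\<integral>\<^sup>+y. g y \<partial>lborel)"
      by (subst lborel_pair.nn_integral_snd[symmetric]) (simp_all add: nn_integral_cmult nn_integral_multc shift[OF that(2)])
  qed
  let ?bound = "\<lambda>z. ennreal ((w (fst z))\<^sup>2) * ennreal ((w (snd z))\<^sup>2) + ennreal (\<bar>w (fst z)\<bar> ^ 3) * ennreal (\<bar>w (snd z)\<bar> ^ 3)
      + (ennreal ((w (fst z))\<^sup>2) * ?k (snd z - fst z) + ennreal ((w (snd z))\<^sup>2) * ?k (fst z - snd z))"
  have "(\<integral>\<^sup>+z. ennreal (norm (case z of (x, y) \<Rightarrow> (w x)\<^sup>2 * (w y)\<^sup>2 / norm (x - y))) \<partial>(lborel \<Otimes>\<^sub>M lborel))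
      \<le> (\<integral>\<^sup>+z. ?bound z \<partial>(lborel \<Otimes>\<^sub>M lborel))"
    using pt by (intro nn_integral_mono) (simp only: case_prod_beta)
  also have "\<dots> = ?W2 * ?W2 + ?W3 * ?W3 + (?W2 * ?K + ?W2 * ?K)"
  proof -
    let ?a = "\<lambda>x. ennreal ((w x)\<^sup>2)" and ?b = "\<lambda>x. ennreal (\<bar>w x\<bar> ^ 3)"
    have [measurable]: "?a \<in> borel_measurable borel" "?b \<in> borel_measurable borel" by measurable
    show ?thesis
      using prod[of ?a ?a] prod[of ?b ?b] conv_x[of ?a ?k] conv_y[of ?a ?k] by (simp add: nn_integral_add)
  qed
  also have "\<dots> < \<infinity>"
    using w2 w3 inverse_square_locally_integrable by (simp add: ennreal_mult_less_top less_top)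
  finally show "(\<integral>\<^sup>+z. ennreal (norm (case z of (x, y) \<Rightarrow> (w x)\<^sup>2 * (w y)\<^sup>2 / norm (x - y))) \<partial>(lborel \<Otimes>\<^sub>M lborel)) < \<infinity>" .
qed

subsection \<open>Tuples over a finite-dimensional space\<close>

lemma tinner_eq: "tinner U W = (\<Sum>i\<in>UNIV. L2_inner (U $ i) (W $ i))"
  by (simp add: tinner_def trace_def gram_def)

lemma tmul_nth: "tmul U P $ i = (\<Sum>j\<in>UNIV. (P $ j $ i) *\<^sub>R (U $ j))"
  by (simp add: tmul_def)

lemma gram_nth: "gram U W $ i $ j = L2_inner (U $ i) (W $ j)"
  by (simp add: gram_def)

lemma tmul_add_left: "tmul (U + W) P = tmul U P + tmul W P"
  by (simp add: vec_eq_iff tmul_nth scaleR_add_right sum.distrib)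

lemma tmul_diff_left: "tmul (U - W) P = tmul U P - tmul W P"
  by (simp add: vec_eq_iff tmul_nth scaleR_diff_right sum_subtractf)

lemma tmul_add_right: "tmul U (P + Q) = tmul U P + tmul U Q"
  by (simp add: vec_eq_iff tmul_nth scaleR_add_left sum.distrib)

lemma tmul_diff_right: "tmul U (P - Q) = tmul U P - tmul U Q"
  by (simp add: vec_eq_iff tmul_nth scaleR_diff_left sum_subtractf)

lemma tmul_scaleR_right: "tmul U (c *\<^sub>R P) = c *\<^sub>R tmul U P"
  by (simp add: vec_eq_iff tmul_nth scaleR_sum_right)

lemma tmul_one [simp]: "tmul U (mat 1) = U"
proof -
  have "(\<Sum>j\<in>UNIV. (if j = i then 1 else 0) *\<^sub>R (U $ j)) = (\<Sum>j\<in>UNIV. if j = i then U $ j else 0)" for i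
    by (rule sum.cong) auto
  then show ?thesis by (simp add: vec_eq_iff tmul_nth mat_def)
qed

lemma tmul_assoc: "tmul (tmul U P) Q = tmul U (P ** Q)"
proof -
  have "(\<Sum>j\<in>UNIV. Q $ j $ i *\<^sub>R (\<Sum>k\<in>UNIV. P $ k $ j *\<^sub>R U $ k)) = (\<Sum>k\<in>UNIV. (\<Sum>j\<in>UNIV. P $ k $ j * Q $ j $ i) *\<^sub>R U $ k)" for i
  proof -
    have "(\<Sum>j\<in>UNIV. Q $ j $ i *\<^sub>R (\<Sum>k\<in>UNIV. P $ k $ j *\<^sub>R U $ k)) = (\<Sum>j\<in>UNIV. \<Sum>k\<in>UNIV. (P $ k $ j * Q $ j $ i) *\<^sub>R U $ k)"
      by (simp add: scaleR_sum_right mult.commute)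
    also have "\<dots> = (\<Sum>k\<in>UNIV. \<Sum>j\<in>UNIV. (P $ k $ j * Q $ j $ i) *\<^sub>R U $ k)"
      by (rule sum.swap)
    finally show ?thesis by (simp add: scaleR_sum_left)
  qed
  then show ?thesis by (simp add: vec_eq_iff tmul_nth matrix_matrix_mult_def)
qed

text \<open>What the linear algebra takes from \<open>V\<close>. By \<open>AE_zero_V\<close> a
  member of \<open>V\<close> with vanishing L^2 norm is the zero function, so
  \<open>L2_inner\<close> is definite on \<open>V\<close> although it is not on all
  functions.\<close>

locale L2_space =
  fixes V :: "(real^3 \<Rightarrow> real) set"
  assumes subspace_V: "subspace V"
    and square_integrable_V: "\<And>v. v \<in> V \<Longrightarrow> square_integrable v"
    and AE_zero_V: "\<And>v. v \<in> V \<Longrightarrow> AE x in lborel. v x = 0 \<Longrightarrow> v = 0"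
    and finite_dim_V: "\<exists>B. finite B \<and> B \<subseteq> V \<and> V \<subseteq> span B"
begin

lemma measurable_V: "v \<in> V \<Longrightarrow> v \<in> borel_measurable borel"
  using square_integrable_V[of v] by (simp add: square_integrable_def)

lemma integrable_square_V: "v \<in> V \<Longrightarrow> integrable lborel (\<lambda>x. (v x)\<^sup>2)"
  using square_integrable_V[of v] by (simp add: square_integrable_def)

lemma integrable_mult_V:
  assumes "v \<in> V" "w \<in> V"
  shows "integrable lborel (\<lambda>x. v x * w x)"
proof (rule Bochner_Integration.integrable_bound[of _ "\<lambda>x. (v x)\<^sup>2 + (w x)\<^sup>2"])
  show "integrable lborel (\<lambda>x. (v x)\<^sup>2 + (w x)\<^sup>2)"
    using assms integrable_square_V by auto
  show "(\<lambda>x. v x * w x) \<in> borel_measurable lborel"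
    using assms measurable_V by auto
  have "\<bar>a * b\<bar> \<le> a\<^sup>2 + b\<^sup>2" for a b :: real
  proof -
    have "2 * \<bar>a * b\<bar> \<le> a\<^sup>2 + b\<^sup>2"
      using sum_squares_bound[of "\<bar>a\<bar>" "\<bar>b\<bar>"] by (simp add: abs_mult)
    then show ?thesis by simp
  qed
  then show "AE x in lborel. norm (v x * w x) \<le> norm ((v x)\<^sup>2 + (w x)\<^sup>2)" by simp
qed

sublocale V: fin_ip_space V L2_inner
proof
  show "subspace V" by (rule subspace_V)
  show "L2_inner x y = L2_inner y x" for x y by (simp add: L2_inner_def mult.commute)
  show "L2_inner (x + y) z = L2_inner x z + L2_inner y z" if "x \<in> V" "y \<in> V" "z \<in> V" for x y z
    using integrable_mult_V[OF that(1,3)] integrable_mult_V[OF that(2,3)]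
    by (simp add: L2_inner_def distrib_right)
  show "L2_inner (c *\<^sub>R x) y = c * L2_inner x y" for c x y
    by (simp add: L2_inner_def mult.assoc)
  show "L2_inner x x > 0" if "x \<in> V" "x \<noteq> 0" for x
  proof (rule ccontr)
    assume "\<not> L2_inner x x > 0"
    moreover have "L2_inner x x \<ge> 0" by (simp add: L2_inner_def)
    moreover have "L2_inner x x = (LBINT t. (x t)\<^sup>2)" by (simp add: L2_inner_def power2_eq_square)
    ultimately have "(LBINT t. (x t)\<^sup>2) = 0" by linarith
    then have "AE t in lborel. (x t)\<^sup>2 = 0"
      using integral_nonneg_eq_0_iff_AE[OF integrable_square_V[OF that(1)]] by simp
    then show False using AE_zero_V[OF that(1)] that(2) by simp
  qed
  show "\<exists>C. finite C \<and> C \<subseteq> V \<and> V \<subseteq> span C" by (rule finite_dim_V)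
qed

lemma tuples_nth [simp]: "U \<in> tuples V \<Longrightarrow> U $ i \<in> V"
  by (simp add: tuples_def)

lemma tuplesI: "(\<And>i. U $ i \<in> V) \<Longrightarrow> U \<in> tuples V"
  unfolding tuples_def by blast

definition single :: "'n \<Rightarrow> (real^3 \<Rightarrow> real) \<Rightarrow> ('n::finite) tuple" where
  "single i f = (\<chi> j. if j = i then f else 0)"

lemma single_tuples: "f \<in> V \<Longrightarrow> single i f \<in> tuples V"
  by (rule tuplesI) (simp add: single_def)

text \<open>The inner product of tuples sums over the entries, and tuples with one nonzero entry
  from a spanning set of \<open>V\<close> span all tuples. The \<open>rewrites\<close> clause makes
  the inherited norm facts speak of \<open>tnorm\<close>.\<close>

sublocale T: fin_ip_space "tuples V :: ('n::finite) tuple set" tinner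
  rewrites "ip_space.nrm tinner = tnorm"
proof -
  show "fin_ip_space (tuples V :: 'n tuple set) tinner"
  proof
    show "subspace (tuples V :: 'n tuple set)"
      by (auto simp: subspace_def intro!: tuplesI)
    show "tinner x y = tinner y x" for x y :: "'n tuple"
      by (simp add: tinner_eq V.ip_commute)
    show "tinner (x + y) z = tinner x z + tinner y z"
      if "x \<in> tuples V" "y \<in> tuples V" "z \<in> tuples V" for x y z :: "'n tuple"
      using that by (simp add: tinner_eq V.ip_add_left sum.distrib)
    show "tinner (c *\<^sub>R x) y = c * tinner x y" if "x \<in> tuples V" "y \<in> tuples V" for c and x y :: "'n tuple"
      using that by (simp add: tinner_eq V.ip_scaleR_left sum_distrib_left)
    show "tinner x x > 0" if x: "x \<in> tuples V" "x \<noteq> 0" for x :: "'n tuple"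
    proof -
      obtain i where i: "x $ i \<noteq> 0" using x(2) by (auto simp: vec_eq_iff)
      have "0 < L2_inner (x $ i) (x $ i)" using x(1) i by (intro V.ip_pos) auto
      also have "\<dots> \<le> tinner x x"
        unfolding tinner_eq using x(1) by (intro member_le_sum) (auto intro: V.ip_ge_0)
      finally show ?thesis .
    qed
    show "\<exists>C. finite C \<and> C \<subseteq> (tuples V :: 'n tuple set) \<and> tuples V \<subseteq> span C"
    proof -
      obtain B where B: "finite B" "B \<subseteq> V" "V \<subseteq> span B" using finite_dim_V by auto
      let ?C = "(\<lambda>(i, b). single i b :: 'n tuple) ` (UNIV \<times> B)"
      have mem: "single i f \<in> span ?C" if "f \<in> V" for f and i :: 'n
      proof -
        have "f \<in> span B" using that B by auto
        then show ?thesis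
        proof (rule span_induct)
          show "subspace {f. single i f \<in> span ?C}"
          proof (rule subspaceI; clarify)
            have "single i 0 = (0 :: 'n tuple)" by (simp add: single_def vec_eq_iff)
            then show "single i 0 \<in> span ?C" by (simp add: span_zero)
          next
            fix x y assume xy: "single i x \<in> span ?C" "single i y \<in> span ?C"
            have "single i (x + y) = single i x + single i y" by (simp add: single_def vec_eq_iff)
            then show "single i (x + y) \<in> span ?C" using span_add[OF xy] by simp
          next
            fix c :: real and x assume x: "single i x \<in> span ?C"
            have "single i (c *\<^sub>R x) = c *\<^sub>R single i x" by (simp add: single_def vec_eq_iff)
            then show "single i (c *\<^sub>R x) \<in> span ?C" using span_scale[OF x, of c] by simp
          qed
          fix b assume "b \<in> B"
          then show "single i b \<in> span ?C" by (intro span_base) auto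
        qed
      qed
      have "U \<in> span ?C" if "U \<in> tuples V" for U
      proof -
        have "(\<Sum>i\<in>UNIV. single i (U $ i)) \<in> span ?C" using that by (intro span_sum mem) auto
        moreover have "U = (\<Sum>i\<in>UNIV. single i (U $ i))"
          by (simp add: vec_eq_iff single_def sum_component)
        ultimately show ?thesis by simp
      qed
      moreover have "?C \<subseteq> tuples V" using B(2) by (auto intro: single_tuples)
      ultimately show ?thesis using B(1) by (intro exI[of _ ?C]) auto
    qed
  qed
  then interpret T: fin_ip_space "tuples V :: 'n tuple set" tinner .
  show "ip_space.nrm (tinner :: 'n tuple \<Rightarrow> _) = tnorm"
    by (simp add: fun_eq_iff T.nrm_def tnorm_def)
qed

lemma tmul_tuples [simp]: "U \<in> tuples V \<Longrightarrow> tmul U P \<in> tuples V"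
  by (intro tuplesI) (simp add: tmul_nth)

lemma gram_commute: "gram U W = transpose (gram W U)"
  by (simp add: vec_eq_iff gram_nth transpose_def V.ip_commute)

lemma gram_nth_commute: "gram U W $ i $ j = gram W U $ j $ i"
  by (simp add: gram_nth V.ip_commute)

lemma gram_add_right: "U \<in> tuples V \<Longrightarrow> W \<in> tuples V \<Longrightarrow> X \<in> tuples V \<Longrightarrow> gram X (U + W) = gram X U + gram X W"
  by (simp add: vec_eq_iff gram_nth V.ip_simps)

lemma gram_diff_right: "U \<in> tuples V \<Longrightarrow> W \<in> tuples V \<Longrightarrow> X \<in> tuples V \<Longrightarrow> gram X (U - W) = gram X U - gram X W"
  by (simp add: vec_eq_iff gram_nth V.ip_simps)

lemma gram_add_left: "U \<in> tuples V \<Longrightarrow> W \<in> tuples V \<Longrightarrow> X \<in> tuples V \<Longrightarrow> gram (U + W) X = gram U X + gram W X"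
  by (simp add: vec_eq_iff gram_nth V.ip_simps)

lemma gram_diff_left: "U \<in> tuples V \<Longrightarrow> W \<in> tuples V \<Longrightarrow> X \<in> tuples V \<Longrightarrow> gram (U - W) X = gram U X - gram W X"
  by (simp add: vec_eq_iff gram_nth V.ip_simps)

lemma gram_scaleR_right: "U \<in> tuples V \<Longrightarrow> W \<in> tuples V \<Longrightarrow> gram U (c *\<^sub>R W) = c *\<^sub>R gram U W"
  by (simp add: vec_eq_iff gram_nth V.ip_simps)

lemma gram_scaleR_left: "U \<in> tuples V \<Longrightarrow> W \<in> tuples V \<Longrightarrow> gram (c *\<^sub>R U) W = c *\<^sub>R gram U W"
  by (simp add: vec_eq_iff gram_nth V.ip_simps)

lemma gram_tmul_right:
  assumes "U \<in> tuples V" "W \<in> tuples V" shows "gram U (tmul W P) = gram U W ** P"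
proof -
  have "L2_inner (U $ i) (\<Sum>k\<in>UNIV. P $ k $ j *\<^sub>R W $ k) = (\<Sum>k\<in>UNIV. L2_inner (U $ i) (W $ k) * P $ k $ j)" for i j
    using assms by (subst V.ip_sum_right) (auto simp: V.ip_simps mult.commute)
  then show ?thesis
    by (simp add: vec_eq_iff gram_nth tmul_nth matrix_matrix_mult_def)
qed

lemma gram_tmul_left:
  assumes "U \<in> tuples V" "W \<in> tuples V" shows "gram (tmul U P) W = transpose P ** gram U W"
  using gram_tmul_right[OF assms(2,1), of P]
  by (metis gram_commute matrix_transpose_mul)

text \<open>The right-hand side is the Frobenius product of \<open>P\<close> and
  \<open>gram U W\<close>, written out because it is later estimated entry by entry.\<close>

lemma tinner_tmul_left:
  assumes "U \<in> tuples V" "W \<in> tuples V"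
  shows "tinner (tmul U P) W = (\<Sum>i\<in>UNIV. \<Sum>j\<in>UNIV. P $ j $ i * gram U W $ j $ i)"
proof -
  have "L2_inner (\<Sum>j\<in>UNIV. P $ j $ i *\<^sub>R U $ j) (W $ i) = (\<Sum>j\<in>UNIV. P $ j $ i * L2_inner (U $ j) (W $ i))" for i
    using assms by (subst V.ip_sum_left) (auto simp: V.ip_simps)
  then show ?thesis by (simp add: tinner_eq tmul_nth gram_nth)
qed

lemma tinner_tmul_right:
  assumes "U \<in> tuples V" "W \<in> tuples V"
  shows "tinner U (tmul W P) = tinner (tmul U (transpose P)) W"
proof -
  have "tinner U (tmul W P) = tinner (tmul W P) U" by (rule T.ip_commute)
  also have "\<dots> = (\<Sum>i\<in>UNIV. \<Sum>j\<in>UNIV. P $ j $ i * gram U W $ i $ j)"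
    by (simp add: tinner_tmul_left[OF assms(2,1)] gram_nth_commute[of W])
  also have "\<dots> = (\<Sum>j\<in>UNIV. \<Sum>i\<in>UNIV. P $ j $ i * gram U W $ i $ j)"
    by (rule sum.swap)
  also have "\<dots> = tinner (tmul U (transpose P)) W"
    by (simp add: tinner_tmul_left[OF assms] transpose_def)
  finally show ?thesis .
qed

lemma tnorm_tmul_orthogonal:
  assumes "U \<in> tuples V" "orthogonal_matrix P"
  shows "tnorm (tmul U P) = tnorm U"
proof -
  have "tinner (tmul U P) (tmul U P) = tinner (tmul (tmul U P) (transpose P)) U"
    using assms by (intro tinner_tmul_right) auto
  also have "tmul (tmul U P) (transpose P) = U"
    using assms(2) by (simp add: tmul_assoc orthogonal_matrix_def)
  finally show ?thesis by (simp add: tnorm_def)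
qed

lemma nrm_nth_le:
  assumes "U \<in> tuples V" shows "V.nrm (U $ i) \<le> tnorm U"
  unfolding tnorm_def V.nrm_def tinner_eq using assms
  by (intro real_sqrt_le_mono member_le_sum) (auto intro: V.ip_ge_0)

lemma abs_gram_nth_le:
  assumes "U \<in> tuples V" "W \<in> tuples V"
  shows "\<bar>gram U W $ i $ j\<bar> \<le> tnorm U * tnorm W"
proof -
  have "\<bar>gram U W $ i $ j\<bar> \<le> V.nrm (U $ i) * V.nrm (W $ j)"
    unfolding gram_nth using assms by (intro V.Cauchy_Schwarz) auto
  also have "\<dots> \<le> tnorm U * tnorm W"
    using assms by (intro mult_mono nrm_nth_le) auto
  finally show ?thesis .
qed

lemma tnorm_le_sum:
  assumes "U \<in> tuples V" shows "tnorm U \<le> (\<Sum>i\<in>UNIV. V.nrm (U $ i))"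
proof -
  have "tnorm U = L2_set (\<lambda>i. V.nrm (U $ i)) UNIV"
    using assms by (simp add: tnorm_def tinner_eq L2_set_def V.nrm_power2)
  also have "\<dots> \<le> (\<Sum>i\<in>UNIV. V.nrm (U $ i))"
    using assms by (intro L2_set_le_sum) auto
  finally show ?thesis .
qed

text \<open>A crude bound from the entries of \<open>P\<close>. The size of the constant is
  immaterial, as only the existence of a bound on the time steps is claimed.\<close>

lemma tnorm_tmul_le:
  fixes U :: "('n::finite) tuple"
  assumes U: "U \<in> tuples V" and P: "\<And>i j. \<bar>P $ i $ j\<bar> \<le> K"
  shows "tnorm (tmul U P) \<le> (real CARD('n))\<^sup>2 * K * tnorm U"
proof -
  have "tnorm (tmul U P) \<le> (\<Sum>i\<in>UNIV. V.nrm (tmul U P $ i))"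
    using U by (intro tnorm_le_sum) auto
  also have "\<dots> \<le> (\<Sum>i\<in>(UNIV::'n set). \<Sum>j\<in>(UNIV::'n set). K * tnorm U)"
  proof (rule sum_mono)
    fix i
    have "V.nrm (tmul U P $ i) \<le> (\<Sum>j\<in>UNIV. V.nrm (P $ j $ i *\<^sub>R U $ j))"
      unfolding tmul_nth using U by (intro V.nrm_sum) auto
    also have "\<dots> \<le> (\<Sum>j\<in>(UNIV::'n set). K * tnorm U)"
      using U order_trans[OF abs_ge_zero P]
      by (intro sum_mono) (auto simp: V.nrm_scaleR intro!: mult_mono P nrm_nth_le)
    finally show "V.nrm (tmul U P $ i) \<le> (\<Sum>j\<in>(UNIV::'n set). K * tnorm U)" .
  qed
  finally show ?thesis by (simp add: power2_eq_square mult_ac)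
qed

lemma tnorm_tmul_gram_le:
  fixes U :: "('n::finite) tuple"
  assumes "U \<in> tuples V" "W \<in> tuples V" "X \<in> tuples V"
  shows "tnorm (tmul U (gram W X)) \<le> (real CARD('n))\<^sup>2 * tnorm U * tnorm W * tnorm X"
  using tnorm_tmul_le[OF assms(1) abs_gram_nth_le[OF assms(2,3)]] by (simp add: mult_ac)

end

subsection \<open>The gradient\<close>

text \<open>The interface between the Kohn-Sham energy and the analysis of the iteration:
  differentiability along the tuples over \<open>V\<close> and invariance under rotations of the
  entries.\<close>

locale energy_space = L2_space V for V +
  fixes E :: "('n::finite) tuple \<Rightarrow> real"
  assumes V_H1: "V \<subseteq> H1"
    and differentiable: "\<And>U. U \<in> tuples V \<Longrightarrow> \<exists>G\<in>tuples V. frechet_on V E U (tinner G)"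
    and invariant: "\<And>U P. U \<in> tuples V \<Longrightarrow> orthogonal_matrix P \<Longrightarrow> E (tmul U P) = E U"
begin

text \<open>Both expansions are compared at a small multiple of \<open>G - H\<close>. This justifies
  the definite description in \<open>grad\<close>.\<close>

lemma gradient_unique:
  assumes G: "G \<in> tuples V" "frechet_on V E U (tinner G)" and H: "H \<in> tuples V" "frechet_on V E U (tinner H)"
  shows "G = H"
proof (rule ccontr)
  assume "G \<noteq> H"
  then have n: "tnorm (G - H) > 0"
    using G(1) H(1) by (metis T.mem_diff T.nrm_eq_0_iff T.nrm_ge_0 eq_iff_diff_eq_0 order_le_less)
  \<comment> \<open>A quarter: the two errors together are at most half of t |||G - H|||^2, which is
    the difference of the two linear terms at \<open>K\<close>.\<close>
  define e where "e = tnorm (G - H) / 4"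
  have e: "e > 0" using n by (simp add: e_def)
  obtain d1 where d1: "d1 > 0" "\<And>K. K \<in> tuples V \<Longrightarrow> tnorm K < d1 \<Longrightarrow> \<bar>E (U + K) - E U - tinner G K\<bar> \<le> e * tnorm K"
    using G(2) e unfolding frechet_on_def by blast
  obtain d2 where d2: "d2 > 0" "\<And>K. K \<in> tuples V \<Longrightarrow> tnorm K < d2 \<Longrightarrow> \<bar>E (U + K) - E U - tinner H K\<bar> \<le> e * tnorm K"
    using H(2) e unfolding frechet_on_def by blast
  define t where "t = min d1 d2 / (2 * tnorm (G - H))"
  define K where "K = t *\<^sub>R (G - H)"
  have t: "t > 0" using n d1(1) d2(1) by (simp add: t_def)
  have K: "K \<in> tuples V" using G(1) H(1) by (simp add: K_def)
  have nK: "tnorm K = t * tnorm (G - H)" using G(1) H(1) t by (simp add: K_def T.nrm_scaleR)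
  then have "tnorm K = min d1 d2 / 2" using n by (simp add: t_def)
  then have "tnorm K < d1" "tnorm K < d2" using d1(1) d2(1) by auto
  from d1(2)[OF K this(1)] d2(2)[OF K this(2)]
  have "\<bar>tinner G K - tinner H K\<bar> \<le> 2 * e * tnorm K" by linarith
  moreover have "tinner G K - tinner H K = t * (tnorm (G - H))\<^sup>2"
    using G(1) H(1) by (simp add: K_def T.ip_simps T.nrm_power2 algebra_simps)
  ultimately have "t * (tnorm (G - H))\<^sup>2 \<le> 2 * e * tnorm K" by linarith
  also have "\<dots> = t * (tnorm (G - H))\<^sup>2 / 2" by (simp add: nK e_def power2_eq_square)
  finally have "t * (tnorm (G - H))\<^sup>2 \<le> 0" by simp
  then show False using t n by (simp add: mult_le_0_iff)
qed

lemma grad_props: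
  assumes "U \<in> tuples V"
  shows grad_tuples [simp]: "grad V E U \<in> tuples V"
    and grad_frechet: "frechet_on V E U (tinner (grad V E U))"
proof -
  have "\<exists>!G. G \<in> tuples V \<and> frechet_on V E U (tinner G)"
    using differentiable[OF assms] gradient_unique by blast
  from theI'[OF this] show "grad V E U \<in> tuples V" "frechet_on V E U (tinner (grad V E U))"
    by (auto simp: grad_def)
qed

lemma grad_eqI: "U \<in> tuples V \<Longrightarrow> G \<in> tuples V \<Longrightarrow> frechet_on V E U (tinner G) \<Longrightarrow> grad V E U = G"
  using gradient_unique[OF grad_tuples grad_frechet] by blast

lemma energy_continuous:
  assumes U: "U \<in> tuples V" and X: "\<And>n. X n \<in> tuples V" and lim: "(\<lambda>n. tnorm (X n - U)) \<longlonglongrightarrow> 0"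
  shows "(\<lambda>n. E (X n)) \<longlonglongrightarrow> E U"
proof -
  obtain d where d: "d > 0" "\<And>K. K \<in> tuples V \<Longrightarrow> tnorm K < d \<Longrightarrow> \<bar>E (U + K) - E U - tinner (grad V E U) K\<bar> \<le> 1 * tnorm K"
    using grad_frechet[OF U] unfolding frechet_on_def by (meson zero_less_one)
  have "\<forall>\<^sub>F n in sequentially. tnorm (X n - U) < d"
    using lim d(1) by (rule order_tendstoD)
  then have "\<forall>\<^sub>F n in sequentially. norm (E (X n) - E U) \<le> (tnorm (grad V E U) + 1) * tnorm (X n - U)"
  proof eventually_elim
    case (elim n)
    have "\<bar>E (X n) - E U - tinner (grad V E U) (X n - U)\<bar> \<le> tnorm (X n - U)"
      using d(2)[OF _ elim] X U by simp
    moreover have "\<bar>tinner (grad V E U) (X n - U)\<bar> \<le> tnorm (grad V E U) * tnorm (X n - U)"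
      using X U by (intro T.Cauchy_Schwarz) auto
    ultimately show ?case by (simp add: algebra_simps)
  qed
  moreover have "(\<lambda>n. (tnorm (grad V E U) + 1) * tnorm (X n - U)) \<longlonglongrightarrow> 0"
    using tendsto_mult_right_zero[OF lim] by simp
  ultimately have "(\<lambda>n. E (X n) - E U) \<longlonglongrightarrow> 0" by (rule Lim_null_comparison)
  then show ?thesis by (simp add: LIM_zero_iff)
qed

text \<open>Restricts the energy to lines, where the mean value theorem for real functions
  applies.\<close>

lemma energy_line_derivative:
  assumes U: "U \<in> tuples V" and H: "H \<in> tuples V"
  shows "((\<lambda>t. E (U + t *\<^sub>R H)) has_real_derivative tinner (grad V E (U + t *\<^sub>R H)) H) (at t)"
proof -
  let ?X = "U + t *\<^sub>R H" and ?g = "tinner (grad V E (U + t *\<^sub>R H)) H"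
  have X: "?X \<in> tuples V" using U H by simp
  have "((\<lambda>h. (E (U + (t + h) *\<^sub>R H) - E ?X) / h) \<longlongrightarrow> ?g) (at 0)"
  proof (rule tendstoI)
    fix e :: real assume e: "e > 0"
    \<comment> \<open>The summand 1 keeps the denominator positive when \<open>H\<close> is
      zero.\<close>
    define e' where "e' = e / (2 * (tnorm H + 1))"
    have nH: "tnorm H \<ge> 0" using H by simp
    have e': "e' > 0" using e nH by (simp add: e'_def)
    obtain d where d: "d > 0" "\<And>K. K \<in> tuples V \<Longrightarrow> tnorm K < d \<Longrightarrow> \<bar>E (?X + K) - E ?X - tinner (grad V E ?X) K\<bar> \<le> e' * tnorm K"
      using grad_frechet[OF X] e' unfolding frechet_on_def by blast
    have "\<forall>\<^sub>F h in at 0. \<bar>h\<bar> < d / (tnorm H + 1) \<and> h \<noteq> 0"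
      using d(1) nH unfolding eventually_at by (intro exI[of _ "d / (tnorm H + 1)"]) auto
    then show "\<forall>\<^sub>F h in at 0. dist ((E (U + (t + h) *\<^sub>R H) - E ?X) / h) ?g < e"
    proof eventually_elim
      case (elim h)
      have nh: "tnorm (h *\<^sub>R H) = \<bar>h\<bar> * tnorm H" using H by (simp add: T.nrm_scaleR)
      have "\<bar>h\<bar> * tnorm H \<le> \<bar>h\<bar> * (tnorm H + 1)" by (intro mult_left_mono) auto
      also have "\<dots> < d" using elim nH by (simp add: pos_less_divide_eq)
      finally have "\<bar>E (?X + h *\<^sub>R H) - E ?X - tinner (grad V E ?X) (h *\<^sub>R H)\<bar> \<le> e' * (\<bar>h\<bar> * tnorm H)"
        using d(2)[of "h *\<^sub>R H"] H nh by simp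
      moreover have "?X + h *\<^sub>R H = U + (t + h) *\<^sub>R H" by (simp add: scaleR_add_left)
      moreover have "tinner (grad V E ?X) (h *\<^sub>R H) = h * ?g" using X H by (simp add: T.ip_simps)
      ultimately have le: "\<bar>E (U + (t + h) *\<^sub>R H) - E ?X - h * ?g\<bar> \<le> e' * (\<bar>h\<bar> * tnorm H)" by simp
      have "dist ((E (U + (t + h) *\<^sub>R H) - E ?X) / h) ?g = \<bar>E (U + (t + h) *\<^sub>R H) - E ?X - h * ?g\<bar> / \<bar>h\<bar>"
        using elim by (simp add: dist_real_def field_simps flip: abs_divide)
      also have "\<dots> \<le> e' * tnorm H" using le elim by (simp add: pos_divide_le_eq mult_ac)
      also have "\<dots> < e"
      proof -
        have "tnorm H / (2 * (tnorm H + 1)) < 1" using nH by (simp add: divide_less_eq)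
        then have "e * (tnorm H / (2 * (tnorm H + 1))) < e * 1" using e by (intro mult_strict_left_mono) auto
        then show ?thesis by (simp add: e'_def)
      qed
      finally show ?case .
    qed
  qed
  then show ?thesis by (simp add: DERIV_def)
qed

text \<open>The descent lemma for a Lipschitz gradient. It is derived from the mean value theorem,
  with the intermediate gradient compared to that at \<open>X\<close>; this gives the factor
  \<open>L\<close> where integration would give L/2.\<close>

lemma quadratic_upper_bound:
  assumes X: "X \<in> tball V W \<delta>" and Y: "Y \<in> tball V W \<delta>" and W: "W \<in> tuples V"
    and lip: "lipschitz_grad V E L (tball V W \<delta>)" and L: "L \<ge> 0"
  shows "E Y - E X \<le> tinner (grad V E X) (Y - X) + L * (tnorm (Y - X))\<^sup>2"
proof -
  have XV: "X \<in> tuples V" and YV: "Y \<in> tuples V" using X Y by (auto simp: tball_def)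
  define H where "H = Y - X"
  have H: "H \<in> tuples V" using XV YV by (simp add: H_def)
  have "\<exists>s::real. 0 < s \<and> s < 1 \<and> E (X + 1 *\<^sub>R H) - E (X + 0 *\<^sub>R H) = (1 - 0) * tinner (grad V E (X + s *\<^sub>R H)) H"
    using energy_line_derivative[OF XV H] by (intro MVT2) auto
  then obtain s :: real where s: "0 < s" "s < 1" "E Y - E X = tinner (grad V E (X + s *\<^sub>R H)) H"
    by (auto simp: H_def)
  let ?Z = "X + s *\<^sub>R H"
  have Z: "?Z \<in> tuples V" using XV H by simp
  \<comment> \<open>Balls are convex: the intermediate point stays where the gradient is
    Lipschitz.\<close>
  have "W - ?Z = (1 - s) *\<^sub>R (W - X) + s *\<^sub>R (W - Y)" by (simp add: H_def algebra_simps)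
  then have "tnorm (W - ?Z) \<le> (1 - s) * tnorm (W - X) + s * tnorm (W - Y)"
    using T.nrm_triangle[of "(1 - s) *\<^sub>R (W - X)" "s *\<^sub>R (W - Y)"] XV YV W s by (simp add: T.nrm_scaleR)
  also have "\<dots> \<le> (1 - s) * \<delta> + s * \<delta>"
    using X Y s by (intro add_mono mult_left_mono) (auto simp: tball_def)
  finally have Zb: "?Z \<in> tball V W \<delta>" using Z by (simp add: tball_def algebra_simps)
  have "tinner (grad V E ?Z) H - tinner (grad V E X) H = tinner (grad V E ?Z - grad V E X) H"
    using Z XV H by (simp add: T.ip_simps)
  also have "\<dots> \<le> tnorm (grad V E ?Z - grad V E X) * tnorm H"
    using T.Cauchy_Schwarz[of "grad V E ?Z - grad V E X" H] Z XV H by simp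
  also have "\<dots> \<le> (L * tnorm (?Z - X)) * tnorm H"
  proof (rule mult_right_mono)
    show "tnorm (grad V E ?Z - grad V E X) \<le> L * tnorm (?Z - X)"
      using lip Zb X unfolding lipschitz_grad_def by blast
  qed (use H in simp)
  also have "tnorm (?Z - X) = s * tnorm H" using H s by (simp add: T.nrm_scaleR)
  also have "L * (s * tnorm H) * tnorm H \<le> L * (1 * tnorm H) * tnorm H"
    using s L H by (intro mult_right_mono mult_left_mono) auto
  finally show ?thesis using s(3) by (simp add: H_def power2_eq_square)
qed

lemma orthogonal_transpose: "orthogonal_matrix P \<Longrightarrow> orthogonal_matrix (transpose P)"
  by (simp add: orthogonal_matrix_transpose)

lemma tmul_transpose_cancel:
  "orthogonal_matrix P \<Longrightarrow> tmul (tmul U P) (transpose P) = U"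
  "orthogonal_matrix P \<Longrightarrow> tmul (tmul U (transpose P)) P = U"
  by (simp_all add: tmul_assoc orthogonal_matrix_def)

text \<open>Invariance of the energy under the isometry \<open>P\<close> makes the gradient
  equivariant: an increment H at UP corresponds to the increment H P^T at U, of equal norm. This
  carries estimates near \<open>Ustar\<close> along its orbit.\<close>

lemma grad_tmul:
  assumes U: "U \<in> tuples V" and P: "orthogonal_matrix P"
  shows "grad V E (tmul U P) = tmul (grad V E U) P"
proof (rule grad_eqI)
  show "frechet_on V E (tmul U P) (tinner (tmul (grad V E U) P))"
    unfolding frechet_on_def
  proof (intro allI impI)
    fix e :: real assume "e > 0"
    then obtain d where d: "d > 0" "\<And>K. K \<in> tuples V \<Longrightarrow> tnorm K < d \<Longrightarrow> \<bar>E (U + K) - E U - tinner (grad V E U) K\<bar> \<le> e * tnorm K"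
      using grad_frechet[OF U] unfolding frechet_on_def by blast
    have "\<bar>E (tmul U P + H) - E (tmul U P) - tinner (tmul (grad V E U) P) H\<bar> \<le> e * tnorm H"
      if H: "H \<in> tuples V" "tnorm H < d" for H
    proof -
      let ?K = "tmul H (transpose P)"
      have nK: "tnorm ?K = tnorm H" using H P by (intro tnorm_tmul_orthogonal orthogonal_transpose)
      have "tmul (U + ?K) P = tmul U P + H" using P by (simp add: tmul_add_left tmul_transpose_cancel)
      then have "E (tmul U P + H) = E (U + ?K)" using invariant[of "U + ?K" P] U H P by simp
      moreover have "E (tmul U P) = E U" using invariant U P by simp
      moreover have "tinner (tmul (grad V E U) P) H = tinner (grad V E U) ?K"
        using tinner_tmul_right[of "grad V E U" H "transpose P"] U H by simp
      ultimately show ?thesis using d(2)[of ?K] H nK by simp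
    qed
    then show "\<exists>d>0. \<forall>H\<in>tuples V. tnorm H < d \<longrightarrow>
         \<bar>E (tmul U P + H) - E (tmul U P) - tinner (tmul (grad V E U) P) H\<bar> \<le> e * tnorm H"
      using d(1) by blast
  qed
qed (use U in auto)

text \<open>
  The energy is constant along the rotations of the entries \<open>i\<close> and \<open>j\<close>, so its derivative in the
  direction of their generator vanishes.
\<close>

lemma gram_grad_symmetric:
  assumes U: "U \<in> tuples V"
  shows "gram (grad V E U) U $ i $ j = gram (grad V E U) U $ j $ i"
proof (cases "i = j")
  case False
  let ?G = "grad V E U"
  \<comment> \<open>Rotating the entries i and j of U by the angle t gives U + (cos t - 1) A + sin t
    B: \<open>B\<close> is the generator, and \<open>A\<close> enters to second order only.\<close>
  define A where "A = single i (U $ i) + single j (U $ j)"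
  define B where "B = single i (U $ j) - single j (U $ i)"
  have AB: "A \<in> tuples V" "B \<in> tuples V" using U by (auto simp: A_def B_def single_tuples)
  define R :: "real \<Rightarrow> real^'n^'n" where "R t = (\<chi> a b. (if b = i then cos t *\<^sub>R axis i 1 + sin t *\<^sub>R axis j 1 else
    if b = j then cos t *\<^sub>R axis j 1 - sin t *\<^sub>R axis i 1 else axis b 1) $ a)" for t
  have col: "column b (R t) = (if b = i then cos t *\<^sub>R axis i 1 + sin t *\<^sub>R axis j 1 else
    if b = j then cos t *\<^sub>R axis j 1 - sin t *\<^sub>R axis i 1 else axis b 1)" for t b
    by (simp add: column_def R_def vec_eq_iff)
  have orth: "orthogonal_matrix (R t)" for t
    unfolding orthogonal_matrix_orthonormal_columns norm_eq_1 col orthogonal_def using False sin_cos_squared_add[of t]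
    by (auto simp: inner_add_left inner_add_right inner_diff_left inner_diff_right inner_axis_axis power2_eq_square add.commute)
  have RU: "tmul U (R t) = U + ((cos t - 1) *\<^sub>R A + sin t *\<^sub>R B)" for t
  proof -
    have "(\<Sum>a\<in>UNIV. R t $ a $ b *\<^sub>R U $ a) = (U + ((cos t - 1) *\<^sub>R A + sin t *\<^sub>R B)) $ b" for b
    proof -
      have "(\<Sum>a\<in>UNIV. (axis c (1::real) $ a) *\<^sub>R U $ a) = U $ c" for c
      proof -
        have "(\<Sum>a\<in>UNIV. (axis c (1::real) $ a) *\<^sub>R U $ a) = (\<Sum>a\<in>UNIV. if a = c then U $ a else 0)"
          by (intro sum.cong) (auto simp: axis_def)
        then show ?thesis by simp
      qed
      note s = this
      have s2: "(\<Sum>a\<in>UNIV. (k * axis c (1::real) $ a) *\<^sub>R U $ a) = k *\<^sub>R U $ c" for c k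
        by (simp add: s flip: scaleR_scaleR scaleR_sum_right)
      show ?thesis
        using False by (auto simp: R_def A_def B_def single_def s s2 scaleR_add_left scaleR_diff_left sum.distrib sum_subtractf algebra_simps)
    qed
    then show ?thesis by (simp add: vec_eq_iff tmul_nth)
  qed
  \<comment> \<open>The linear part of the energy change along the rotation. Its derivative at zero
    is \<open>tinner ?G B\<close>; since the energy does not change, f h is also o(h).\<close>
  define f where "f t = (cos t - 1) * tinner ?G A + sin t * tinner ?G B" for t :: real
  have "(f has_real_derivative tinner ?G B) (at 0)"
    unfolding f_def by (auto intro!: derivative_eq_intros)
  then have lim: "((\<lambda>h. f h / h) \<longlongrightarrow> tinner ?G B) (at 0)"
    by (simp add: DERIV_def f_def)
  have "((\<lambda>h. f h / h) \<longlongrightarrow> 0) (at 0)"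
  proof (rule tendstoI)
    fix e :: real assume e: "e > 0"
    define C where "C = tnorm A + tnorm B + 1"
    have C: "C > 0" using T.nrm_ge_0[OF AB(1)] T.nrm_ge_0[OF AB(2)] unfolding C_def by linarith
    have e': "e / (2 * C) > 0" using e C by simp
    obtain d where d: "d > 0" "\<And>K. K \<in> tuples V \<Longrightarrow> tnorm K < d \<Longrightarrow> \<bar>E (U + K) - E U - tinner ?G K\<bar> \<le> (e / (2 * C)) * tnorm K"
      using grad_frechet[OF U] e' unfolding frechet_on_def by blast
    have "\<forall>\<^sub>F h in at 0. \<bar>h\<bar> < d / C \<and> h \<noteq> 0"
      using d(1) C unfolding eventually_at by (intro exI[of _ "d / C"]) auto
    then show "\<forall>\<^sub>F h in at 0. dist (f h / h) 0 < e"
    proof eventually_elim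
      case (elim h)
      let ?K = "(cos h - 1) *\<^sub>R A + sin h *\<^sub>R B"
      have K: "?K \<in> tuples V" using AB by simp
      have "\<bar>cos h - 1\<bar> \<le> \<bar>h\<bar>"
      proof -
        have "\<bar>cos h - 1\<bar> = 2 * \<bar>sin (h / 2)\<bar> * \<bar>sin (h / 2)\<bar>"
          using cos_double_sin[of "h / 2"] by (simp add: power2_eq_square flip: abs_mult)
        also have "\<dots> \<le> 2 * \<bar>h / 2\<bar> * 1"
          using abs_sin_x_le_abs_x[of "h/2"] by (intro mult_mono) auto
        finally show ?thesis by simp
      qed
      then have "tnorm ?K \<le> \<bar>h\<bar> * tnorm A + \<bar>h\<bar> * tnorm B"
        using AB abs_sin_x_le_abs_x[of h]
        by (intro order_trans[OF T.nrm_triangle] add_mono) (auto simp: T.nrm_scaleR intro!: mult_right_mono)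
      also have "\<dots> \<le> \<bar>h\<bar> * C" by (simp add: C_def algebra_simps)
      finally have nK: "tnorm ?K \<le> \<bar>h\<bar> * C" .
      also have "\<dots> < d" using elim C by (simp add: pos_less_divide_eq)
      finally have "\<bar>E (U + ?K) - E U - tinner ?G ?K\<bar> \<le> (e / (2 * C)) * tnorm ?K"
        using d(2) K by blast
      moreover have "E (U + ?K) = E U" using invariant[OF U orth] by (simp add: RU)
      moreover have "tinner ?G ?K = f h" using U AB by (simp add: f_def T.ip_simps)
      ultimately have "\<bar>f h\<bar> \<le> (e / (2 * C)) * tnorm ?K" by simp
      also have "\<dots> \<le> (e / (2 * C)) * (\<bar>h\<bar> * C)" using nK e C by (intro mult_left_mono) auto
      also have "\<dots> = e / 2 * \<bar>h\<bar>" using C by simp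
      finally have "\<bar>f h\<bar> / \<bar>h\<bar> \<le> e / 2" using elim by (simp add: pos_divide_le_eq)
      then have "\<bar>f h\<bar> / \<bar>h\<bar> < e" using e by linarith
      then show ?case by (simp add: abs_divide)
    qed
  qed
  with lim have "tinner ?G B = 0" by (rule tendsto_unique[rotated]) simp
  moreover have "tinner ?G (single k f) = L2_inner (?G $ k) f" if "f \<in> V" for k f
  proof -
    have "tinner ?G (single k f) = (\<Sum>a\<in>UNIV. if a = k then L2_inner (?G $ a) f else 0)"
      unfolding tinner_eq using U by (intro sum.cong) (auto simp: single_def)
    then show ?thesis by simp
  qed
  moreover have "tinner ?G B = tinner ?G (single i (U $ j)) - tinner ?G (single j (U $ i))"
    using U unfolding B_def by (intro T.ip_diff_right single_tuples) auto
  ultimately show ?thesis using U by (simp add: gram_nth)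
qed simp

end

subsection \<open>Weak gradients\<close>

lemma wgrad_props:
  assumes "u \<in> H1"
  shows "square_integrable (wgrad u)" "weak_gradient u (wgrad u)"
proof -
  have "\<exists>g. square_integrable g \<and> weak_gradient u g" using assms by (simp add: H1_def)
  from someI_ex[OF this] show "square_integrable (wgrad u)" "weak_gradient u (wgrad u)"
    by (auto simp: wgrad_def)
qed

lemma square_integrable_linear:
  assumes f: "square_integrable f" and g: "square_integrable g"
  shows "square_integrable (\<lambda>x. a *\<^sub>R f x + b *\<^sub>R g x)"
proof -
  have [measurable]: "f \<in> borel_measurable borel" "g \<in> borel_measurable borel"
    using f g by (auto simp: square_integrable_def)
  have "integrable lborel (\<lambda>x. 2 * a\<^sup>2 * (norm (f x))\<^sup>2 + 2 * b\<^sup>2 * (norm (g x))\<^sup>2)"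
    using f g by (auto simp: square_integrable_def)
  then have "integrable lborel (\<lambda>x. (norm (a *\<^sub>R f x + b *\<^sub>R g x))\<^sup>2)"
  proof (rule Bochner_Integration.integrable_bound)
    have "(norm (a *\<^sub>R f x + b *\<^sub>R g x))\<^sup>2 \<le> 2 * a\<^sup>2 * (norm (f x))\<^sup>2 + 2 * b\<^sup>2 * (norm (g x))\<^sup>2" for x
    proof -
      have "norm (a *\<^sub>R f x + b *\<^sub>R g x) \<le> \<bar>a\<bar> * norm (f x) + \<bar>b\<bar> * norm (g x)"
        using norm_triangle_ineq[of "a *\<^sub>R f x" "b *\<^sub>R g x"] by simp
      then have "(norm (a *\<^sub>R f x + b *\<^sub>R g x))\<^sup>2 \<le> (\<bar>a\<bar> * norm (f x) + \<bar>b\<bar> * norm (g x))\<^sup>2"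
        by (rule power_mono) simp
      also have "\<dots> \<le> 2 * (\<bar>a\<bar> * norm (f x))\<^sup>2 + 2 * (\<bar>b\<bar> * norm (g x))\<^sup>2"
        using sum_squares_bound[of "\<bar>a\<bar> * norm (f x)" "\<bar>b\<bar> * norm (g x)"] by (simp add: power2_sum)
      finally show ?thesis by (simp add: power_mult_distrib)
    qed
    then show "AE x in lborel. norm ((norm (a *\<^sub>R f x + b *\<^sub>R g x))\<^sup>2) \<le> norm (2 * a\<^sup>2 * (norm (f x))\<^sup>2 + 2 * b\<^sup>2 * (norm (g x))\<^sup>2)"
      by (simp add: order_trans[OF _ abs_ge_self])
  qed simp
  then show ?thesis by (simp add: square_integrable_def)
qed

text \<open>The value of \<open>wgrad\<close> is an arbitrary choice among functions that agree
  almost everywhere, so linearity follows from uniqueness and holds up to null sets.\<close>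

lemma wgrad_linear:
  assumes u: "u \<in> H1" and v: "v \<in> H1" and uv: "a *\<^sub>R u + b *\<^sub>R v \<in> H1"
  shows "AE x in lborel. wgrad (a *\<^sub>R u + b *\<^sub>R v) x = a *\<^sub>R wgrad u x + b *\<^sub>R wgrad v x"
proof (rule weak_gradient_unique)
  show "square_integrable (wgrad (a *\<^sub>R u + b *\<^sub>R v))" "weak_gradient (a *\<^sub>R u + b *\<^sub>R v) (wgrad (a *\<^sub>R u + b *\<^sub>R v))"
    using uv by (rule wgrad_props)+
  show "square_integrable (\<lambda>x. a *\<^sub>R wgrad u x + b *\<^sub>R wgrad v x)"
    using u v by (intro square_integrable_linear wgrad_props)
  show "weak_gradient (a *\<^sub>R u + b *\<^sub>R v) (\<lambda>x. a *\<^sub>R wgrad u x + b *\<^sub>R wgrad v x)"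
    unfolding weak_gradient_def
  proof (intro allI impI)
    fix \<phi> D\<phi> assume t: "test_function \<phi> D\<phi>"
    have I: "integrable lborel (\<lambda>x. f x *\<^sub>R D\<phi> x)" "integrable lborel (\<lambda>x. \<phi> x *\<^sub>R wgrad f x)"
      and w: "(LBINT x. f x *\<^sub>R D\<phi> x) = - (LBINT x. \<phi> x *\<^sub>R wgrad f x)" if f: "f \<in> H1" for f
      using test_function_integrable[OF t] f wgrad_props[OF f] t
      by (auto simp: H1_def weak_gradient_def)
    have "(LBINT x. (a *\<^sub>R u + b *\<^sub>R v) x *\<^sub>R D\<phi> x) = (LBINT x. a *\<^sub>R (u x *\<^sub>R D\<phi> x) + b *\<^sub>R (v x *\<^sub>R D\<phi> x))"
      by (simp add: scaleR_add_left)
    also have "\<dots> = a *\<^sub>R (LBINT x. u x *\<^sub>R D\<phi> x) + b *\<^sub>R (LBINT x. v x *\<^sub>R D\<phi> x)"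
      using I(1)[OF u] I(1)[OF v] by (simp add: Bochner_Integration.integral_add del: scaleR_scaleR)
    also have "\<dots> = - (a *\<^sub>R (LBINT x. \<phi> x *\<^sub>R wgrad u x) + b *\<^sub>R (LBINT x. \<phi> x *\<^sub>R wgrad v x))"
      by (simp add: w u v)
    also have "a *\<^sub>R (LBINT x. \<phi> x *\<^sub>R wgrad u x) + b *\<^sub>R (LBINT x. \<phi> x *\<^sub>R wgrad v x) =
       (LBINT x. a *\<^sub>R (\<phi> x *\<^sub>R wgrad u x) + b *\<^sub>R (\<phi> x *\<^sub>R wgrad v x))"
      using I(2)[OF u] I(2)[OF v] by (simp add: Bochner_Integration.integral_add del: scaleR_scaleR)
    also have "\<dots> = (LBINT x. \<phi> x *\<^sub>R (a *\<^sub>R wgrad u x + b *\<^sub>R wgrad v x))"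
      by (simp add: scaleR_add_right mult.commute)
    finally show "(LBINT x. (a *\<^sub>R u + b *\<^sub>R v) x *\<^sub>R D\<phi> x) = - (LBINT x. \<phi> x *\<^sub>R (a *\<^sub>R wgrad u x + b *\<^sub>R wgrad v x))" .
  qed
qed

definition kinetic_form :: "(real^3 \<Rightarrow> real) \<Rightarrow> (real^3 \<Rightarrow> real) \<Rightarrow> real" where
  "kinetic_form u v = (LBINT x. wgrad u x \<bullet> wgrad v x)"

lemma kinetic_form_linear:
  assumes u: "u \<in> H1" and v: "v \<in> H1" and uv: "a *\<^sub>R u + b *\<^sub>R v \<in> H1" and w: "w \<in> H1"
  shows "kinetic_form (a *\<^sub>R u + b *\<^sub>R v) w = a * kinetic_form u w + b * kinetic_form v w"
proof -
  have m [measurable]: "wgrad f \<in> borel_measurable borel" if "f \<in> H1" for f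
    using wgrad_props(1)[OF that] by (simp add: square_integrable_def)
  note [measurable] = m[OF u] m[OF v] m[OF w] m[OF uv]
  have I: "integrable lborel (\<lambda>x. wgrad f x \<bullet> wgrad w x)" if f: "f \<in> H1" for f
  proof (rule Bochner_Integration.integrable_bound[of _ "\<lambda>x. (norm (wgrad f x))\<^sup>2 + (norm (wgrad w x))\<^sup>2"])
    show "integrable lborel (\<lambda>x. (norm (wgrad f x))\<^sup>2 + (norm (wgrad w x))\<^sup>2)"
      using wgrad_props(1)[OF f] wgrad_props(1)[OF w] by (simp add: square_integrable_def)
    show "(\<lambda>x. wgrad f x \<bullet> wgrad w x) \<in> borel_measurable lborel" using m[OF f] by simp
    have "\<bar>wgrad f x \<bullet> wgrad w x\<bar> \<le> (norm (wgrad f x))\<^sup>2 + (norm (wgrad w x))\<^sup>2" for x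
    proof -
      have "2 * \<bar>wgrad f x \<bullet> wgrad w x\<bar> \<le> (norm (wgrad f x))\<^sup>2 + (norm (wgrad w x))\<^sup>2"
        using Cauchy_Schwarz_ineq2[of "wgrad f x" "wgrad w x"] sum_squares_bound[of "norm (wgrad f x)" "norm (wgrad w x)"]
        by linarith
      then show ?thesis by linarith
    qed
    then show "AE x in lborel. norm (wgrad f x \<bullet> wgrad w x) \<le> norm ((norm (wgrad f x))\<^sup>2 + (norm (wgrad w x))\<^sup>2)"
      by (simp add: abs_of_nonneg)
  qed
  have "kinetic_form (a *\<^sub>R u + b *\<^sub>R v) w = (LBINT x. a * (wgrad u x \<bullet> wgrad w x) + b * (wgrad v x \<bullet> wgrad w x))"
    unfolding kinetic_form_def
  proof (rule integral_cong_AE)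
    show "AE x in lborel. wgrad (a *\<^sub>R u + b *\<^sub>R v) x \<bullet> wgrad w x = a * (wgrad u x \<bullet> wgrad w x) + b * (wgrad v x \<bullet> wgrad w x)"
      using wgrad_linear[OF u v uv] by eventually_elim (simp add: inner_add_left)
  qed simp_all
  also have "\<dots> = a * kinetic_form u w + b * kinetic_form v w"
    unfolding kinetic_form_def using I[OF u] I[OF v] by simp
  finally show ?thesis .
qed

text \<open>Bounding a sum of two terms by twice the larger one gives (a + b)^p \<le> 2^p a^p + 2^p
  b^p. Used with p = 2 and p = 3 for a finite basis.\<close>

lemma nn_integral_power_sum:
  fixes B :: "(real^3 \<Rightarrow> real) set"
  assumes "finite B" "\<And>b. b \<in> B \<Longrightarrow> b \<in> borel_measurable borel" "p > 0"
    and "\<And>b. b \<in> B \<Longrightarrow> (\<integral>\<^sup>+x. ennreal (\<bar>b x\<bar> ^ p) \<partial>lborel) < \<infinity>"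
  shows "(\<integral>\<^sup>+x. ennreal ((\<Sum>b\<in>B. \<bar>b x\<bar>) ^ p) \<partial>lborel) < \<infinity>"
  using assms(1,2,4)
proof (induction B rule: finite_induct)
  case empty
  then show ?case using assms(3) by (simp add: power_0_left)
next
  case (insert b B)
  have [measurable]: "b \<in> borel_measurable borel" using insert by simp
  have [measurable]: "(\<lambda>x. \<Sum>b\<in>B. \<bar>b x\<bar>) \<in> borel_measurable borel" using insert by (intro borel_measurable_sum) auto
  have pt: "(\<Sum>c\<in>insert b B. \<bar>c x\<bar>) ^ p \<le> 2 ^ p * \<bar>b x\<bar> ^ p + 2 ^ p * (\<Sum>b\<in>B. \<bar>b x\<bar>) ^ p" for x
  proof -
    let ?s = "\<Sum>b\<in>B. \<bar>b x\<bar>"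
    have s: "?s \<ge> 0" by (simp add: sum_nonneg)
    have "(\<bar>b x\<bar> + ?s) ^ p \<le> (2 * max \<bar>b x\<bar> ?s) ^ p"
      using s by (intro power_mono) auto
    also have "\<dots> \<le> 2 ^ p * \<bar>b x\<bar> ^ p + 2 ^ p * ?s ^ p"
      using s by (auto simp: power_mult_distrib max_def)
    finally show ?thesis using insert.hyps by simp
  qed
  have "(\<integral>\<^sup>+x. ennreal ((\<Sum>c\<in>insert b B. \<bar>c x\<bar>) ^ p) \<partial>lborel) \<le>
    (\<integral>\<^sup>+x. ennreal (2 ^ p) * ennreal (\<bar>b x\<bar> ^ p) + ennreal (2 ^ p) * ennreal ((\<Sum>b\<in>B. \<bar>b x\<bar>) ^ p) \<partial>lborel)"
    by (intro nn_integral_mono order_trans[OF ennreal_leI[OF pt]]) (simp add: ennreal_mult sum_nonneg)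
  also have "\<dots> = ennreal (2 ^ p) * (\<integral>\<^sup>+x. ennreal (\<bar>b x\<bar> ^ p) \<partial>lborel) + ennreal (2 ^ p) * (\<integral>\<^sup>+x. ennreal ((\<Sum>b\<in>B. \<bar>b x\<bar>) ^ p) \<partial>lborel)"
    by (simp add: nn_integral_add nn_integral_cmult)
  also have "\<dots> < \<infinity>"
    using insert.IH insert.prems by (simp add: ennreal_mult_less_top less_top)
  finally show ?case .
qed

subsection \<open>Differentiability of the Kohn-Sham energy\<close>

text \<open>The rows of an orthogonal matrix are orthonormal. This is the common core of the
  invariance of the density and of every quadratic form in the energy.\<close>

lemma orthogonal_double_sum:
  fixes P :: "real^'n^'n"
  assumes "orthogonal_matrix P"
  shows "(\<Sum>i\<in>UNIV. \<Sum>j\<in>UNIV. \<Sum>k\<in>UNIV. P $ j $ i * P $ k $ i * f j k) = (\<Sum>j\<in>UNIV. f j j)"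
proof -
  have PP: "(\<Sum>i\<in>UNIV. P $ j $ i * P $ k $ i) = (if j = k then 1 else 0)" for j k
  proof -
    have "(P ** transpose P) $ j $ k = mat 1 $ j $ k" using assms by (simp add: orthogonal_matrix_def)
    then show ?thesis by (simp add: matrix_matrix_mult_def transpose_def mat_def)
  qed
  have "(\<Sum>i\<in>UNIV. \<Sum>j\<in>UNIV. \<Sum>k\<in>UNIV. P $ j $ i * P $ k $ i * f j k) = (\<Sum>j\<in>UNIV. \<Sum>i\<in>UNIV. \<Sum>k\<in>UNIV. P $ j $ i * P $ k $ i * f j k)"
    by (rule sum.swap)
  also have "\<dots> = (\<Sum>j\<in>UNIV. \<Sum>k\<in>UNIV. \<Sum>i\<in>UNIV. P $ j $ i * P $ k $ i * f j k)"
    by (intro sum.cong refl sum.swap)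
  also have "\<dots> = (\<Sum>j\<in>UNIV. \<Sum>k\<in>UNIV. if j = k then f j k else 0)"
    by (intro sum.cong refl) (simp add: PP flip: sum_distrib_right)
  finally show ?thesis by simp
qed

lemma density_tmul:
  assumes "orthogonal_matrix P"
  shows "density (tmul U P) = density U"
proof
  fix r
  have "(\<Sum>j\<in>UNIV. P $ j $ i *\<^sub>R U $ j) r = (\<Sum>j\<in>UNIV. P $ j $ i * (U $ j) r)" for i
    by (induction rule: infinite_finite_induct) auto
  then have "((tmul U P $ i) r)\<^sup>2 = (\<Sum>j\<in>UNIV. \<Sum>k\<in>UNIV. P $ j $ i * P $ k $ i * ((U $ j) r * (U $ k) r))" for i
    by (simp add: tmul_nth power2_eq_square sum_product mult_ac)
  then show "density (tmul U P) r = density U r"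
    using orthogonal_double_sum[OF assms, of "\<lambda>j k. (U $ j) r * (U $ k) r"]
    by (simp add: density_def power2_eq_square)
qed

section \<open>Differentiable functions and quadratic forms on tuples\<close>

context L2_space
begin

definition linear_on_tuples :: "(('n::finite) tuple \<Rightarrow> real) \<Rightarrow> bool" where
  "linear_on_tuples F \<longleftrightarrow> (\<forall>X\<in>tuples V. \<forall>Y\<in>tuples V. F (X + Y) = F X + F Y) \<and> (\<forall>c. \<forall>X\<in>tuples V. F (c *\<^sub>R X) = c * F X)"

text \<open>The derivative is a linear functional rather than a vector, so that the terms of the
  energy can be treated separately and the Riesz representation is applied once to their
  sum.\<close>

definition differentiable_at :: "(('n::finite) tuple \<Rightarrow> real) \<Rightarrow> 'n tuple \<Rightarrow> bool" where
  "differentiable_at F U \<longleftrightarrow> (\<exists>F'. linear_on_tuples F' \<and> frechet_on V F U F')"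

lemma differentiable_at_add:
  assumes "differentiable_at F U" "differentiable_at G U"
  shows "differentiable_at (\<lambda>X. F X + G X) U"
proof -
  obtain F' where F': "linear_on_tuples F'" "frechet_on V F U F'"
    using assms(1) by (auto simp: differentiable_at_def)
  obtain G' where G': "linear_on_tuples G'" "frechet_on V G U G'"
    using assms(2) by (auto simp: differentiable_at_def)
  have "linear_on_tuples (\<lambda>X. F' X + G' X)"
    using F'(1) G'(1) by (simp add: linear_on_tuples_def distrib_left)
  moreover have "frechet_on V (\<lambda>X. F X + G X) U (\<lambda>X. F' X + G' X)"
    unfolding frechet_on_def
  proof (intro allI impI)
    fix e :: real assume "e > 0"
    then have e2: "e / 2 > 0" by simp
    obtain d1 where d1: "d1 > 0" "\<And>H. H \<in> tuples V \<Longrightarrow> tnorm H < d1 \<Longrightarrow> \<bar>F (U + H) - F U - F' H\<bar> \<le> e / 2 * tnorm H"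
      using F'(2) e2 unfolding frechet_on_def by blast
    obtain d2 where d2: "d2 > 0" "\<And>H. H \<in> tuples V \<Longrightarrow> tnorm H < d2 \<Longrightarrow> \<bar>G (U + H) - G U - G' H\<bar> \<le> e / 2 * tnorm H"
      using G'(2) e2 unfolding frechet_on_def by blast
    have "\<bar>F (U + H) + G (U + H) - (F U + G U) - (F' H + G' H)\<bar> \<le> e * tnorm H"
      if H: "H \<in> tuples V" "tnorm H < min d1 d2" for H
    proof -
      have "\<bar>F (U + H) - F U - F' H\<bar> \<le> e / 2 * tnorm H" using H by (intro d1) auto
      moreover have "\<bar>G (U + H) - G U - G' H\<bar> \<le> e / 2 * tnorm H" using H by (intro d2) auto
      moreover have "e * tnorm H = e / 2 * tnorm H + e / 2 * tnorm H" by simp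
      ultimately show ?thesis by linarith
    qed
    then show "\<exists>d>0. \<forall>H\<in>tuples V. tnorm H < d \<longrightarrow> \<bar>F (U + H) + G (U + H) - (F U + G U) - (F' H + G' H)\<bar> \<le> e * tnorm H"
      using d1(1) d2(1) by (intro exI[of _ "min d1 d2"]) auto
  qed
  ultimately show ?thesis by (auto simp: differentiable_at_def)
qed

text \<open>The remainder is only bounded for increments of norm at most one, so that cubic and
  quartic terms of the Hartree energy can be absorbed into the quadratic one.\<close>

lemma differentiable_at_quadratic_remainder:
  assumes lin: "linear_on_tuples F'"
    and rem: "\<And>H. H \<in> tuples V \<Longrightarrow> tnorm H \<le> 1 \<Longrightarrow> \<bar>F (U + H) - F U - F' H\<bar> \<le> K * (tnorm H)\<^sup>2"
  shows "differentiable_at F U"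
proof -
  have "frechet_on V F U F'"
    unfolding frechet_on_def
  proof (intro allI impI)
    fix e :: real assume e: "e > 0"
    let ?d = "min 1 (e / (\<bar>K\<bar> + 1))"
    have "\<bar>F (U + H) - F U - F' H\<bar> \<le> e * tnorm H" if H: "H \<in> tuples V" "tnorm H < ?d" for H
    proof -
      have n0: "tnorm H \<ge> 0" using H by simp
      have "\<bar>K\<bar> * tnorm H \<le> (\<bar>K\<bar> + 1) * tnorm H" using n0 by (intro mult_right_mono) auto
      also have "\<dots> \<le> e" using H(2) by (simp add: pos_less_divide_eq mult.commute)
      finally have Ke: "\<bar>K\<bar> * tnorm H \<le> e" .
      have "\<bar>F (U + H) - F U - F' H\<bar> \<le> K * (tnorm H)\<^sup>2" using H by (intro rem) auto
      also have "\<dots> \<le> \<bar>K\<bar> * (tnorm H)\<^sup>2" by (intro mult_right_mono) auto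
      also have "\<dots> = (\<bar>K\<bar> * tnorm H) * tnorm H" by (simp add: power2_eq_square)
      also have "\<dots> \<le> e * tnorm H" using Ke n0 by (rule mult_right_mono)
      finally show ?thesis .
    qed
    then show "\<exists>d>0. \<forall>H\<in>tuples V. tnorm H < d \<longrightarrow> \<bar>F (U + H) - F U - F' H\<bar> \<le> e * tnorm H"
      using e by (intro exI[of _ ?d]) auto
  qed
  then show ?thesis using lin by (auto simp: differentiable_at_def)
qed

text \<open>Symmetry is asked of all functions but linearity only on \<open>V\<close>: the kinetic
  form is linear where weak gradients exist, and the external form where the integrals
  converge.\<close>

definition bilinear_V :: "((real^3 \<Rightarrow> real) \<Rightarrow> (real^3 \<Rightarrow> real) \<Rightarrow> real) \<Rightarrow> bool" where
  "bilinear_V q \<longleftrightarrow> (\<forall>u v. q u v = q v u) \<and>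
     (\<forall>a b. \<forall>u\<in>V. \<forall>v\<in>V. \<forall>w\<in>V. q (a *\<^sub>R u + b *\<^sub>R v) w = a * q u w + b * q v w)"

context
  fixes q assumes q: "bilinear_V q"
begin

lemma q_commute: "q u v = q v u"
  using q unfolding bilinear_V_def by blast

lemma q_linear: "u \<in> V \<Longrightarrow> v \<in> V \<Longrightarrow> w \<in> V \<Longrightarrow> q (a *\<^sub>R u + b *\<^sub>R v) w = a * q u w + b * q v w"
  using q unfolding bilinear_V_def by blast

lemma q_add: "u \<in> V \<Longrightarrow> v \<in> V \<Longrightarrow> w \<in> V \<Longrightarrow> q (u + v) w = q u w + q v w"
  using q_linear[of u v w 1 1] by simp

lemma q_scaleR: "u \<in> V \<Longrightarrow> w \<in> V \<Longrightarrow> q (a *\<^sub>R u) w = a * q u w"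
  using q_linear[of u 0 w a 0] by simp

lemma q_add_right: "u \<in> V \<Longrightarrow> v \<in> V \<Longrightarrow> w \<in> V \<Longrightarrow> q w (u + v) = q w u + q w v"
  by (simp add: q_commute[of w] q_add)

lemma q_scaleR_right: "u \<in> V \<Longrightarrow> w \<in> V \<Longrightarrow> q w (a *\<^sub>R u) = a * q w u"
  by (simp add: q_commute[of w] q_scaleR)

lemma q_sum:
  assumes "\<And>i. i \<in> I \<Longrightarrow> f i \<in> V" "w \<in> V"
  shows "q (sum f I) w = (\<Sum>i\<in>I. q (f i) w)"
proof -
  have z: "q 0 w = 0" using q_scaleR[of 0 w 0] assms by simp
  show ?thesis using assms
    by (induction I rule: infinite_finite_induct) (auto simp: q_add z)
qed

lemma q_sum_right: "(\<And>i. i \<in> I \<Longrightarrow> f i \<in> V) \<Longrightarrow> w \<in> V \<Longrightarrow> q w (sum f I) = (\<Sum>i\<in>I. q w (f i))"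
  by (simp add: q_commute[of w] q_sum)

text \<open>In finite dimension every quadratic form is controlled by the L^2 norm, with the sum of
  its values on basis pairs as constant. For the kinetic form this is an inverse estimate, which
  fails on the full Sobolev space.\<close>

lemma q_bounded: "\<exists>K\<ge>0. \<forall>u\<in>V. \<bar>q u u\<bar> \<le> K * (V.nrm u)\<^sup>2"
proof -
  let ?K = "\<Sum>b\<in>V.onb. \<Sum>c\<in>V.onb. \<bar>q c b\<bar>"
  have "\<bar>q u u\<bar> \<le> ?K * (V.nrm u)\<^sup>2" if u: "u \<in> V" for u
  proof -
    define e where "e b = L2_inner u b" for b
    have ue: "u = (\<Sum>b\<in>V.onb. e b *\<^sub>R b)" unfolding e_def by (rule V.onb_expansion[OF u])
    have "q u u = q (\<Sum>b\<in>V.onb. e b *\<^sub>R b) (\<Sum>b\<in>V.onb. e b *\<^sub>R b)" using ue by simp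
    also have "\<dots> = (\<Sum>b\<in>V.onb. \<Sum>c\<in>V.onb. e b * e c * q c b)"
      by (simp add: q_sum q_sum_right q_scaleR q_scaleR_right sum_distrib_left mult_ac)
    also have "\<bar>\<dots>\<bar> \<le> (\<Sum>b\<in>V.onb. \<Sum>c\<in>V.onb. \<bar>q c b\<bar> * (V.nrm u)\<^sup>2)"
    proof (intro order_trans[OF sum_abs] sum_mono)
      fix b c assume "b \<in> V.onb" "c \<in> V.onb"
      then have "\<bar>e b\<bar> * \<bar>e c\<bar> \<le> V.nrm u * V.nrm u"
        unfolding e_def using u by (intro mult_mono V.abs_ip_onb_le) auto
      then have "\<bar>q c b\<bar> * (\<bar>e b\<bar> * \<bar>e c\<bar>) \<le> \<bar>q c b\<bar> * (V.nrm u * V.nrm u)" by (rule mult_left_mono) simp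
      then show "\<bar>e b * e c * q c b\<bar> \<le> \<bar>q c b\<bar> * (V.nrm u)\<^sup>2" by (simp add: abs_mult power2_eq_square mult_ac)
    qed
    finally show ?thesis by (simp add: sum_distrib_right)
  qed
  moreover have "?K \<ge> 0" by (simp add: sum_nonneg)
  ultimately show ?thesis by blast
qed

text \<open>By polarization the remainder is the form evaluated at the increment itself.\<close>

lemma differentiable_at_quadratic:
  fixes U :: "('n::finite) tuple"
  assumes U: "U \<in> tuples V"
  shows "differentiable_at (\<lambda>X. \<Sum>i\<in>UNIV. q (X $ i) (X $ i)) U"
proof -
  obtain K where K: "K \<ge> 0" "\<And>u. u \<in> V \<Longrightarrow> \<bar>q u u\<bar> \<le> K * (V.nrm u)\<^sup>2" using q_bounded by blast
  show ?thesis
  proof (rule differentiable_at_quadratic_remainder)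
    show "linear_on_tuples (\<lambda>H. 2 * (\<Sum>i\<in>UNIV. q (U $ i) (H $ i)))"
      using U by (simp add: linear_on_tuples_def q_add_right q_scaleR_right sum.distrib sum_distrib_left mult_ac)
    fix H :: "'n tuple" assume H: "H \<in> tuples V"
    have "q ((U + H) $ i) ((U + H) $ i) = q (U $ i) (U $ i) + 2 * q (U $ i) (H $ i) + q (H $ i) (H $ i)" for i
      using U H by (simp add: q_add q_add_right q_commute[of "H $ i" "U $ i"])
    then have "(\<Sum>i\<in>UNIV. q ((U + H) $ i) ((U + H) $ i)) - (\<Sum>i\<in>UNIV. q (U $ i) (U $ i)) - 2 * (\<Sum>i\<in>UNIV. q (U $ i) (H $ i)) = (\<Sum>i\<in>UNIV. q (H $ i) (H $ i))"
      by (simp add: sum.distrib sum_distrib_left)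
    also have "\<bar>\<dots>\<bar> \<le> (\<Sum>i\<in>(UNIV::'n set). K * (tnorm H)\<^sup>2)"
    proof (intro order_trans[OF sum_abs] sum_mono)
      fix i
      have "\<bar>q (H $ i) (H $ i)\<bar> \<le> K * (V.nrm (H $ i))\<^sup>2" using H K by simp
      also have "\<dots> \<le> K * (tnorm H)\<^sup>2"
        using H K(1) by (intro mult_left_mono power_mono nrm_nth_le) auto
      finally show "\<bar>q (H $ i) (H $ i)\<bar> \<le> K * (tnorm H)\<^sup>2" .
    qed
    finally show "\<bar>(\<Sum>i\<in>UNIV. q ((U + H) $ i) ((U + H) $ i)) - (\<Sum>i\<in>UNIV. q (U $ i) (U $ i)) - 2 * (\<Sum>i\<in>UNIV. q (U $ i) (H $ i))\<bar> \<le> (real CARD('n) * K) * (tnorm H)\<^sup>2"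
      by simp
  qed
qed

lemma quadratic_tmul:
  assumes U: "U \<in> tuples V" and P: "orthogonal_matrix P"
  shows "(\<Sum>i\<in>UNIV. q (tmul U P $ i) (tmul U P $ i)) = (\<Sum>i\<in>UNIV. q (U $ i) (U $ i))"
proof -
  have "q (tmul U P $ i) (tmul U P $ i) = (\<Sum>j\<in>UNIV. \<Sum>k\<in>UNIV. P $ j $ i * P $ k $ i * q (U $ k) (U $ j))" for i
    using U by (simp add: tmul_nth q_sum q_sum_right q_scaleR q_scaleR_right sum_distrib_left mult_ac)
  then show ?thesis using orthogonal_double_sum[OF P, of "\<lambda>j k. q (U $ k) (U $ j)"] by simp
qed

end

end

lemma sum_scaleR_apply: "(\<Sum>i\<in>I. c i *\<^sub>R f i) x = (\<Sum>i\<in>I. c i * f i x)" for f :: "'b \<Rightarrow> 'a \<Rightarrow> real"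
  by (induction I rule: infinite_finite_induct) auto

section \<open>The terms of the Kohn-Sham energy\<close>

definition Coulomb :: "(real^3 \<Rightarrow> real) \<Rightarrow> (real^3 \<Rightarrow> real) \<Rightarrow> real" where
  "Coulomb f g = (LINT (r, r')|(lborel \<Otimes>\<^sub>M lborel). f r * g r' / norm (r - r'))"

definition mixed_density :: "('n::finite) tuple \<Rightarrow> 'n tuple \<Rightarrow> real^3 \<Rightarrow> real" where
  "mixed_density X Y r = 2 * (\<Sum>i\<in>UNIV. (X $ i) r * (Y $ i) r)"

lemma density_eq_mixed: "density U = mixed_density U U"
  by (rule ext) (simp add: density_def mixed_density_def power2_eq_square)

lemma density_add: "density (U + H) = (\<lambda>r. density U r + (2 * mixed_density U H r + density H r))"
  by (rule ext) (simp add: density_def mixed_density_def power2_sum sum.distrib sum_distrib_left algebra_simps)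

locale H1_space = L2_space V for V +
  assumes V_H1: "V \<subseteq> H1"
begin

text \<open>One function that dominates all of \<open>V\<close> pointwise, up to the L^2 norm. Every
  product of two members of \<open>V\<close> is thus bounded by a multiple of the squared envelope,
  and a single Coulomb integral controls the whole Hartree term.\<close>

definition envelope :: "real^3 \<Rightarrow> real" where
  "envelope r = (\<Sum>b\<in>V.onb. \<bar>b r\<bar>)"

lemma envelope_measurable [measurable]: "envelope \<in> borel_measurable borel"
  unfolding envelope_def[abs_def] by (intro borel_measurable_sum borel_measurable_abs measurable_V) auto

lemma envelope_bound:
  assumes "v \<in> V" shows "\<bar>v r\<bar> \<le> V.nrm v * envelope r"
proof -
  have "v r = (\<Sum>b\<in>V.onb. L2_inner v b * b r)"
    using V.onb_expansion[OF assms] sum_scaleR_apply by metis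
  also have "\<bar>\<dots>\<bar> \<le> (\<Sum>b\<in>V.onb. V.nrm v * \<bar>b r\<bar>)"
    using V.abs_ip_onb_le[OF assms] by (intro order_trans[OF sum_abs] sum_mono) (auto simp: abs_mult intro: mult_right_mono)
  finally show ?thesis by (simp add: envelope_def sum_distrib_left)
qed

lemma envelope_Coulomb_integrable:
  "integrable (lborel \<Otimes>\<^sub>M lborel) (\<lambda>(x, y). (envelope x)\<^sup>2 * (envelope y)\<^sup>2 / norm (x - y))"
proof (rule Coulomb_integrable)
  have B: "b \<in> H1" "square_integrable b" "b \<in> borel_measurable borel" if "b \<in> V.onb" for b
    using that V_H1 square_integrable_V measurable_V by auto
  show "(\<integral>\<^sup>+x. ennreal ((envelope x)\<^sup>2) \<partial>lborel) < \<infinity>"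
    unfolding envelope_def
  proof (rule nn_integral_power_sum)
    show "(\<integral>\<^sup>+x. ennreal (\<bar>b x\<bar>\<^sup>2) \<partial>lborel) < \<infinity>" if "b \<in> V.onb" for b
      using square_integrable_nn_integral[OF B(2)[OF that]] by simp
  qed (use B V.onb in auto)
  have "(\<integral>\<^sup>+x. ennreal ((envelope x) ^ 3) \<partial>lborel) < \<infinity>"
    unfolding envelope_def
  proof (rule nn_integral_power_sum)
    show "(\<integral>\<^sup>+x. ennreal (\<bar>b x\<bar> ^ 3) \<partial>lborel) < \<infinity>" if "b \<in> V.onb" for b
      using H1_imp_cube_integrable[OF B(2)[OF that] wgrad_props[OF B(1)[OF that]]] .
  qed (use B V.onb in auto)
  moreover have "\<bar>envelope x\<bar> = envelope x" for x by (simp add: envelope_def sum_nonneg)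
  ultimately show "(\<integral>\<^sup>+x. ennreal (\<bar>envelope x\<bar> ^ 3) \<partial>lborel) < \<infinity>" by simp
qed measurable

definition dominated :: "real \<Rightarrow> (real^3 \<Rightarrow> real) \<Rightarrow> bool" where
  "dominated M f \<longleftrightarrow> f \<in> borel_measurable borel \<and> (\<forall>r. \<bar>f r\<bar> \<le> M * (envelope r)\<^sup>2)"

text \<open>The Coulomb form inherits the product of the two pointwise bounds; the constant is the
  Coulomb self-energy of the squared envelope, which is finite.\<close>

lemma Coulomb_dominated:
  assumes f: "dominated M f" and g: "dominated M' g" and M: "M \<ge> 0" "M' \<ge> 0"
  shows "integrable (lborel \<Otimes>\<^sub>M lborel) (\<lambda>(r, r'). f r * g r' / norm (r - r'))"
    and "\<bar>Coulomb f g\<bar> \<le> M * M' * Coulomb (\<lambda>r. (envelope r)\<^sup>2) (\<lambda>r. (envelope r)\<^sup>2)"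
proof -
  have [measurable]: "f \<in> borel_measurable borel" "g \<in> borel_measurable borel"
    using f g by (auto simp: dominated_def)
  let ?k = "\<lambda>(r, r'). M * M' * ((envelope r)\<^sup>2 * (envelope r')\<^sup>2 / norm (r - r'))"
  have k: "integrable (lborel \<Otimes>\<^sub>M lborel) ?k"
    using integrable_mult_right[OF envelope_Coulomb_integrable, of "M * M'"] by (simp add: case_prod_beta')
  have le: "norm (case z of (r, r') \<Rightarrow> f r * g r' / norm (r - r')) \<le> ?k z" for z
  proof -
    obtain r r' where z: "z = (r, r')" by force
    have "\<bar>f r\<bar> * \<bar>g r'\<bar> \<le> (M * (envelope r)\<^sup>2) * (M' * (envelope r')\<^sup>2)"
      using f g M by (intro mult_mono) (auto simp: dominated_def)
    from divide_right_mono[OF this norm_ge_zero[of "r - r'"]] show ?thesis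
      by (simp add: z abs_mult mult_ac)
  qed
  show int: "integrable (lborel \<Otimes>\<^sub>M lborel) (\<lambda>(r, r'). f r * g r' / norm (r - r'))"
    using le by (intro Bochner_Integration.integrable_bound[OF k]) (auto intro!: always_eventually order_trans[OF _ abs_ge_self])
  have "\<bar>Coulomb f g\<bar> \<le> (LINT z|(lborel \<Otimes>\<^sub>M lborel). ?k z)"
    unfolding Coulomb_def by (rule order_trans[OF integral_abs_bound]) (use le in \<open>intro integral_mono integrable_abs int k; simp\<close>)
  also have "\<dots> = M * M' * Coulomb (\<lambda>r. (envelope r)\<^sup>2) (\<lambda>r. (envelope r)\<^sup>2)"
    unfolding Coulomb_def by (subst integral_mult_right_zero[symmetric]) (simp add: case_prod_beta')
  finally show "\<bar>Coulomb f g\<bar> \<le> M * M' * Coulomb (\<lambda>r. (envelope r)\<^sup>2) (\<lambda>r. (envelope r)\<^sup>2)" .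
qed

text \<open>For the bilinear algebra of \<open>Coulomb\<close>, where integrability is needed but
  the constants are not.\<close>

definition dominated_some :: "(real^3 \<Rightarrow> real) \<Rightarrow> bool" where
  "dominated_some f \<longleftrightarrow> (\<exists>M\<ge>0. dominated M f)"

lemma Coulomb_add_left:
  assumes "dominated_some f" "dominated_some g" "dominated_some h"
  shows "Coulomb (\<lambda>r. f r + g r) h = Coulomb f h + Coulomb g h"
proof -
  have "integrable (lborel \<Otimes>\<^sub>M lborel) (\<lambda>(r, r'). f r * h r' / norm (r - r'))"
    "integrable (lborel \<Otimes>\<^sub>M lborel) (\<lambda>(r, r'). g r * h r' / norm (r - r'))"
    using assms Coulomb_dominated(1) unfolding dominated_some_def by blast+
  then have "(LINT z|(lborel \<Otimes>\<^sub>M lborel). (case z of (r, r') \<Rightarrow> f r * h r' / norm (r - r')) + (case z of (r, r') \<Rightarrow> g r * h r' / norm (r - r')))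
     = Coulomb f h + Coulomb g h"
    unfolding Coulomb_def by (rule Bochner_Integration.integral_add)
  then show ?thesis
    by (simp add: Coulomb_def case_prod_beta' add_divide_distrib distrib_right)
qed

lemma Coulomb_commute:
  assumes "dominated_some f" "dominated_some g"
  shows "Coulomb f g = Coulomb g f"
proof -
  have m: "(\<lambda>(r, r'). g r * f r' / norm (r - r')) \<in> borel_measurable (lborel \<Otimes>\<^sub>M lborel)"
    using assms Coulomb_dominated(1) unfolding dominated_some_def by blast
  show ?thesis
    using lborel_pair.integral_product_swap[OF m] by (simp add: Coulomb_def norm_minus_commute mult.commute)
qed

lemma Coulomb_mult_left: "Coulomb (\<lambda>r. c * f r) g = c * Coulomb f g"
  by (simp add: Coulomb_def case_prod_beta' mult.assoc flip: times_divide_eq_right)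

lemma dominated_some_add:
  assumes "dominated_some f" "dominated_some g" shows "dominated_some (\<lambda>r. f r + g r)"
proof -
  obtain M M' where M: "M \<ge> 0" "dominated M f" "M' \<ge> 0" "dominated M' g"
    using assms by (auto simp: dominated_some_def)
  have "\<bar>f r + g r\<bar> \<le> (M + M') * (envelope r)\<^sup>2" for r
  proof -
    have "\<bar>f r\<bar> \<le> M * (envelope r)\<^sup>2" "\<bar>g r\<bar> \<le> M' * (envelope r)\<^sup>2" using M by (auto simp: dominated_def)
    then show ?thesis by (simp add: distrib_right)
  qed
  then have "dominated (M + M') (\<lambda>r. f r + g r)"
    using M by (auto simp: dominated_def)
  then show ?thesis using M unfolding dominated_some_def by (meson add_nonneg_nonneg)
qed

lemma mixed_density_dominated:
  fixes X Y :: "('n::finite) tuple"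
  assumes "X \<in> tuples V" "Y \<in> tuples V"
  shows "dominated (2 * real CARD('n) * (tnorm X * tnorm Y)) (mixed_density X Y)"
  unfolding dominated_def
proof (intro conjI allI)
  show "mixed_density X Y \<in> borel_measurable borel"
    unfolding mixed_density_def[abs_def] using assms
    by (intro borel_measurable_times borel_measurable_sum borel_measurable_const measurable_V) auto
  fix r
  have "\<bar>mixed_density X Y r\<bar> \<le> 2 * (\<Sum>i\<in>UNIV. \<bar>(X $ i) r * (Y $ i) r\<bar>)"
    using sum_abs[of "\<lambda>i. (X $ i) r * (Y $ i) r" UNIV] by (simp add: mixed_density_def abs_mult[of 2])
  also have "\<dots> \<le> 2 * (\<Sum>i\<in>(UNIV::'n set). (tnorm X * tnorm Y) * (envelope r)\<^sup>2)"
  proof (intro mult_left_mono sum_mono)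
    fix i
    have e0: "envelope r \<ge> 0" by (simp add: envelope_def sum_nonneg)
    have *: "\<bar>(Z $ i) r\<bar> \<le> tnorm Z * envelope r" if "Z \<in> tuples V" for Z :: "'n tuple"
    proof -
      have "\<bar>(Z $ i) r\<bar> \<le> V.nrm (Z $ i) * envelope r" using that by (intro envelope_bound) simp
      also have "\<dots> \<le> tnorm Z * envelope r" by (intro mult_right_mono nrm_nth_le that e0)
      finally show ?thesis .
    qed
    have "\<bar>(X $ i) r\<bar> * \<bar>(Y $ i) r\<bar> \<le> (tnorm X * envelope r) * (tnorm Y * envelope r)"
      using * assms e0 by (intro mult_mono) auto
    then show "\<bar>(X $ i) r * (Y $ i) r\<bar> \<le> (tnorm X * tnorm Y) * (envelope r)\<^sup>2"
      by (simp add: abs_mult power2_eq_square mult_ac)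
  qed simp
  finally show "\<bar>mixed_density X Y r\<bar> \<le> 2 * real CARD('n) * (tnorm X * tnorm Y) * (envelope r)\<^sup>2"
    by simp
qed

lemma mixed_density_dominated_some: "X \<in> tuples V \<Longrightarrow> Y \<in> tuples V \<Longrightarrow> dominated_some (mixed_density X Y)"
  unfolding dominated_some_def using mixed_density_dominated[of X Y] by (intro exI[of _ "2 * real CARD('a) * (tnorm X * tnorm Y)"]) auto

text \<open>The density at U + H is a + b + c with a the density at U, b = 2
  \<open>mixed_density U H\<close> linear in H, and c the density of H. The term linear in H of half
  the Coulomb energy is the Coulomb form of b and a, and everything else is at least
  quadratic.\<close>

lemma Hartree_differentiable:
  fixes U :: "('n::finite) tuple"
  assumes U: "U \<in> tuples V"
  shows "differentiable_at (\<lambda>X. 1 / 2 * (LINT (r, r')|(lborel \<Otimes>\<^sub>M lborel). density X r * density X r' / norm (r - r'))) U"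
proof -
  let ?a = "density U" and ?b = "\<lambda>H r. 2 * mixed_density U H r"
  let ?C = "Coulomb (\<lambda>r. (envelope r)\<^sup>2) (\<lambda>r. (envelope r)\<^sup>2)"
  let ?N = "2 * real CARD('n)"
  \<comment> \<open>With u = |||U||| and h = |||H|||, the terms (c,a), (b,b), (b,c) and (c,c) add up
    to 6 u^2 + 4 u h + h^2 times h^2, and h is at most one. The factor \<open>?N\<close> is the
    constant in the bound of the mixed density.\<close>
  let ?K = "1 / 2 * ?C * ?N\<^sup>2 * (6 * (tnorm U)\<^sup>2 + 4 * tnorm U + 1)"
  have dm: "dominated_some (mixed_density X Y)" if "X \<in> tuples V" "Y \<in> tuples V" for X Y :: "'n tuple"
    using that by (rule mixed_density_dominated_some)
  have da: "dominated_some ?a" using U dm by (simp add: density_eq_mixed)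
  have "differentiable_at (\<lambda>X. 1 / 2 * Coulomb (density X) (density X)) U"
  proof (rule differentiable_at_quadratic_remainder)
    let ?F' = "\<lambda>H. 2 * Coulomb (mixed_density U H) ?a"
    have "mixed_density U (X + Y) = (\<lambda>r. mixed_density U X r + mixed_density U Y r)" for X Y
      by (rule ext) (simp add: mixed_density_def distrib_left sum.distrib)
    moreover have "mixed_density U (c *\<^sub>R X) = (\<lambda>r. c * mixed_density U X r)" for c X
      by (rule ext) (simp add: mixed_density_def sum_distrib_left mult_ac)
    ultimately show "linear_on_tuples ?F'"
      using U by (simp add: linear_on_tuples_def Coulomb_add_left da dm Coulomb_mult_left)
    fix H :: "'n tuple" assume H: "H \<in> tuples V" "tnorm H \<le> 1"
    let ?c = "density H"
    have dc: "dominated_some ?c" using H dm by (simp add: density_eq_mixed)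
    have db: "dominated_some (?b H)"
      using dominated_some_add[OF dm[OF U H(1)] dm[OF U H(1)]] by (simp only: mult_2)
    define h where "h = tnorm H"
    define u where "u = tnorm U"
    have h: "0 \<le> h" "h \<le> 1" and u: "0 \<le> u" using H U by (auto simp: h_def u_def)
    have Ma: "dominated (?N * u\<^sup>2) ?a" and Mc: "dominated (?N * h\<^sup>2) ?c"
      using mixed_density_dominated[OF U U] mixed_density_dominated[OF H(1) H(1)]
      by (simp_all add: density_eq_mixed u_def h_def power2_eq_square)
    have Mb: "dominated (2 * ?N * u * h) (?b H)"
    proof -
      have "\<bar>?b H r\<bar> \<le> 2 * ?N * u * h * (envelope r)\<^sup>2" for r
      proof -
        have "\<bar>mixed_density U H r\<bar> \<le> ?N * (u * h) * (envelope r)\<^sup>2"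
          using mixed_density_dominated[OF U H(1)] unfolding dominated_def u_def h_def by blast
        then have "2 * \<bar>mixed_density U H r\<bar> \<le> 2 * (?N * (u * h) * (envelope r)\<^sup>2)" by linarith
        then show ?thesis by (simp only: abs_mult abs_numeral mult.assoc)
      qed
      moreover have "?b H \<in> borel_measurable borel"
        using mixed_density_dominated[OF U H(1)]
        by (intro borel_measurable_times borel_measurable_const) (simp add: dominated_def)
      ultimately show ?thesis unfolding dominated_def by blast
    qed
    have dbc: "dominated_some (\<lambda>r. ?b H r + ?c r)" by (rule dominated_some_add[OF db dc])
    have "Coulomb (density (U + H)) (density (U + H)) = Coulomb ?a ?a + 2 * Coulomb (\<lambda>r. ?b H r + ?c r) ?a + Coulomb (\<lambda>r. ?b H r + ?c r) (\<lambda>r. ?b H r + ?c r)"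
    proof -
      let ?t = "\<lambda>r. ?b H r + ?c r"
      have dt: "dominated_some (\<lambda>r. ?a r + ?t r)" by (rule dominated_some_add[OF da dbc])
      have "Coulomb (\<lambda>r. ?a r + ?t r) (\<lambda>r. ?a r + ?t r) = Coulomb ?a (\<lambda>r. ?a r + ?t r) + Coulomb ?t (\<lambda>r. ?a r + ?t r)"
        by (rule Coulomb_add_left[OF da dbc dt])
      also have "Coulomb ?a (\<lambda>r. ?a r + ?t r) = Coulomb ?a ?a + Coulomb ?t ?a"
        using Coulomb_commute[OF da dt] Coulomb_add_left[OF da dbc da] by simp
      also have "Coulomb ?t (\<lambda>r. ?a r + ?t r) = Coulomb ?t ?a + Coulomb ?t ?t"
        using Coulomb_commute[OF dbc dt] Coulomb_add_left[OF da dbc dbc] Coulomb_commute[OF da dbc] by simp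
      finally show ?thesis by (simp add: density_add)
    qed
    also have "Coulomb (\<lambda>r. ?b H r + ?c r) ?a = 2 * Coulomb (mixed_density U H) ?a + Coulomb ?c ?a"
      using Coulomb_add_left[OF db dc da] by (simp add: Coulomb_mult_left)
    also have "Coulomb (\<lambda>r. ?b H r + ?c r) (\<lambda>r. ?b H r + ?c r) = Coulomb (?b H) (?b H) + 2 * Coulomb (?b H) ?c + Coulomb ?c ?c"
    proof -
      have "Coulomb (\<lambda>r. ?b H r + ?c r) (\<lambda>r. ?b H r + ?c r) = Coulomb (?b H) (\<lambda>r. ?b H r + ?c r) + Coulomb ?c (\<lambda>r. ?b H r + ?c r)"
        by (rule Coulomb_add_left[OF db dc dbc])
      also have "Coulomb (?b H) (\<lambda>r. ?b H r + ?c r) = Coulomb (?b H) (?b H) + Coulomb (?b H) ?c"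
        using Coulomb_commute[OF db dbc] Coulomb_add_left[OF db dc db] Coulomb_commute[OF db dc] by simp
      also have "Coulomb ?c (\<lambda>r. ?b H r + ?c r) = Coulomb (?b H) ?c + Coulomb ?c ?c"
        using Coulomb_commute[OF dc dbc] Coulomb_add_left[OF db dc dc] by simp
      finally show ?thesis by simp
    qed
    \<comment> \<open>What is left after removing the constant and the linear part; each of the four
      terms contains H at least twice.\<close>
    finally have eq: "1 / 2 * Coulomb (density (U + H)) (density (U + H)) - 1 / 2 * Coulomb ?a ?a - ?F' H =
       1 / 2 * (2 * Coulomb ?c ?a + (Coulomb (?b H) (?b H) + 2 * Coulomb (?b H) ?c + Coulomb ?c ?c))"
      by (simp add: algebra_simps)
    have nn: "0 \<le> ?N * u\<^sup>2" "0 \<le> ?N * h\<^sup>2" "0 \<le> 2 * ?N * u * h" using u h by auto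
    have b1: "\<bar>Coulomb ?c ?a\<bar> \<le> ?N * h\<^sup>2 * (?N * u\<^sup>2) * ?C" by (rule Coulomb_dominated(2)[OF Mc Ma nn(2,1)])
    have b2: "\<bar>Coulomb (?b H) (?b H)\<bar> \<le> 2 * ?N * u * h * (2 * ?N * u * h) * ?C" by (rule Coulomb_dominated(2)[OF Mb Mb nn(3,3)])
    have b3: "\<bar>Coulomb (?b H) ?c\<bar> \<le> 2 * ?N * u * h * (?N * h\<^sup>2) * ?C" by (rule Coulomb_dominated(2)[OF Mb Mc nn(3,2)])
    have b4: "\<bar>Coulomb ?c ?c\<bar> \<le> ?N * h\<^sup>2 * (?N * h\<^sup>2) * ?C" by (rule Coulomb_dominated(2)[OF Mc Mc nn(2,2)])
    have C0: "?C \<ge> 0" unfolding Coulomb_def by (rule Bochner_Integration.integral_nonneg) auto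
    have "\<bar>1 / 2 * Coulomb (density (U + H)) (density (U + H)) - 1 / 2 * Coulomb ?a ?a - ?F' H\<bar> \<le>
      1 / 2 * (2 * (?N * h\<^sup>2 * (?N * u\<^sup>2) * ?C) + (2 * ?N * u * h * (2 * ?N * u * h) * ?C + 2 * (2 * ?N * u * h * (?N * h\<^sup>2) * ?C) + ?N * h\<^sup>2 * (?N * h\<^sup>2) * ?C))"
    proof -
      have "\<bar>1 / 2 * (2 * p + (q + 2 * s + t))\<bar> \<le> 1 / 2 * (2 * p' + (q' + 2 * s' + t'))"
        if "\<bar>p\<bar> \<le> p'" "\<bar>q\<bar> \<le> q'" "\<bar>s\<bar> \<le> s'" "\<bar>t\<bar> \<le> t'" for p q s t p' q' s' t' :: real
        using that by (auto simp: abs_le_iff)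
      from this[OF b1 b2 b3 b4] show ?thesis unfolding eq .
    qed
    also have "\<dots> = 1 / 2 * ?C * ?N\<^sup>2 * (6 * u\<^sup>2 + 4 * u * h + h * h) * h\<^sup>2"
      by (simp add: power2_eq_square algebra_simps)
    also have "\<dots> \<le> 1 / 2 * ?C * ?N\<^sup>2 * (6 * u\<^sup>2 + 4 * u + 1) * h\<^sup>2"
    proof (intro mult_right_mono mult_left_mono add_mono)
      show "4 * u * h \<le> 4 * u" using u h by (simp add: mult_left_le)
      show "h * h \<le> 1" using h by (simp add: mult_le_one)
    qed (use C0 in auto)
    finally show "\<bar>1 / 2 * Coulomb (density (U + H)) (density (U + H)) - 1 / 2 * Coulomb ?a ?a - ?F' H\<bar> \<le> ?K * (tnorm H)\<^sup>2"
      by (simp add: u_def h_def)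
  qed
  then show ?thesis by (simp add: Coulomb_def)
qed

lemma kinetic_bilinear: "bilinear_V kinetic_form"
  unfolding bilinear_V_def
proof (intro conjI allI ballI)
  show "kinetic_form u v = kinetic_form v u" for u v by (simp add: kinetic_form_def inner_commute)
  fix a b u v w assume uvw: "u \<in> V" "v \<in> V" "w \<in> V"
  then have "a *\<^sub>R u + b *\<^sub>R v \<in> V" by simp
  then show "kinetic_form (a *\<^sub>R u + b *\<^sub>R v) w = a * kinetic_form u w + b * kinetic_form v w"
    using uvw V_H1 by (intro kinetic_form_linear) auto
qed

lemma differentiable_at_cong:
  assumes "\<And>X. X \<in> tuples V \<Longrightarrow> F X = G X" "U \<in> tuples V" "differentiable_at F U"
  shows "differentiable_at G U"
proof -
  have "frechet_on V G U F'" if "frechet_on V F U F'" for F'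
    using that assms(1,2) unfolding frechet_on_def by simp
  then show ?thesis using assms(3) by (auto simp: differentiable_at_def)
qed

lemma differentiable_imp_gradient:
  assumes "differentiable_at F U"
  shows "\<exists>G\<in>tuples V. frechet_on V F U (tinner G)"
proof -
  obtain F' where F': "linear_on_tuples F'" "frechet_on V F U F'"
    using assms by (auto simp: differentiable_at_def)
  obtain G where "G \<in> tuples V" "\<And>H. H \<in> tuples V \<Longrightarrow> F' H = tinner G H"
    using T.Riesz[of F'] F'(1) unfolding linear_on_tuples_def by blast
  then show ?thesis using F'(2) unfolding frechet_on_def by (intro bexI[of _ G]) auto
qed

text \<open>The hypothesis speaks of densities only. The tuple with all entries equal to w has
  density 2 N w^2, which gives integrability for squares; polarization gives mixed products.\<close>

lemma external_potential_integrable: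
  assumes energy: "energy_well_defined TYPE('n::finite) Vext exc" and u: "u \<in> V" and v: "v \<in> V"
  shows "integrable lborel (\<lambda>r. Vext r * u r * v r)"
proof -
  have sq: "integrable lborel (\<lambda>r. Vext r * (w r)\<^sup>2)" if "w \<in> V" for w
  proof -
    let ?W = "(\<chi> i. w) :: 'n tuple"
    have "?W \<in> tuples H1" using that V_H1 by (auto simp: tuples_def)
    then have "integrable lborel (\<lambda>r. Vext r * density ?W r)"
      using energy unfolding energy_well_defined_def by blast
    then have "integrable lborel (\<lambda>r. (1 / (2 * real CARD('n))) * (Vext r * density ?W r))"
      by (rule integrable_mult_right)
    then show ?thesis by (simp add: density_def)
  qed
  have "integrable lborel (\<lambda>r. 1 / 2 * (Vext r * ((u + v) r)\<^sup>2 - Vext r * (u r)\<^sup>2 - Vext r * (v r)\<^sup>2))"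
    by (intro integrable_mult_right Bochner_Integration.integrable_diff sq V.mem_add u v)
  also have "(\<lambda>r. 1 / 2 * (Vext r * ((u + v) r)\<^sup>2 - Vext r * (u r)\<^sup>2 - Vext r * (v r)\<^sup>2)) = (\<lambda>r. Vext r * u r * v r)"
    by (rule ext) (simp add: power2_sum field_simps)
  finally show ?thesis .
qed

lemma external_bilinear:
  assumes energy: "energy_well_defined TYPE('n::finite) Vext exc"
  shows "bilinear_V (\<lambda>u v. 2 * (LBINT r. Vext r * u r * v r))"
  unfolding bilinear_V_def
proof (intro conjI allI ballI)
  show "2 * (LBINT r. Vext r * u r * v r) = 2 * (LBINT r. Vext r * v r * u r)" for u v by (simp add: mult_ac)
  fix a b u v w assume uvw: "u \<in> V" "v \<in> V" "w \<in> V"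
  note I = external_potential_integrable[OF energy]
  have "(LBINT r. Vext r * (a *\<^sub>R u + b *\<^sub>R v) r * w r) = (LBINT r. a * (Vext r * u r * w r) + b * (Vext r * v r * w r))"
    by (simp add: algebra_simps)
  also have "\<dots> = a * (LBINT r. Vext r * u r * w r) + b * (LBINT r. Vext r * v r * w r)"
    using I[OF uvw(1,3)] I[OF uvw(2,3)] by simp
  finally show "2 * (LBINT r. Vext r * (a *\<^sub>R u + b *\<^sub>R v) r * w r) =
      a * (2 * (LBINT r. Vext r * u r * w r)) + b * (2 * (LBINT r. Vext r * v r * w r))" by simp
qed

text \<open>The derivative is prescribed as an integral. Its additivity in the increment has to be
  proved by splitting it into one integral per entry, each of which converges.\<close>

lemma xc_energy_differentiable:
  fixes U :: "('n::finite) tuple"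
  assumes xc: "xc_differentiable TYPE('n) V exc vxc" and U: "U \<in> tuples V"
  shows "differentiable_at (xc_energy exc) U"
proof -
  let ?F' = "\<lambda>H. LBINT r. vxc (density U) r * (4 * (\<Sum>i\<in>UNIV. (U $ i) r * (H $ i) r))"
  have I: "integrable lborel (\<lambda>r. vxc (density U) r * (U $ i) r * v r)" if "v \<in> V" for i v
    using xc U that unfolding xc_differentiable_def by blast
  have F': "?F' H = 4 * (\<Sum>i\<in>UNIV. LBINT r. vxc (density U) r * (U $ i) r * (H $ i) r)" if "H \<in> tuples V" for H
  proof -
    have "?F' H = (LBINT r. 4 * (\<Sum>i\<in>UNIV. vxc (density U) r * (U $ i) r * (H $ i) r))"
      by (simp add: sum_distrib_left mult_ac)
    also have "\<dots> = 4 * (\<Sum>i\<in>UNIV. LBINT r. vxc (density U) r * (U $ i) r * (H $ i) r)"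
      using that I by (simp add: Bochner_Integration.integral_sum)
    finally show ?thesis .
  qed
  have "?F' (X + Y) = ?F' X + ?F' Y" if "X \<in> tuples V" "Y \<in> tuples V" for X Y
  proof -
    have "?F' (X + Y) = 4 * (\<Sum>i\<in>UNIV. LBINT r. vxc (density U) r * (U $ i) r * ((X + Y) $ i) r)"
      by (rule F') (use that in simp)
    also have "\<dots> = 4 * (\<Sum>i\<in>UNIV. (LBINT r. vxc (density U) r * (U $ i) r * (X $ i) r) + (LBINT r. vxc (density U) r * (U $ i) r * (Y $ i) r))"
      using that I by (simp add: distrib_left)
    also have "\<dots> = ?F' X + ?F' Y"
      unfolding F'[OF that(1)] F'[OF that(2)] by (simp only: sum.distrib distrib_left)
    finally show ?thesis .
  qed
  moreover have "?F' (c *\<^sub>R X) = c * ?F' X" for c X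
    by (simp add: sum_distrib_left mult_ac flip: integral_mult_right_zero)
  ultimately have "linear_on_tuples ?F'" unfolding linear_on_tuples_def by blast
  moreover have "frechet_on V (xc_energy exc) U ?F'"
    using xc U unfolding xc_differentiable_def by blast
  ultimately show ?thesis unfolding differentiable_at_def by blast
qed

theorem ks_energy_space:
  assumes energy: "energy_well_defined TYPE('n::finite) Vext exc" and xc: "xc_differentiable TYPE('n) V exc vxc"
  shows "energy_space V (ks_energy Vext exc :: 'n tuple \<Rightarrow> real)"
proof
  let ?q = "\<lambda>u v. 2 * (LBINT r. Vext r * u r * v r)"
  have kin: "(\<Sum>i\<in>UNIV. LBINT r. (norm (wgrad (X $ i) r))\<^sup>2) = (\<Sum>i\<in>UNIV. kinetic_form (X $ i) (X $ i))" for X :: "'n tuple"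
    by (simp add: kinetic_form_def power2_norm_eq_inner)
  show "V \<subseteq> H1" by (rule V_H1)
  fix U :: "'n tuple" assume U: "U \<in> tuples V"
  have "differentiable_at (\<lambda>X. \<Sum>i\<in>UNIV. LBINT r. (norm (wgrad (X $ i) r))\<^sup>2) U"
    unfolding kin by (rule differentiable_at_quadratic[OF kinetic_bilinear U])
  moreover have "differentiable_at (\<lambda>X. LBINT r. Vext r * density X r) U"
  proof (rule differentiable_at_cong[OF _ U differentiable_at_quadratic[OF external_bilinear[OF energy] U]])
    fix X :: "'n tuple" assume "X \<in> tuples V"
    then have I: "integrable lborel (\<lambda>r. Vext r * (X $ i) r * (X $ i) r)" for i
      by (intro external_potential_integrable[OF energy]) auto
    have "(LBINT r. Vext r * density X r) = (LBINT r. (\<Sum>i\<in>UNIV. 2 * (Vext r * (X $ i) r * (X $ i) r)))"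
      by (simp add: density_def sum_distrib_left power2_eq_square mult_ac)
    also have "\<dots> = (\<Sum>i\<in>UNIV. ?q (X $ i) (X $ i))"
      using I by (simp add: Bochner_Integration.integral_sum)
    finally show "(\<Sum>i\<in>UNIV. ?q (X $ i) (X $ i)) = (LBINT r. Vext r * density X r)" by simp
  qed
  ultimately have "differentiable_at (ks_energy Vext exc) U"
    unfolding ks_energy_def[abs_def]
    by (intro differentiable_at_add Hartree_differentiable[OF U] xc_energy_differentiable[OF xc U])
  then show "\<exists>G\<in>tuples V. frechet_on V (ks_energy Vext exc) U (tinner G)"
    by (rule differentiable_imp_gradient)
  fix P :: "real^'n^'n" assume P: "orthogonal_matrix P"
  show "ks_energy Vext exc (tmul U P) = ks_energy Vext exc U"
    unfolding ks_energy_def kin quadratic_tmul[OF kinetic_bilinear U P] xc_energy_def density_tmul[OF P] ..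
qed

end

subsection \<open>Energy decrease\<close>

context energy_space
begin

lemma skew_op_tuples [simp]: "Y \<in> tuples V \<Longrightarrow> skew_op V E Y X \<in> tuples V"
  by (simp add: skew_op_def)

lemma skew_op_add: "Y \<in> tuples V \<Longrightarrow> X \<in> tuples V \<Longrightarrow> Z \<in> tuples V \<Longrightarrow>
    skew_op V E Y (X + Z) = skew_op V E Y X + skew_op V E Y Z"
  by (simp add: skew_op_def gram_add_right tmul_add_right)

lemma skew_op_diff: "Y \<in> tuples V \<Longrightarrow> X \<in> tuples V \<Longrightarrow> Z \<in> tuples V \<Longrightarrow>
    skew_op V E Y (X - Z) = skew_op V E Y X - skew_op V E Y Z"
  by (simp add: skew_op_def gram_diff_right tmul_diff_right)

lemma skew_op_scaleR: "Y \<in> tuples V \<Longrightarrow> X \<in> tuples V \<Longrightarrow> skew_op V E Y (c *\<^sub>R X) = c *\<^sub>R skew_op V E Y X"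
  by (simp add: skew_op_def gram_scaleR_right tmul_scaleR_right scaleR_diff_right)

text \<open>Skewness for the matrix-valued product, stronger than for its trace; this is what
  preserves the entire Gram matrix and not merely the norm.\<close>

lemma gram_skew_op:
  assumes "Y \<in> tuples V" "X \<in> tuples V" "Z \<in> tuples V"
  shows "gram (skew_op V E Y X) Z = - gram X (skew_op V E Y Z)"
proof -
  let ?G = "grad V E Y"
  have "gram (skew_op V E Y X) Z = gram X Y ** gram ?G Z - gram X ?G ** gram Y Z"
    using assms by (simp add: skew_op_def gram_diff_left gram_tmul_left flip: gram_commute)
  moreover have "gram X (skew_op V E Y Z) = gram X ?G ** gram Y Z - gram X Y ** gram ?G Z"
    using assms by (simp add: skew_op_def gram_diff_right gram_tmul_right)
  ultimately show ?thesis by simp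
qed

lemma tinner_skew_op_self:
  assumes "Y \<in> tuples V" "X \<in> tuples V"
  shows "tinner X (skew_op V E Y X) = 0"
proof -
  have "tinner (skew_op V E Y X) X = - tinner X (skew_op V E Y X)"
    by (simp add: tinner_def gram_skew_op[OF assms(1,2,2)] trace_def sum_negf)
  then show ?thesis by (simp add: T.ip_commute[of X])
qed

text \<open>\<open>inv_into\<close> yields a solution only for points in the range. By skewness the
  inner product of X with X + s A X is that of X with itself, so the operator is injective, and in
  finite dimension it is onto.\<close>

lemma half_step_solution:
  assumes "Y \<in> tuples V" "U \<in> tuples V"
  shows "inv_into (tuples V) (\<lambda>X. X + s *\<^sub>R skew_op V E Y X) U \<in> tuples V"
    and "inv_into (tuples V) (\<lambda>X. X + s *\<^sub>R skew_op V E Y X) U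
      + s *\<^sub>R skew_op V E Y (inv_into (tuples V) (\<lambda>X. X + s *\<^sub>R skew_op V E Y X) U) = U"
proof -
  let ?T = "\<lambda>X. X + s *\<^sub>R skew_op V E Y X"
  have "?T ` tuples V = tuples V"
  proof (rule T.injective_imp_surjective)
    show "X + s *\<^sub>R skew_op V E Y X \<in> tuples V" if "X \<in> tuples V" for X using assms that by simp
    show "X + Z + s *\<^sub>R skew_op V E Y (X + Z) = X + s *\<^sub>R skew_op V E Y X + (Z + s *\<^sub>R skew_op V E Y Z)"
      if "X \<in> tuples V" "Z \<in> tuples V" for X Z
      using assms that by (simp add: skew_op_add scaleR_add_right)
    show "c *\<^sub>R X + s *\<^sub>R skew_op V E Y (c *\<^sub>R X) = c *\<^sub>R (X + s *\<^sub>R skew_op V E Y X)" if "X \<in> tuples V" for c X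
      using assms that by (simp add: skew_op_scaleR scaleR_add_right mult.commute)
    show "X = 0" if X: "X \<in> tuples V" and z: "X + s *\<^sub>R skew_op V E Y X = 0" for X
    proof -
      have "tinner X (X + s *\<^sub>R skew_op V E Y X) = tinner X X"
        using assms X by (simp add: T.ip_simps tinner_skew_op_self)
      then show ?thesis using z X by (simp add: T.ip_eq_0_iff)
    qed
  qed
  then have U: "U \<in> ?T ` tuples V" using assms by simp
  show "inv_into (tuples V) ?T U \<in> tuples V" using inv_into_into[OF U] .
  show "inv_into (tuples V) ?T U + s *\<^sub>R skew_op V E Y (inv_into (tuples V) ?T U) = U"
    using f_inv_into_f[OF U] .
qed

lemma half_step_tuples: "U \<in> tuples V \<Longrightarrow> half_step V E \<tau> U k \<in> tuples V"
  by (induction k) (auto intro: half_step_solution)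

text \<open>The implicit equation is all that is used of a half step from here on; the recursive
  equation is removed from the simp set after it.\<close>

lemma half_step_Suc:
  "U \<in> tuples V \<Longrightarrow> half_step V E \<tau> U (Suc k) + (\<tau>/2) *\<^sub>R skew_op V E (half_step V E \<tau> U k) (half_step V E \<tau> U (Suc k)) = U"
  using half_step_solution(2)[OF half_step_tuples] by simp

declare half_step.simps(2) [simp del]

text \<open>The old point is X + s A X and the new one X - s A X; by skewness the cross terms cancel
  in both Gram matrices. The operator may be frozen at any \<open>Y\<close>, so it does not matter
  how many inner iterations produced it.\<close>

lemma gram_Cayley:
  assumes Y: "Y \<in> tuples V" and X: "X \<in> tuples V" and U: "X + s *\<^sub>R skew_op V E Y X = U"
  shows "gram (2 *\<^sub>R X - U) (2 *\<^sub>R X - U) = gram U U"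
proof -
  let ?A = "skew_op V E Y X"
  have A: "?A \<in> tuples V" "s *\<^sub>R ?A \<in> tuples V" using Y by simp_all
  have "2 *\<^sub>R X - U = X - s *\<^sub>R ?A" using U by (auto simp: scaleR_2)
  then have "gram (2 *\<^sub>R X - U) (2 *\<^sub>R X - U) = gram X X - s *\<^sub>R gram X ?A - (s *\<^sub>R gram ?A X - s *\<^sub>R s *\<^sub>R gram ?A ?A)"
    using X A by (simp add: gram_diff_left gram_diff_right gram_scaleR_left gram_scaleR_right scaleR_diff_right)
  moreover have "gram U U = gram X X + s *\<^sub>R gram X ?A + (s *\<^sub>R gram ?A X + s *\<^sub>R s *\<^sub>R gram ?A ?A)"
    using X A by (simp add: U[symmetric] gram_add_left gram_add_right gram_scaleR_left gram_scaleR_right scaleR_add_right)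
  ultimately show ?thesis by (simp add: gram_skew_op[OF Y X X])
qed

lemma tnorm_skew_op_le:
  assumes "Y \<in> tuples V" "X \<in> tuples V"
  shows "tnorm (skew_op V E Y X) \<le> 2 * (real CARD('n))\<^sup>2 * tnorm (grad V E Y) * tnorm Y * tnorm X"
proof -
  have "tnorm (skew_op V E Y X) \<le> tnorm (tmul (grad V E Y) (gram Y X)) + tnorm (tmul Y (gram (grad V E Y) X))"
    unfolding skew_op_def using assms by (intro T.nrm_triangle_diff) auto
  also have "\<dots> \<le> (real CARD('n))\<^sup>2 * tnorm (grad V E Y) * tnorm Y * tnorm X + (real CARD('n))\<^sup>2 * tnorm Y * tnorm (grad V E Y) * tnorm X"
    using assms by (intro add_mono tnorm_tmul_gram_le) auto
  finally show ?thesis by (simp add: mult_ac)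
qed

end

text \<open>Estimates around one representative \<open>W\<close> of the orbit. On the ball,
  \<open>R\<close> bounds the norm of a point and \<open>K'\<close> that of its gradient, and
  \<open>C\<close> is a Lipschitz constant of the skew operator on tuples of norm at most
  \<open>R\<close>. The constants are parameters, so that one choice can serve all
  representatives.\<close>

locale descent_ball = energy_space V E for V and E :: "('n::finite) tuple \<Rightarrow> real" +
  fixes W :: "'n tuple" and \<delta> L K R K' C :: real
  assumes W: "W \<in> tuples V" and gram_W: "gram W W = mat 1"
    and \<delta>: "\<delta> > 0" and L: "L \<ge> 0" and lipschitz: "lipschitz_grad V E L (tball V W \<delta>)"
    and K: "tnorm (grad V E W) \<le> K"
    and R_def: "R = sqrt (real CARD('n)) + \<delta>"
    and K'_def: "K' = K + L * \<delta>"
    and C_def: "C = 2 * (real CARD('n))\<^sup>2 * R * (L * R + K')"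
begin

lemma R_pos: "R > 0"
  using \<delta> by (simp add: R_def add_nonneg_pos)

lemma K'_nonneg: "K' \<ge> 0"
  using order_trans[OF T.nrm_ge_0[OF grad_tuples[OF W]] K] L \<delta> by (simp add: K'_def)

lemma C_nonneg: "C \<ge> 0"
  using R_pos K'_nonneg L by (simp add: C_def)

lemma tball_bounds:
  assumes "Y \<in> tball V W \<delta>"
  shows "Y \<in> tuples V" "tnorm Y \<le> R" "tnorm (grad V E Y) \<le> K'"
proof -
  show Y: "Y \<in> tuples V" using assms by (simp add: tball_def)
  have d: "tnorm (Y - W) \<le> \<delta>" using assms Y W by (simp add: tball_def T.nrm_minus_commute)
  have "tnorm W = sqrt (real CARD('n))"
    by (simp add: tnorm_def tinner_def gram_W trace_I)
  then show "tnorm Y \<le> R"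
    using T.nrm_triangle[of W "Y - W"] Y W d by (simp add: R_def)
  have "W \<in> tball V W \<delta>" using W \<delta> by (simp add: tball_def)
  then have "tnorm (grad V E Y - grad V E W) \<le> L * tnorm (Y - W)"
    using lipschitz assms unfolding lipschitz_grad_def by blast
  also have "\<dots> \<le> L * \<delta>" using d L by (rule mult_left_mono)
  finally show "tnorm (grad V E Y) \<le> K'"
    using T.nrm_triangle[of "grad V E W" "grad V E Y - grad V E W"] Y W K by (simp add: K'_def)
qed

lemma tnorm_skew_op_le_C:
  assumes "Y \<in> tball V W \<delta>" "X \<in> tuples V"
  shows "tnorm (skew_op V E Y X) \<le> C * tnorm X"
proof -
  note b = tball_bounds[OF assms(1)]
  have "tnorm (skew_op V E Y X) \<le> 2 * (real CARD('n))\<^sup>2 * tnorm (grad V E Y) * tnorm Y * tnorm X"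
    using b assms by (intro tnorm_skew_op_le)
  also have "\<dots> \<le> 2 * (real CARD('n))\<^sup>2 * K' * R * tnorm X"
    using b assms K'_nonneg R_pos by (intro mult_right_mono mult_mono mult_nonneg_nonneg) auto
  also have "2 * (real CARD('n))\<^sup>2 * K' * R \<le> C"
  proof -
    have "0 \<le> (real CARD('n))\<^sup>2 * R * (L * R)" using L R_pos by simp
    then show ?thesis by (simp add: C_def algebra_simps)
  qed
  finally show ?thesis using assms by (simp add: mult_right_mono)
qed

text \<open>The operator is a difference of two expressions, each bilinear in the point and its
  gradient. Changing one factor at a time gives four terms, two with the constant L R^2 and two with
  K' R; their sum is the definition of \<open>C\<close>.\<close>

lemma skew_op_Lipschitz:
  assumes Y: "Y \<in> tball V W \<delta>" and Z: "Z \<in> tball V W \<delta>" and U: "U \<in> tuples V" "tnorm U \<le> R"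
  shows "tnorm (skew_op V E Y U - skew_op V E Z U) \<le> C * tnorm (Y - Z)"
proof -
  let ?c = "(real CARD('n))\<^sup>2" and ?GY = "grad V E Y" and ?GZ = "grad V E Z" and ?d = "tnorm (Y - Z)"
  note y = tball_bounds[OF Y] and z = tball_bounds[OF Z]
  have lip: "tnorm (?GY - ?GZ) \<le> L * ?d" using lipschitz Y Z unfolding lipschitz_grad_def by blast
  have d0: "?d \<ge> 0" using y z by simp
  have bound: "tnorm (tmul A (gram B U)) \<le> ?c * a * b * R"
    if "A \<in> tuples V" "B \<in> tuples V" "tnorm A \<le> a" "tnorm B \<le> b" for A B a b
  proof -
    have "tnorm (tmul A (gram B U)) \<le> ?c * tnorm A * tnorm B * tnorm U"
      using that U by (intro tnorm_tmul_gram_le)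
    also have "\<dots> \<le> ?c * a * b * R"
      using that U order_trans[OF T.nrm_ge_0[OF that(1)] that(3)] order_trans[OF T.nrm_ge_0[OF that(2)] that(4)]
      by (intro mult_mono mult_nonneg_nonneg) auto
    finally show ?thesis .
  qed
  have "skew_op V E Y U - skew_op V E Z U = (tmul (?GY - ?GZ) (gram Y U) + tmul ?GZ (gram (Y - Z) U))
     - (tmul (Y - Z) (gram ?GY U) + tmul Z (gram (?GY - ?GZ) U))"
    using y z U by (simp add: skew_op_def gram_diff_left tmul_diff_left tmul_diff_right)
  also have "tnorm \<dots> \<le> (tnorm (tmul (?GY - ?GZ) (gram Y U)) + tnorm (tmul ?GZ (gram (Y - Z) U)))
     + (tnorm (tmul (Y - Z) (gram ?GY U)) + tnorm (tmul Z (gram (?GY - ?GZ) U)))"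
    using y z U by (intro order_trans[OF T.nrm_triangle_diff] add_mono T.nrm_triangle) auto
  also have "\<dots> \<le> (?c * (L * ?d) * R * R + ?c * K' * ?d * R) + (?c * ?d * K' * R + ?c * R * (L * ?d) * R)"
    using y z lip by (intro add_mono bound) auto
  also have "\<dots> = C * ?d" by (simp add: C_def algebra_simps)
  finally show ?thesis .
qed

text \<open>Argument and base point are changed one after the other. The estimate compares the
  direction of an actual step with the one at the old point, and with X = Y it is the Lipschitz
  bound of \<open>grad_G\<close>. \<open>X\<close> need not lie in the ball, as required for the
  implicit half step.\<close>

lemma skew_op_diff_bound:
  assumes Y: "Y \<in> tball V W \<delta>" and U: "U \<in> tball V W \<delta>" and X: "X \<in> tuples V"
  shows "tnorm (skew_op V E Y X - skew_op V E U U) \<le> C * (tnorm (X - U) + tnorm (Y - U))"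
proof -
  note y = tball_bounds[OF Y] and u = tball_bounds[OF U]
  have "skew_op V E Y X - skew_op V E U U = skew_op V E Y (X - U) + (skew_op V E Y U - skew_op V E U U)"
    using y u X by (simp add: skew_op_diff)
  also have "tnorm \<dots> \<le> tnorm (skew_op V E Y (X - U)) + tnorm (skew_op V E Y U - skew_op V E U U)"
    using y u X by (intro T.nrm_triangle) auto
  also have "\<dots> \<le> C * tnorm (X - U) + C * tnorm (Y - U)"
    using y u X by (intro add_mono tnorm_skew_op_le_C skew_op_Lipschitz Y U) auto
  finally show ?thesis by (simp add: algebra_simps)
qed

lemma grad_G_Lipschitz:
  assumes "Y \<in> tball V W \<delta>" "U \<in> tball V W \<delta>"
  shows "tnorm (grad_G V E Y - grad_G V E U) \<le> 2 * C * tnorm (Y - U)"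
  using skew_op_diff_bound[OF assms tball_bounds(1)[OF assms(1)]] by (simp add: grad_G_def)

lemma grad_G_le: "U \<in> tball V W \<delta> \<Longrightarrow> tnorm (grad_G V E U) \<le> C * R"
  using tnorm_skew_op_le_C[of U U] tball_bounds[of U] mult_left_mono[OF _ C_nonneg, of "tnorm U" R]
  unfolding grad_G_def by fastforce

text \<open>The displacement is of order \<tau>D with D = |||grad_G E(U)|||, so every deviation from
  the linear decrease is of order \<tau>^2 D^2. The first condition on \<tau> controls the implicit
  half steps, the second keeps all points in the ball because D is at most C R, and the third leaves
  half of the gain.\<close>

lemma one_step:
  assumes U: "U \<in> tuples V" "gram U U = mat 1" "tnorm (U - W) \<le> \<delta> / 2"
    and \<tau>: "\<tau> > 0" "\<tau> * C \<le> 1 / 2" "\<tau> * (C * R) \<le> \<delta> / 4" "\<tau> * (3 * C + 4 * L) \<le> 1 / 2"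
    and p: "p \<ge> 1"
  defines "U' \<equiv> 2 *\<^sub>R half_step V E \<tau> U p - U"
  shows "U' \<in> tuples V" "gram U' U' = mat 1" "tnorm (U' - U) \<le> 2 * \<tau> * tnorm (grad_G V E U)"
    "E U' \<le> E U - \<tau> / 2 * (tnorm (grad_G V E U))\<^sup>2"
proof -
  let ?D = "tnorm (grad_G V E U)"
  let ?h = "half_step V E \<tau> U"
  have GU: "grad_G V E U \<in> tuples V" using U by (simp add: grad_G_def)
  have D0: "?D \<ge> 0" using GU by simp
  have Ub: "U \<in> tball V W \<delta>" using U W \<delta> by (simp add: tball_def T.nrm_minus_commute)
  have \<tau>D: "\<tau> * ?D \<le> \<delta> / 4"
    using mult_left_mono[OF grad_G_le[OF Ub], of \<tau>] \<tau>(1,3) by linarith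
  \<comment> \<open>Covers the half steps, at distance \<tau>D from U, and the new iterate, at
    distance 2\<tau>D: as \<tau>D \<le> \<delta>/4 and U is within \<delta>/2 of W, both stay in the
    ball.\<close>
  have near: "Y \<in> tball V W \<delta>" if "Y \<in> tuples V" "tnorm (Y - U) \<le> 2 * (\<tau> * ?D)" for Y
  proof -
    have "tnorm (W - Y) = tnorm (Y - W)" using W that by (simp add: T.nrm_minus_commute)
    also have "\<dots> \<le> tnorm (Y - U) + tnorm (U - W)" using W U that by (intro T.nrm_triangle3)
    also have "\<dots> \<le> \<delta>" using that U \<tau>D by linarith
    finally show ?thesis using that by (simp add: tball_def)
  qed
  have hV: "?h k \<in> tuples V" for k using U(1) by (rule half_step_tuples)
  have h_diff: "?h (Suc k) - U = - ((\<tau> / 2) *\<^sub>R skew_op V E (?h k) (?h (Suc k)))" for k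
    using half_step_Suc[OF U(1), of \<tau> k] by (metis add_diff_cancel_left' minus_diff_eq)
  \<comment> \<open>The bound reproduces itself: with r the distance of the next half step, the
    estimate is r \<le> r/4 + 3\<tau>D/4, hence r \<le> \<tau>D. It does not deteriorate with k,
    which gives uniformity in the number of inner iterations.\<close>
  have h_bound: "tnorm (?h k - U) \<le> \<tau> * ?D" for k
  proof (induction k)
    case 0
    then show ?case using D0 \<tau> by simp
  next
    case (Suc k)
    let ?r = "tnorm (?h (Suc k) - U)"
    let ?A = "skew_op V E (?h k) (?h (Suc k))"
    have "0 \<le> \<tau> * ?D" using \<tau> D0 by simp
    then have Yb: "?h k \<in> tball V W \<delta>" using hV Suc by (intro near) auto
    have "tnorm ?A \<le> tnorm (?A - skew_op V E U U) + tnorm (skew_op V E U U)"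
      using T.nrm_triangle[of "?A - skew_op V E U U" "skew_op V E U U"] hV U by simp
    also have "\<dots> \<le> C * (?r + tnorm (?h k - U)) + ?D"
      using skew_op_diff_bound[OF Yb Ub hV[of "Suc k"]] by (simp add: grad_G_def)
    also have "\<dots> \<le> C * (?r + \<tau> * ?D) + ?D"
      using Suc C_nonneg by (simp add: mult_left_mono)
    finally have A: "tnorm ?A \<le> C * (?r + \<tau> * ?D) + ?D" .
    have "?r = \<tau> / 2 * tnorm ?A"
      unfolding h_diff using hV \<tau> by (simp add: T.nrm_minus T.nrm_scaleR)
    also have "\<dots> \<le> \<tau> / 2 * (C * (?r + \<tau> * ?D) + ?D)" using A \<tau> by (intro mult_left_mono) auto
    also have "\<dots> = (\<tau> * C) * ((?r + \<tau> * ?D) / 2) + \<tau> * ?D / 2" by (simp add: algebra_simps)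
    also have "\<dots> \<le> (1 / 2) * ((?r + \<tau> * ?D) / 2) + \<tau> * ?D / 2"
      using \<tau> D0 hV U by (intro add_right_mono mult_right_mono) auto
    finally show ?case by (simp add: field_simps)
  qed
  obtain q where q: "p = Suc q" using p by (cases p) auto
  define Y where "Y = ?h q"
  define X where "X = ?h p"
  let ?A = "skew_op V E Y X"
  have Y: "Y \<in> tuples V" and X: "X \<in> tuples V" using hV by (auto simp: Y_def X_def)
  have X_eq: "X + (\<tau> / 2) *\<^sub>R ?A = U" using half_step_Suc[OF U(1)] by (simp add: X_def Y_def q)
  have U': "U' = 2 *\<^sub>R X - U" by (simp add: U'_def X_def)
  show U'V: "U' \<in> tuples V" using U X by (simp add: U')
  show gU': "gram U' U' = mat 1" unfolding U' using gram_Cayley[OF Y X X_eq] U by simp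
  define H where "H = U' - U"
  have H: "H \<in> tuples V" using U U'V by (simp add: H_def)
  have H2: "H = 2 *\<^sub>R (X - U)" by (simp add: H_def U' scaleR_2 algebra_simps)
  have HA: "H = - (\<tau> *\<^sub>R ?A)" unfolding H2 using h_diff[of q] by (simp add: X_def Y_def q)
  have "tnorm H = 2 * tnorm (X - U)" unfolding H2 using X U by (simp add: T.nrm_scaleR)
  also have "\<dots> \<le> 2 * (\<tau> * ?D)" using h_bound[of p] by (simp add: X_def)
  finally have Hn: "tnorm H \<le> 2 * (\<tau> * ?D)" .
  then show "tnorm (U' - U) \<le> 2 * \<tau> * ?D" by (simp add: H_def)
  have U'b: "U' \<in> tball V W \<delta>" using Hn U'V by (intro near) (auto simp: H_def)
  have "0 \<le> \<tau> * ?D" using \<tau> D0 by simp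
  then have Yb: "Y \<in> tball V W \<delta>" using h_bound[of q] Y by (intro near) (auto simp: Y_def)
  \<comment> \<open>The deviation of the actual direction from the one at U. It is of order \<tau>D,
    one order smaller than D itself.\<close>
  define err where "err = ?A - grad_G V E U"
  have err: "err \<in> tuples V" using GU Y by (simp add: err_def)
  have "tnorm err \<le> C * (tnorm (X - U) + tnorm (Y - U))"
    unfolding err_def grad_G_def by (rule skew_op_diff_bound[OF Yb Ub X])
  also have "\<dots> \<le> C * (\<tau> * ?D + \<tau> * ?D)"
    using h_bound[of p] h_bound[of q] C_nonneg by (intro mult_left_mono add_mono) (auto simp: X_def Y_def)
  finally have errn: "tnorm err \<le> 2 * C * \<tau> * ?D" by simp
  have "tinner (grad_G V E U) H = - \<tau> * (?D\<^sup>2 + tinner (grad_G V E U) err)"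
  proof -
    have "?A = grad_G V E U + err" by (simp add: err_def)
    then show ?thesis unfolding HA using GU err by (simp add: T.ip_simps T.nrm_power2)
  qed
  moreover have "- tinner (grad_G V E U) err \<le> ?D * (2 * C * \<tau> * ?D)"
    using T.Cauchy_Schwarz[OF GU err] mult_left_mono[OF errn D0] by linarith
  from mult_left_mono[OF this, of \<tau>]
  have "- \<tau> * tinner (grad_G V E U) err \<le> \<tau> * (?D * (2 * C * \<tau> * ?D))" using \<tau> by simp
  ultimately have part1: "tinner (grad_G V E U) H \<le> - \<tau> * ?D\<^sup>2 + 2 * C * \<tau>\<^sup>2 * ?D\<^sup>2"
    by (simp add: algebra_simps power2_eq_square)
  define M where "M = gram (grad V E U) U"
  have Gsplit: "grad V E U = grad_G V E U + tmul U M"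
    using U by (simp add: grad_G_def skew_op_def M_def)
  have Msym: "M $ i $ j = M $ j $ i" for i j
    unfolding M_def by (rule gram_grad_symmetric[OF U(1)])
  \<comment> \<open>Both U and U + H are orthonormal, so the symmetric part of the Gram matrix of U
    and H is minus half the Gram matrix of H. The symmetric matrix \<open>M\<close> sees this part
    alone.\<close>
  have cancel: "gram U H $ j $ i + gram U H $ i $ j = - gram H H $ j $ i" for i j
  proof -
    have "gram U' U' = gram U U + gram U H + (gram H U + gram H H)"
    proof -
      have "U' = U + H" by (simp add: H_def)
      then show ?thesis using U H by (simp only:) (simp add: gram_add_left gram_add_right)
    qed
    then have "gram U H + (gram H U + gram H H) = 0" using gU' U by simp
    then have "gram U H $ j $ i + (gram H U $ j $ i + gram H H $ j $ i) = 0" by (simp add: vec_eq_iff)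
    then show ?thesis by (simp add: gram_nth_commute[of H U])
  qed
  have part2: "tinner (tmul U M) H \<le> C / 4 * (tnorm H)\<^sup>2"
  proof -
    let ?s = "tinner (tmul U M) H"
    have s1: "?s = (\<Sum>i\<in>UNIV. \<Sum>j\<in>UNIV. M $ j $ i * gram U H $ j $ i)"
      using U H by (intro tinner_tmul_left)
    also have "\<dots> = (\<Sum>j\<in>UNIV. \<Sum>i\<in>UNIV. M $ j $ i * gram U H $ j $ i)"
      by (rule sum.swap)
    also have "\<dots> = (\<Sum>i\<in>UNIV. \<Sum>j\<in>UNIV. M $ j $ i * gram U H $ i $ j)"
      by (intro sum.cong refl arg_cong2[where f = "(*)"] Msym)
    \<comment> \<open>Symmetry of \<open>M\<close> allows the sum to be added to its transpose,
      where the first-order terms in H drop out by \<open>cancel\<close>.\<close>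
    finally have "2 * ?s = (\<Sum>i\<in>UNIV. \<Sum>j\<in>UNIV. M $ j $ i * (gram U H $ j $ i + gram U H $ i $ j))"
      using s1 by (simp add: sum.distrib distrib_left)
    also have "\<dots> = - (\<Sum>i\<in>UNIV. \<Sum>j\<in>UNIV. M $ j $ i * gram H H $ j $ i)"
      by (simp add: cancel sum_negf)
    also have "\<dots> \<le> (\<Sum>i\<in>(UNIV::'n set). \<Sum>j\<in>(UNIV::'n set). (K' * R) * (tnorm H)\<^sup>2)"
    proof -
      have "- (M $ j $ i * gram H H $ j $ i) \<le> (K' * R) * (tnorm H)\<^sup>2" for i j
      proof -
        note u = tball_bounds[OF Ub]
        have "\<bar>M $ j $ i\<bar> \<le> tnorm (grad V E U) * tnorm U"
          unfolding M_def using U by (intro abs_gram_nth_le) auto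
        also have "\<dots> \<le> K' * R" using u K'_nonneg by (intro mult_mono) auto
        finally have "\<bar>M $ j $ i * gram H H $ j $ i\<bar> \<le> (K' * R) * (tnorm H * tnorm H)"
          unfolding abs_mult using H K'_nonneg R_pos by (intro mult_mono abs_gram_nth_le) auto
        then show ?thesis by (simp add: power2_eq_square)
      qed
      then show ?thesis unfolding sum_negf[symmetric] by (intro sum_mono)
    qed
    also have "\<dots> = ((real CARD('n))\<^sup>2 * K' * R) * (tnorm H)\<^sup>2" by (simp add: power2_eq_square)
    also have "\<dots> \<le> (C / 2) * (tnorm H)\<^sup>2"
    proof (rule mult_right_mono)
      have "0 \<le> (real CARD('n))\<^sup>2 * R * (L * R)" using L R_pos by simp
      then show "(real CARD('n))\<^sup>2 * K' * R \<le> C / 2" by (simp add: C_def algebra_simps)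
    qed simp
    finally show ?thesis by simp
  qed
  have "(tnorm H)\<^sup>2 \<le> (2 * (\<tau> * ?D))\<^sup>2" using Hn H by (intro power_mono) auto
  then have Hsq: "(tnorm H)\<^sup>2 \<le> 4 * \<tau>\<^sup>2 * ?D\<^sup>2" by (simp add: power_mult_distrib)
  have "E U' - E U \<le> tinner (grad V E U) H + L * (tnorm H)\<^sup>2"
    unfolding H_def by (rule quadratic_upper_bound[OF Ub U'b W lipschitz L])
  also have "tinner (grad V E U) H = tinner (grad_G V E U) H + tinner (tmul U M) H"
    by (subst Gsplit) (use GU U H in \<open>simp add: T.ip_simps\<close>)
  also have "\<dots> + L * (tnorm H)\<^sup>2 \<le> (- \<tau> * ?D\<^sup>2 + 2 * C * \<tau>\<^sup>2 * ?D\<^sup>2) + (C / 4 + L) * (tnorm H)\<^sup>2"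
    using part1 part2 by (simp add: algebra_simps)
  also have "\<dots> \<le> (- \<tau> * ?D\<^sup>2 + 2 * C * \<tau>\<^sup>2 * ?D\<^sup>2) + (C / 4 + L) * (4 * \<tau>\<^sup>2 * ?D\<^sup>2)"
    using Hsq C_nonneg L by (intro add_left_mono mult_left_mono) auto
  \<comment> \<open>Of the coefficient, 2C comes from the direction error, C from the normal part of
    the gradient and 4L from the remainder of the energy; the last two include the factor 4 in
    \<open>Hsq\<close>.\<close>
  also have "\<dots> = - \<tau> * ?D\<^sup>2 + (\<tau> * (3 * C + 4 * L)) * (\<tau> * ?D\<^sup>2)"
    by (simp add: algebra_simps power2_eq_square)
  also have "\<dots> \<le> - \<tau> * ?D\<^sup>2 + (1 / 2) * (\<tau> * ?D\<^sup>2)"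
    using \<tau> by (intro add_left_mono mult_right_mono) auto
  finally show "E U' \<le> E U - \<tau> / 2 * ?D\<^sup>2" by simp
qed

end

subsection \<open>Isolated minimizers\<close>

context energy_space
begin

lemma tuples_stiefel_iff: "U \<in> tuples V \<inter> stiefel \<longleftrightarrow> U \<in> tuples V \<and> gram U U = mat 1"
proof -
  have "tuples V \<subseteq> tuples H1" using V_H1 unfolding tuples_def by blast
  then show ?thesis unfolding stiefel_def by auto
qed

text \<open>The infimum is used through strict bounds, so that no minimizing rotation has to be
  produced.\<close>

lemma orbit_dist_less_iff:
  fixes U W :: "('k::finite) tuple"
  assumes "U \<in> tuples V" "W \<in> tuples V"
  shows "orbit_dist U W < e \<longleftrightarrow> (\<exists>P. orthogonal_matrix P \<and> tnorm (U - tmul W P) < e)"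
proof -
  have b: "bdd_below ((\<lambda>P. tnorm (U - tmul W P)) ` {P. orthogonal_matrix P})"
    using assms by (intro bdd_belowI[of _ 0]) auto
  have ne: "{P :: real^'k^'k. orthogonal_matrix P} \<noteq> {}" using orthogonal_matrix_id by auto
  show ?thesis unfolding orbit_dist_def by (subst cINF_less_iff[OF ne b]) auto
qed

lemma orbit_dist_le:
  assumes "U \<in> tuples V" "W \<in> tuples V" "orthogonal_matrix P"
  shows "orbit_dist U W \<le> tnorm (U - tmul W P)"
  using orbit_dist_less_iff[OF assms(1,2), of "tnorm (U - tmul W P)"] orbit_dist_less_iff[OF assms(1,2), of "orbit_dist U W"] assms(3)
  by (metis less_irrefl not_less)

lemma orbit_dist_nonneg:
  assumes "U \<in> tuples V" "W \<in> tuples V"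
  shows "orbit_dist U W \<ge> 0"
proof (rule ccontr)
  assume "\<not> orbit_dist U W \<ge> 0"
  then obtain P where "tnorm (U - tmul W P) < 0" using orbit_dist_less_iff[OF assms, of 0] by auto
  moreover have "U - tmul W P \<in> tuples V" using assms by simp
  ultimately show False using T.nrm_ge_0 by fastforce
qed

lemma orbit_dist_triangle:
  assumes "U \<in> tuples V" "X \<in> tuples V" "W \<in> tuples V"
  shows "orbit_dist U W \<le> orbit_dist X W + tnorm (U - X)"
proof (rule field_le_epsilon)
  fix e :: real assume "e > 0"
  then obtain P where P: "orthogonal_matrix P" "tnorm (X - tmul W P) < orbit_dist X W + e"
    using orbit_dist_less_iff[OF assms(2,3), of "orbit_dist X W + e"] by auto
  have "orbit_dist U W \<le> tnorm (U - tmul W P)" using assms P by (intro orbit_dist_le)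
  also have "\<dots> \<le> tnorm (U - X) + tnorm (X - tmul W P)" using assms by (intro T.nrm_triangle3) auto
  finally show "orbit_dist U W \<le> orbit_dist X W + tnorm (U - X) + e" using P(2) by simp
qed

lemma orbit_dist_tmul_left:
  assumes "U \<in> tuples V" "W \<in> tuples V" "orthogonal_matrix Q"
  shows "orbit_dist (tmul U Q) W = orbit_dist U W"
proof -
  have le: "orbit_dist (tmul X S) W \<le> orbit_dist X W" if X: "X \<in> tuples V" and S: "orthogonal_matrix S" for X S
  proof (rule field_le_epsilon)
    fix e :: real assume "e > 0"
    then obtain P where P: "orthogonal_matrix P" "tnorm (X - tmul W P) < orbit_dist X W + e"
      using orbit_dist_less_iff[OF X assms(2), of "orbit_dist X W + e"] by auto
    have "orbit_dist (tmul X S) W \<le> tnorm (tmul X S - tmul W (P ** S))"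
      using X S assms P by (intro orbit_dist_le orthogonal_matrix_mul) auto
    also have "tmul X S - tmul W (P ** S) = tmul (X - tmul W P) S"
      by (simp add: tmul_diff_left tmul_assoc)
    also have "tnorm \<dots> = tnorm (X - tmul W P)"
      using X S assms by (intro tnorm_tmul_orthogonal) auto
    finally show "orbit_dist (tmul X S) W \<le> orbit_dist X W + e" using P(2) by simp
  qed
  have "orbit_dist U W = orbit_dist (tmul (tmul U Q) (transpose Q)) W"
    using assms by (simp add: tmul_transpose_cancel)
  also have "\<dots> \<le> orbit_dist (tmul U Q) W"
    using assms by (intro le orthogonal_transpose) auto
  finally show ?thesis using le[OF assms(1,3)] by simp
qed

lemma orbit_dist_commute:
  assumes "U \<in> tuples V" "W \<in> tuples V"
  shows "orbit_dist U W = orbit_dist W U"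
proof -
  have le: "orbit_dist X Z \<le> orbit_dist Z X" if X: "X \<in> tuples V" and Z: "Z \<in> tuples V" for X Z
  proof (rule field_le_epsilon)
    fix e :: real assume "e > 0"
    then obtain P where P: "orthogonal_matrix P" "tnorm (Z - tmul X P) < orbit_dist Z X + e"
      using orbit_dist_less_iff[OF Z X, of "orbit_dist Z X + e"] by auto
    have "orbit_dist X Z \<le> tnorm (X - tmul Z (transpose P))"
      using X Z P by (intro orbit_dist_le orthogonal_transpose) auto
    also have "X - tmul Z (transpose P) = tmul (tmul X P - Z) (transpose P)"
      using P by (simp add: tmul_diff_left tmul_transpose_cancel)
    also have "tnorm \<dots> = tnorm (tmul X P - Z)"
      using X Z P by (intro tnorm_tmul_orthogonal orthogonal_transpose) auto
    also have "\<dots> = tnorm (Z - tmul X P)" using X Z by (intro T.nrm_minus_commute) auto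
    finally show "orbit_dist X Z \<le> orbit_dist Z X + e" using P(2) by simp
  qed
  show ?thesis using le[OF assms] le[OF assms(2,1)] by simp
qed

lemma mem_orbit: "U \<in> orbit U"
  unfolding orbit_def by (auto intro!: exI[of _ "mat 1"] simp: orthogonal_matrix_id)

lemma orbit_ballI:
  assumes "U \<in> tuples V" "gram U U = mat 1" "W \<in> tuples V" "orbit_dist U W \<le> r"
  shows "orbit U \<in> orbit_ball V W r"
  using assms tuples_stiefel_iff[of U] orbit_dist_commute[OF assms(1,3)] unfolding orbit_ball_def by auto

end

locale isolated_minimizer = energy_space V E for V and E :: "('n::finite) tuple \<Rightarrow> real" +
  fixes Ustar :: "'n tuple" and \<delta> \<delta>\<^sub>c L :: real
  assumes Ustar: "Ustar \<in> tuples V" and gram_Ustar: "gram Ustar Ustar = mat 1"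
    and \<delta>: "\<delta> > 0" and L: "L \<ge> 0" and lipschitz: "lipschitz_grad V E L (tball V Ustar \<delta>)"
    and minimizer: "local_minimizer V E Ustar"
    and \<delta>\<^sub>c: "\<delta>\<^sub>c > 0" and critical: "unique_critical_in_ball V E Ustar \<delta>\<^sub>c"
begin

abbreviation d where "d U \<equiv> orbit_dist U Ustar"
abbreviation D where "D U \<equiv> tnorm (grad_G V E U)"

lemma gram_tmul_orthogonal:
  assumes "U \<in> tuples V" "gram U U = mat 1" "orthogonal_matrix P"
  shows "gram (tmul U P) (tmul U P) = mat 1"
  using assms by (simp add: gram_tmul_left gram_tmul_right orthogonal_matrix_def)

text \<open>Multiplication by P^T maps the ball around Ustar P isometrically onto that around Ustar
  and commutes with the gradient, so radius and constant carry over.\<close>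

lemma lipschitz_tmul:
  assumes P: "orthogonal_matrix P"
  shows "lipschitz_grad V E L (tball V (tmul Ustar P) \<delta>)"
  unfolding lipschitz_grad_def
proof (intro ballI)
  fix X Y assume X: "X \<in> tball V (tmul Ustar P) \<delta>" and Y: "Y \<in> tball V (tmul Ustar P) \<delta>"
  let ?T = "\<lambda>Z. tmul Z (transpose P)"
  have Tb: "?T Z \<in> tball V Ustar \<delta>" if "Z \<in> tball V (tmul Ustar P) \<delta>" for Z
  proof -
    have Z: "Z \<in> tuples V" using that by (simp add: tball_def)
    have "Ustar - ?T Z = ?T (tmul Ustar P - Z)" using P by (simp add: tmul_diff_left tmul_transpose_cancel)
    then have "tnorm (Ustar - ?T Z) = tnorm (tmul Ustar P - Z)"
      using tnorm_tmul_orthogonal[OF _ orthogonal_transpose[OF P], of "tmul Ustar P - Z"] Z Ustar by simp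
    then show ?thesis using that Z by (simp add: tball_def)
  qed
  have XV: "X \<in> tuples V" and YV: "Y \<in> tuples V" using X Y by (auto simp: tball_def)
  have "tnorm (grad V E X - grad V E Y) = tnorm (?T (grad V E X - grad V E Y))"
    using XV YV P by (intro tnorm_tmul_orthogonal[symmetric] orthogonal_transpose) auto
  also have "?T (grad V E X - grad V E Y) = grad V E (?T X) - grad V E (?T Y)"
    using XV YV P by (simp add: tmul_diff_left grad_tmul orthogonal_transpose)
  also have "tnorm \<dots> \<le> L * tnorm (?T X - ?T Y)"
    using lipschitz Tb[OF X] Tb[OF Y] unfolding lipschitz_grad_def by blast
  also have "?T X - ?T Y = ?T (X - Y)" by (simp add: tmul_diff_left)
  also have "tnorm \<dots> = tnorm (X - Y)"
    using XV YV P by (intro tnorm_tmul_orthogonal orthogonal_transpose) auto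
  finally show "tnorm (grad V E X - grad V E Y) \<le> L * tnorm (X - Y)" .
qed

definition R where "R = sqrt (real CARD('n)) + \<delta>"
definition K' where "K' = tnorm (grad V E Ustar) + L * \<delta>"
definition C where "C = 2 * (real CARD('n))\<^sup>2 * R * (L * R + K')"

text \<open>\<open>R\<close>, \<open>K'\<close> and \<open>C\<close> are computed at
  \<open>Ustar\<close> and are valid at every representative. Estimates on balls thereby become
  estimates in terms of the orbit distance.\<close>

lemma ball:
  assumes P: "orthogonal_matrix P"
  shows "descent_ball V E (tmul Ustar P) \<delta> L (tnorm (grad V E Ustar)) R K' C"
proof unfold_locales
  show "tmul Ustar P \<in> tuples V" using Ustar by simp
  show "gram (tmul Ustar P) (tmul Ustar P) = mat 1" using Ustar gram_Ustar P by (rule gram_tmul_orthogonal)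
  show "\<delta> > 0" "L \<ge> 0" by (rule \<delta> L)+
  show "lipschitz_grad V E L (tball V (tmul Ustar P) \<delta>)" using P by (rule lipschitz_tmul)
  show "tnorm (grad V E (tmul Ustar P)) \<le> tnorm (grad V E Ustar)"
    using Ustar P by (simp add: grad_tmul tnorm_tmul_orthogonal)
qed (rule R_def K'_def C_def)+

lemma C_nonneg: "C \<ge> 0" and R_pos: "R > 0"
  using descent_ball.C_nonneg[OF ball] descent_ball.R_pos[OF ball] orthogonal_matrix_id by blast+

lemma minimal: "\<exists>r>0. \<forall>W. W \<in> tuples V \<and> gram W W = mat 1 \<and> d W \<le> r \<longrightarrow> E Ustar \<le> E W"
  using minimizer unfolding local_minimizer_def by (meson Ustar orbit_ballI)

lemma critical_imp_orbit:
  assumes "W \<in> tuples V" "gram W W = mat 1" "d W \<le> \<delta>\<^sub>c" "grad_G V E W = 0"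
  shows "W \<in> orbit Ustar"
proof -
  have "orbit W = orbit Ustar"
    using critical orbit_ballI[OF assms(1,2) Ustar assms(3)] assms(4) unfolding unique_critical_in_ball_def by blast
  then show ?thesis using mem_orbit by blast
qed

lemma orbit_Ustar:
  assumes "W \<in> orbit Ustar" shows "d W = 0" "E W = E Ustar"
proof -
  obtain P where P: "orthogonal_matrix P" "W = tmul Ustar P" using assms by (auto simp: orbit_def)
  then show "E W = E Ustar" using invariant Ustar by simp
  have "W \<in> tuples V" using P Ustar by simp
  then have "d W \<le> 0" using orbit_dist_le[of W Ustar P] P Ustar by simp
  then show "d W = 0" using orbit_dist_nonneg[OF \<open>W \<in> tuples V\<close> Ustar] by simp
qed

text \<open>A representative within \<delta>/2 of U exists by the strict bound on
  \<open>d U\<close>. The step length is stated with \<open>C * R\<close> in place of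
  \<open>D U\<close>, so that it is small uniformly in U.\<close>

lemma step:
  assumes U: "U \<in> tuples V" "gram U U = mat 1" "d U < \<delta> / 2"
    and \<tau>: "\<tau> > 0" "\<tau> * C \<le> 1 / 2" "\<tau> * (C * R) \<le> \<delta> / 4" "\<tau> * (3 * C + 4 * L) \<le> 1 / 2"
    and p: "p \<ge> 1"
  shows "2 *\<^sub>R half_step V E \<tau> U p - U \<in> tuples V"
    "gram (2 *\<^sub>R half_step V E \<tau> U p - U) (2 *\<^sub>R half_step V E \<tau> U p - U) = mat 1"
    "tnorm (2 *\<^sub>R half_step V E \<tau> U p - U - U) \<le> 2 * \<tau> * (C * R)"
    "E (2 *\<^sub>R half_step V E \<tau> U p - U) \<le> E U - \<tau> / 2 * (D U)\<^sup>2"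
proof -
  obtain P where P: "orthogonal_matrix P" "tnorm (U - tmul Ustar P) < \<delta> / 2"
    using U orbit_dist_less_iff[OF U(1) Ustar] by blast
  interpret B: descent_ball V E "tmul Ustar P" \<delta> L "tnorm (grad V E Ustar)" R K' C
    using P by (intro ball)
  note s = B.one_step[OF U(1,2) less_imp_le[OF P(2)] \<tau> p]
  show "2 *\<^sub>R half_step V E \<tau> U p - U \<in> tuples V"
    "gram (2 *\<^sub>R half_step V E \<tau> U p - U) (2 *\<^sub>R half_step V E \<tau> U p - U) = mat 1"
    "E (2 *\<^sub>R half_step V E \<tau> U p - U) \<le> E U - \<tau> / 2 * (D U)\<^sup>2"
    by (rule s)+
  have "U \<in> tball V (tmul Ustar P) \<delta>"
    using U P \<delta> Ustar by (simp add: tball_def T.nrm_minus_commute)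
  then have "D U \<le> C * R" by (rule B.grad_G_le)
  then have "2 * \<tau> * D U \<le> 2 * \<tau> * (C * R)" using \<tau> by (intro mult_left_mono) auto
  with s(3) show "tnorm (2 *\<^sub>R half_step V E \<tau> U p - U - U) \<le> 2 * \<tau> * (C * R)" by linarith
qed

text \<open>Orthonormality fixes the norm, so a subsequence converges in finite dimension; the Gram
  matrix, the orbit distance, the energy and the size of \<open>grad_G\<close> pass to the
  limit.\<close>

lemma compactness:
  assumes X: "\<And>n. X n \<in> tuples V" "\<And>n. gram (X n) (X n) = mat 1" "\<And>n. d (X n) \<le> \<rho>" and \<rho>: "\<rho> < \<delta> / 2"
  obtains W r where "strict_mono (r :: nat \<Rightarrow> nat)" "W \<in> tuples V" "gram W W = mat 1" "d W \<le> \<rho>"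
    "(\<lambda>n. d (X (r n))) \<longlonglongrightarrow> d W" "(\<lambda>n. E (X (r n))) \<longlonglongrightarrow> E W" "(\<lambda>n. D (X (r n))) \<longlonglongrightarrow> D W"
proof -
  have nX: "tnorm (X n) = sqrt (real CARD('n))" for n
    by (simp add: tnorm_def tinner_def X trace_I)
  obtain W r where W: "W \<in> tuples V" and r: "strict_mono r" and lim: "(\<lambda>n. tnorm (X (r n) - W)) \<longlonglongrightarrow> 0"
    using T.bounded_imp_convergent_subsequence[of X, OF X(1) eq_refl[OF nX]] by blast
  have gW: "gram W W = mat 1"
  proof -
    have "gram W W $ i $ j = mat 1 $ i $ j" for i j
    proof -
      have "\<bar>(mat 1 - gram W W) $ i $ j\<bar> \<le> (sqrt (real CARD('n)) + tnorm W) * tnorm (X (r n) - W)" for n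
      proof -
        let ?X = "X (r n)"
        have "mat 1 - gram W W = gram (?X - W) ?X + gram W (?X - W)"
          using X W by (simp add: gram_diff_left gram_diff_right)
        then have "\<bar>(mat 1 - gram W W) $ i $ j\<bar> \<le> \<bar>gram (?X - W) ?X $ i $ j\<bar> + \<bar>gram W (?X - W) $ i $ j\<bar>"
          by simp
        also have "\<dots> \<le> tnorm (?X - W) * tnorm ?X + tnorm W * tnorm (?X - W)"
          using X W by (intro add_mono abs_gram_nth_le) auto
        finally show ?thesis by (simp add: nX algebra_simps)
      qed
      moreover have "(\<lambda>n. (sqrt (real CARD('n)) + tnorm W) * tnorm (X (r n) - W)) \<longlonglongrightarrow> 0"
        using tendsto_mult_right_zero[OF lim] .
      ultimately have "\<bar>(mat 1 - gram W W) $ i $ j\<bar> \<le> 0"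
        by (intro LIMSEQ_le_const[of _ 0]) auto
      then show ?thesis by simp
    qed
    then show ?thesis by (simp add: vec_eq_iff)
  qed
  have dlim: "(\<lambda>n. d (X (r n))) \<longlonglongrightarrow> d W"
  proof -
    have "\<bar>d (X (r n)) - d W\<bar> \<le> tnorm (X (r n) - W)" for n
      using orbit_dist_triangle[OF X(1) W Ustar, of "r n"] orbit_dist_triangle[OF W X(1) Ustar, of "r n"] T.nrm_minus_commute[OF W X(1), of "r n"]
      by linarith
    then have "(\<lambda>n. d (X (r n)) - d W) \<longlonglongrightarrow> 0"
      by (intro Lim_null_comparison[OF _ lim]) auto
    then show ?thesis by (simp add: LIM_zero_iff)
  qed
  have dW: "d W \<le> \<rho>" using X(3) by (intro LIMSEQ_le_const2[OF dlim]) auto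
  have Elim: "(\<lambda>n. E (X (r n))) \<longlonglongrightarrow> E W"
    using W X lim by (intro energy_continuous)
  have Dlim: "(\<lambda>n. D (X (r n))) \<longlonglongrightarrow> D W"
  proof -
    \<comment> \<open>Continuity of \<open>D\<close> rests on the Lipschitz bound. The strict
      inequality \<rho> < \<delta>/2 leaves room for the limit and the tail of the sequence in one
      ball around a single representative.\<close>
    obtain P where P: "orthogonal_matrix P" "tnorm (W - tmul Ustar P) < \<delta> / 2"
      using dW \<rho> orbit_dist_less_iff[OF W Ustar, of "\<delta> / 2"] by auto
    interpret B: descent_ball V E "tmul Ustar P" \<delta> L "tnorm (grad V E Ustar)" R K' C
      using P by (intro ball)
    have Wb: "W \<in> tball V (tmul Ustar P) \<delta>"
      using W P \<delta> Ustar by (simp add: tball_def T.nrm_minus_commute)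
    have "\<forall>\<^sub>F n in sequentially. tnorm (X (r n) - W) < \<delta> / 2"
      using lim \<delta> by (intro order_tendstoD) auto
    then have "\<forall>\<^sub>F n in sequentially. norm (D (X (r n)) - D W) \<le> 2 * C * tnorm (X (r n) - W)"
    proof eventually_elim
      case (elim n)
      let ?X = "X (r n)"
      have "tnorm (?X - tmul Ustar P) \<le> tnorm (?X - W) + tnorm (W - tmul Ustar P)"
        using X W Ustar by (intro T.nrm_triangle3) auto
      then have "tnorm (?X - tmul Ustar P) \<le> \<delta>" using elim P(2) by linarith
      then have Xb: "?X \<in> tball V (tmul Ustar P) \<delta>"
        using X Ustar by (simp add: tball_def T.nrm_minus_commute)
      have g: "grad_G V E ?X \<in> tuples V" "grad_G V E W \<in> tuples V" using X W by (simp_all add: grad_G_def)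
      have "\<bar>D ?X - D W\<bar> \<le> tnorm (grad_G V E ?X - grad_G V E W)"
        using T.nrm_triangle[of "grad_G V E ?X - grad_G V E W" "grad_G V E W"]
          T.nrm_triangle[of "grad_G V E W - grad_G V E ?X" "grad_G V E ?X"] T.nrm_minus_commute[OF g] g by simp
      also have "\<dots> \<le> 2 * C * tnorm (?X - W)" by (rule B.grad_G_Lipschitz[OF Xb Wb])
      finally show ?case by simp
    qed
    then have "(\<lambda>n. D (X (r n)) - D W) \<longlonglongrightarrow> 0"
      by (rule Lim_null_comparison) (rule tendsto_mult_right_zero[OF lim])
    then show ?thesis by (simp add: LIM_zero_iff)
  qed
  show ?thesis by (rule that[OF r W gW dW dlim Elim Dlim])
qed

text \<open>A bound uniform along the orbit although the energy is known to be continuous only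
  pointwise: rotating the points back brings them close to \<open>Ustar\<close> itself without
  changing their energy.\<close>

lemma energy_near_orbit:
  assumes "\<gamma> > 0"
  shows "\<exists>\<eta>>0. \<forall>U\<in>tuples V. d U < \<eta> \<longrightarrow> E U < E Ustar + \<gamma>"
proof (rule ccontr)
  assume contra: "\<not> ?thesis"
  have "\<exists>U P. U \<in> tuples V \<and> E U \<ge> E Ustar + \<gamma> \<and> orthogonal_matrix P \<and> tnorm (U - tmul Ustar P) < 1 / real (Suc n)" for n
  proof -
    obtain U where "U \<in> tuples V" "d U < 1 / real (Suc n)" "E U \<ge> E Ustar + \<gamma>"
      using contra by (auto simp: not_less dest: spec[of _ "1 / real (Suc n)"])
    then show ?thesis using orbit_dist_less_iff[of U Ustar] Ustar by blast
  qed
  then obtain U P where UP: "\<And>n. U n \<in> tuples V" "\<And>n. E (U n) \<ge> E Ustar + \<gamma>"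
    "\<And>n. orthogonal_matrix (P n)" "\<And>n. tnorm (U n - tmul Ustar (P n)) < 1 / real (Suc n)" by metis
  define X where "X n = tmul (U n) (transpose (P n))" for n
  have X: "X n \<in> tuples V" for n using UP by (simp add: X_def)
  have EX: "E (X n) = E (U n)" for n using UP by (simp add: X_def invariant orthogonal_transpose)
  have le: "tnorm (X n - Ustar) \<le> 1 / real (Suc n)" for n
  proof -
    have "X n - Ustar = tmul (U n - tmul Ustar (P n)) (transpose (P n))"
      using UP by (simp add: X_def tmul_diff_left tmul_transpose_cancel)
    then show ?thesis using UP(1,3) less_imp_le[OF UP(4)] Ustar by (simp add: tnorm_tmul_orthogonal orthogonal_transpose)
  qed
  have "(\<lambda>n. tnorm (X n - Ustar)) \<longlonglongrightarrow> 0"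
    using le X Ustar by (intro tendsto_sandwich[OF _ _ tendsto_const LIMSEQ_Suc[OF lim_1_over_n]]) auto
  then have "(\<lambda>n. E (X n)) \<longlonglongrightarrow> E Ustar" using Ustar X by (intro energy_continuous)
  then have "E Ustar + \<gamma> \<le> E Ustar" using UP(2) EX by (intro LIMSEQ_le_const) auto
  then show False using assms by simp
qed

end

section \<open>Energy barrier, trapping of the iterates and convergence\<close>

context isolated_minimizer
begin

text \<open>First-order optimality is obtained from the iteration itself: one step with a single
  inner iteration starts at \<open>W\<close>, and \<open>\<eta>\<close> is the room that keeps its
  endpoint in the region of minimality. There the energy cannot drop below that of
  \<open>Ustar\<close>, so the guaranteed decrease is zero.\<close>

lemma critical_points_below:
  assumes small: "\<rho> < \<delta> / 2" "\<rho> \<le> \<delta>\<^sub>c"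
    and minimal: "\<And>W. W \<in> tuples V \<Longrightarrow> gram W W = mat 1 \<Longrightarrow> d W \<le> \<rho> + \<eta> \<Longrightarrow> E Ustar \<le> E W"
    and \<tau>: "\<tau> > 0" "\<tau> * C \<le> 1 / 2" "\<tau> * (C * R) \<le> \<delta> / 4" "\<tau> * (3 * C + 4 * L) \<le> 1 / 2" "2 * \<tau> * (C * R) \<le> \<eta>"
    and W: "W \<in> tuples V" "gram W W = mat 1" "d W \<le> \<rho>" "E W \<le> E Ustar"
  shows "D W = 0" "d W = 0" "E W = E Ustar"
proof -
  let ?W = "2 *\<^sub>R half_step V E \<tau> W 1 - W"
  have dW: "d W < \<delta> / 2" using W small by simp
  note s = step[OF W(1,2) dW \<tau>(1-4) order_refl]
  have "d ?W \<le> d W + tnorm (?W - W)" using s W Ustar by (intro orbit_dist_triangle)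
  also have "\<dots> \<le> \<rho> + \<eta>" using s(3) W(3) \<tau>(5) by linarith
  finally have "E Ustar \<le> E ?W" using s by (intro minimal)
  with s(4) W(4) have "\<tau> / 2 * (D W)\<^sup>2 \<le> 0" by linarith
  then show D0: "D W = 0" using \<tau>(1) by (simp add: mult_le_0_iff)
  have "grad_G V E W = 0" using D0 W by (simp add: T.nrm_eq_0_iff grad_G_def)
  then have "W \<in> orbit Ustar" using W small by (intro critical_imp_orbit) auto
  then show "d W = 0" "E W = E Ustar" by (rule orbit_Ustar)+
qed

theorem convergence:
  "\<exists>\<delta>\<^sub>e>0. \<exists>\<delta>\<^sub>T>0. \<forall>U\<^sub>0 \<in> tuples V \<inter> stiefel. \<forall>\<tau> :: nat \<Rightarrow> real. \<forall>p :: nat \<Rightarrow> nat.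
      orbit U\<^sub>0 \<in> orbit_ball V Ustar \<delta>\<^sub>e \<and>
      (\<forall>n. \<tau> n > 0) \<and>
      filterlim (\<lambda>n. \<Sum>k<n. \<tau> k) at_top sequentially \<and>
      bdd_above (range \<tau>) \<and> (SUP n. \<tau> n) \<le> \<delta>\<^sub>T \<and>
      (\<forall>n. p n \<ge> 1) \<longrightarrow>
      (let U = iterate V E \<tau> p U\<^sub>0 in
        (\<lambda>n. tnorm (grad_G V E (U n))) \<longlonglongrightarrow> 0 \<and>
        (\<lambda>n. E (U n)) \<longlonglongrightarrow> E Ustar \<and>
        (\<lambda>n. orbit_dist (U n) Ustar) \<longlonglongrightarrow> 0)"
proof -
  obtain r where r: "r > 0" "\<And>W. W \<in> tuples V \<Longrightarrow> gram W W = mat 1 \<Longrightarrow> d W \<le> r \<Longrightarrow> E Ustar \<le> E W"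
    using minimal by blast
  \<comment> \<open>Half of \<open>r\<close> leaves room for a further step of length \<rho>/2; the
    other bounds keep points in the Lipschitz region and where the critical orbit is unique.\<close>
  define \<rho> where "\<rho> = min (\<delta> / 4) (min (r / 2) \<delta>\<^sub>c)"
  have \<rho>: "\<rho> > 0" "\<rho> < \<delta> / 2" "\<rho> \<le> \<delta>\<^sub>c" "\<rho> + \<rho> / 2 \<le> r"
    using \<delta> r(1) \<delta>\<^sub>c by (auto simp: \<rho>_def)
  \<comment> \<open>One quotient for each smallness condition; the third limits a step to \<rho>/2,
    the width of the annulus. Adding 1 to the denominators keeps them positive when \<open>C\<close>
    and \<open>L\<close> are zero.\<close>
  define \<delta>\<^sub>T where "\<delta>\<^sub>T = min ((1 / 2) / (C + 1)) (min ((\<delta> / 4) / (C * R + 1)) (min ((\<rho> / 4) / (C * R + 1)) ((1 / 2) / (3 * C + 4 * L + 1))))"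
  have CR: "C * R \<ge> 0" using C_nonneg R_pos by simp
  have \<delta>\<^sub>T: "\<delta>\<^sub>T > 0" using C_nonneg CR L \<delta> \<rho>(1) by (auto simp: \<delta>\<^sub>T_def intro!: divide_pos_pos add_nonneg_pos)
  have bound: "t * b \<le> a" if "0 < t" "t \<le> a / (b + 1)" "b \<ge> 0" for t a b :: real
  proof -
    have "t * b \<le> t * (b + 1)" using that by (intro mult_left_mono) auto
    also have "\<dots> \<le> a" using that by (simp add: pos_le_divide_eq)
    finally show ?thesis .
  qed
  have small: "t * C \<le> 1 / 2" "t * (C * R) \<le> \<delta> / 4" "t * (3 * C + 4 * L) \<le> 1 / 2" "2 * t * (C * R) \<le> \<rho> / 2"
    if t: "0 < t" "t \<le> \<delta>\<^sub>T" for t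
  proof -
    have "t \<le> (1 / 2) / (C + 1)" "t \<le> (\<delta> / 4) / (C * R + 1)" "t \<le> (\<rho> / 4) / (C * R + 1)" "t \<le> (1 / 2) / (3 * C + 4 * L + 1)"
      using t(2) unfolding \<delta>\<^sub>T_def by simp_all
    from bound[OF t(1) this(1)] bound[OF t(1) this(2)] bound[OF t(1) this(3)] bound[OF t(1) this(4)]
    show "t * C \<le> 1 / 2" "t * (C * R) \<le> \<delta> / 4" "t * (3 * C + 4 * L) \<le> 1 / 2" "2 * t * (C * R) \<le> \<rho> / 2"
      using C_nonneg CR L by simp_all
  qed
  have below: "D W = 0" "d W = 0" "E W = E Ustar"
    if "W \<in> tuples V" "gram W W = mat 1" "d W \<le> \<rho>" "E W \<le> E Ustar" for W
    using critical_points_below[where \<rho> = \<rho> and \<eta> = "\<rho> / 2" and \<tau> = \<delta>\<^sub>T and W = W]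
      r(2) \<rho> small[OF \<delta>\<^sub>T order_refl] \<delta>\<^sub>T that by auto
  \<comment> \<open>Without a barrier, points of the annulus with energies at most E(Ustar) + 1/(n +
    1) would have a limit point at distance at least \<rho>/2, whereas \<open>below\<close> puts it
    at distance zero.\<close>
  have "\<exists>\<gamma>>0. \<forall>W. W \<in> tuples V \<longrightarrow> gram W W = mat 1 \<longrightarrow> \<rho> / 2 \<le> d W \<longrightarrow> d W \<le> \<rho> \<longrightarrow> E Ustar + \<gamma> \<le> E W"
  proof (rule ccontr)
    assume contra: "\<not> ?thesis"
    have "\<exists>W. W \<in> tuples V \<and> gram W W = mat 1 \<and> \<rho> / 2 \<le> d W \<and> d W \<le> \<rho> \<and> E W \<le> E Ustar + 1 / real (Suc n)" for n
      using contra by (force simp: not_le dest: spec[of _ "1 / real (Suc n)"])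
    then obtain X where X: "\<And>n. X n \<in> tuples V" "\<And>n. gram (X n) (X n) = mat 1" "\<And>n. \<rho> / 2 \<le> d (X n)"
      "\<And>n. d (X n) \<le> \<rho>" "\<And>n. E (X n) \<le> E Ustar + 1 / real (Suc n)" by metis
    obtain W s where W: "strict_mono (s :: nat \<Rightarrow> nat)" "W \<in> tuples V" "gram W W = mat 1" "d W \<le> \<rho>"
      "(\<lambda>n. d (X (s n))) \<longlonglongrightarrow> d W" "(\<lambda>n. E (X (s n))) \<longlonglongrightarrow> E W" "(\<lambda>n. D (X (s n))) \<longlonglongrightarrow> D W"
      by (rule compactness[OF X(1,2,4) \<rho>(2)])
    have "(\<lambda>n. E Ustar + 1 / real (Suc n)) \<longlonglongrightarrow> E Ustar + 0"
      by (intro tendsto_intros LIMSEQ_Suc[OF lim_1_over_n])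
    then have "(\<lambda>n. E Ustar + 1 / real (Suc (s n))) \<longlonglongrightarrow> E Ustar"
      using LIMSEQ_subseq_LIMSEQ[OF _ W(1)] by (fastforce simp: o_def)
    then have "E W \<le> E Ustar" using X(5) by (intro LIMSEQ_le[OF W(6)]) auto
    then have "d W = 0" using below(2) W by blast
    moreover have "\<rho> / 2 \<le> d W" using X(3) by (intro LIMSEQ_le_const[OF W(5)]) auto
    ultimately show False using \<rho>(1) by simp
  qed
  then obtain \<gamma> where \<gamma>: "\<gamma> > 0"
    "\<And>W. W \<in> tuples V \<Longrightarrow> gram W W = mat 1 \<Longrightarrow> \<rho> / 2 \<le> d W \<Longrightarrow> d W \<le> \<rho> \<Longrightarrow> E Ustar + \<gamma> \<le> E W" by blast
  obtain \<eta> where \<eta>: "\<eta> > 0" "\<And>U. U \<in> tuples V \<Longrightarrow> d U < \<eta> \<Longrightarrow> E U < E Ustar + \<gamma>"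
    using energy_near_orbit[OF \<gamma>(1)] by blast
  \<comment> \<open>Below \<eta>, so that the initial energy is under the barrier, and below
    \<rho>/2, so that the initial point is on the inner side of the annulus.\<close>
  define \<delta>\<^sub>e where "\<delta>\<^sub>e = min \<eta> (\<rho> / 2) / 2"
  have \<delta>\<^sub>e: "\<delta>\<^sub>e > 0" "\<delta>\<^sub>e < \<eta>" "\<delta>\<^sub>e < \<rho> / 2" using \<eta>(1) \<rho>(1) by (auto simp: \<delta>\<^sub>e_def min_def)
  show ?thesis
  proof (rule exI[of _ \<delta>\<^sub>e], rule conjI[OF \<delta>\<^sub>e(1)], rule exI[of _ \<delta>\<^sub>T], rule conjI[OF \<delta>\<^sub>T], intro ballI allI impI, elim conjE)
    fix U\<^sub>0 :: "'n tuple" and \<tau> :: "nat \<Rightarrow> real" and p :: "nat \<Rightarrow> nat"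
    assume U0: "U\<^sub>0 \<in> tuples V \<inter> stiefel" and orb: "orbit U\<^sub>0 \<in> orbit_ball V Ustar \<delta>\<^sub>e"
      and \<tau>0: "\<forall>n. \<tau> n > 0" and diverges: "filterlim (\<lambda>n. \<Sum>k<n. \<tau> k) at_top sequentially"
      and bdd: "bdd_above (range \<tau>)" and sup: "(SUP n. \<tau> n) \<le> \<delta>\<^sub>T" and p: "\<forall>n. p n \<ge> 1"
    define U where "U = iterate V E \<tau> p U\<^sub>0"
    have \<tau>: "0 < \<tau> n" "\<tau> n \<le> \<delta>\<^sub>T" for n
      using \<tau>0 order_trans[OF cSUP_upper[OF UNIV_I bdd] sup] by auto
    have U_Suc: "U (Suc n) = 2 *\<^sub>R half_step V E (\<tau> n) (U n) (p n) - U n" for n by (simp add: U_def)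
    have dU0: "d U\<^sub>0 \<le> \<delta>\<^sub>e"
    proof -
      \<comment> \<open>Membership in the ball of classes is witnessed by some representative
        \<open>W\<close>; the distance carries over to the initial point by rotation.\<close>
      obtain W where W: "orbit U\<^sub>0 = orbit W" "W \<in> tuples V" "orbit_dist Ustar W \<le> \<delta>\<^sub>e"
        using orb by (auto simp: orbit_ball_def)
      obtain P where P: "orthogonal_matrix P" "U\<^sub>0 = tmul W P"
        using W(1) mem_orbit[of U\<^sub>0] by (auto simp: orbit_def)
      show ?thesis using W P Ustar orbit_dist_commute[OF Ustar W(2)] by (simp add: orbit_dist_tmul_left)
    qed
    have inv: "U n \<in> tuples V \<and> gram (U n) (U n) = mat 1 \<and> d (U n) < \<rho> / 2 \<and> E (U n) < E Ustar + \<gamma>" for n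
    proof (induction n)
      case 0
      have "U 0 = U\<^sub>0" by (simp add: U_def)
      then show ?case using U0 tuples_stiefel_iff[of U\<^sub>0] dU0 \<delta>\<^sub>e \<eta>(2)[of U\<^sub>0] by auto
    next
      case (Suc n)
      have dn: "d (U n) < \<delta> / 2" using Suc \<rho> by linarith
      have Un: "U n \<in> tuples V" "gram (U n) (U n) = mat 1" using Suc by auto
      note sm = small[OF \<tau>, of n]
      note s = step[OF Un dn \<tau>(1) sm(1-3) p[rule_format, of n], folded U_Suc]
      have "0 \<le> \<tau> n / 2 * (D (U n))\<^sup>2" using \<tau>(1)[of n] by simp
      then have E: "E (U (Suc n)) < E Ustar + \<gamma>" using s(4) Suc by linarith
      have "d (U (Suc n)) \<le> d (U n) + tnorm (U (Suc n) - U n)" using s(1) Un Ustar by (intro orbit_dist_triangle)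
      also have "\<dots> \<le> \<rho>" using s(3) sm(4) Suc by linarith
      \<comment> \<open>A step has length at most \<rho>/2 and so ends at distance at most \<rho>;
        its energy is below the barrier, which excludes distances between \<rho>/2 and
        \<rho>.\<close>
      finally have "d (U (Suc n)) < \<rho> / 2" using \<gamma>(2)[OF s(1,2)] E by linarith
      then show ?case using s(1,2) E by blast
    qed
    have U: "U n \<in> tuples V" "gram (U n) (U n) = mat 1" "d (U n) < \<rho> / 2" for n using inv[of n] by auto
    have dU: "d (U n) \<le> \<rho>" for n using U(3)[of n] \<rho>(1) by linarith
    have desc: "E (U (Suc n)) \<le> E (U n) - \<tau> n / 2 * (D (U n))\<^sup>2" for n
    proof -
      have dn: "d (U n) < \<delta> / 2" using U(3)[of n] \<rho> by linarith
      note sm = small[OF \<tau>, of n]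
      show ?thesis using step(4)[OF U(1,2) dn \<tau>(1) sm(1-3) p[rule_format, of n]] by (simp add: U_Suc)
    qed
    have lower: "E Ustar \<le> E (U n)" for n
      using U[of n] \<rho> by (intro r(2)) auto
    have nonneg: "0 \<le> \<tau> n / 2 * (D (U n))\<^sup>2" for n using \<tau>(1)[of n] by simp
    have "E (U (Suc n)) \<le> E (U n)" for n using desc[of n] nonneg[of n] by linarith
    then have "decseq (\<lambda>n. E (U n))" by (intro decseq_SucI)
    then obtain Einf where Einf: "(\<lambda>n. E (U n)) \<longlonglongrightarrow> Einf"
      using decseq_convergent[of "\<lambda>n. E (U n)" "E Ustar"] lower by blast
    have telescope: "(\<Sum>k<n. \<tau> k / 2 * (D (U k))\<^sup>2) \<le> E (U 0) - E (U n)" for n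
    proof (induction n)
      case (Suc n)
      then show ?case using desc[of n] by simp
    qed simp
    have small_D: "\<exists>n\<ge>N. D (U n) < e" if e: "e > 0" for e N
    proof (rule ccontr)
      assume "\<not> ?thesis"
      then have ge: "D (U n) \<ge> e" if "n \<ge> N" for n using that by (auto simp: not_less)
      \<comment> \<open>If \<open>D\<close> stays above e from N on, the total energy drop pays for
        all later time steps; the steps before N are counted separately.\<close>
      define B where "B = 2 * (E (U 0) - E Ustar) / e\<^sup>2 + (\<Sum>k<N. \<tau> k)"
      have le_B: "(\<Sum>k<n. \<tau> k) \<le> B" for n
      proof -
        have term_le: "\<tau> k \<le> 2 / e\<^sup>2 * (\<tau> k / 2 * (D (U k))\<^sup>2) + (if k < N then \<tau> k else 0)" for k
        proof (cases "k < N")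
          case True
          then show ?thesis using nonneg[of k] e by simp
        next
          case False
          then have "e\<^sup>2 \<le> (D (U k))\<^sup>2" using ge[of k] e by (intro power_mono) auto
          then have "\<tau> k * e\<^sup>2 \<le> \<tau> k * (D (U k))\<^sup>2" using \<tau>(1)[of k] by (intro mult_left_mono) auto
          then show ?thesis using False e by (simp add: field_simps)
        qed
        have "(\<Sum>k<n. \<tau> k) \<le> (\<Sum>k<n. 2 / e\<^sup>2 * (\<tau> k / 2 * (D (U k))\<^sup>2) + (if k < N then \<tau> k else 0))"
          by (intro sum_mono term_le)
        also have "\<dots> = 2 / e\<^sup>2 * (\<Sum>k<n. \<tau> k / 2 * (D (U k))\<^sup>2) + (\<Sum>k<n. if k < N then \<tau> k else 0)"
          by (simp only: sum.distrib sum_distrib_left)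
        also have "(\<Sum>k<n. if k < N then \<tau> k else 0) = (\<Sum>k\<in>{..<n} \<inter> {..<N}. \<tau> k)"
          by (simp add: sum.If_cases lessThan_def)
        also have "\<dots> \<le> (\<Sum>k<N. \<tau> k)"
          using \<tau>(1) by (intro sum_mono2) (auto intro: less_imp_le)
        also have "2 / e\<^sup>2 * (\<Sum>k<n. \<tau> k / 2 * (D (U k))\<^sup>2) \<le> 2 / e\<^sup>2 * (E (U 0) - E Ustar)"
          using telescope[of n] lower[of n] by (intro mult_left_mono) auto
        finally show ?thesis by (simp add: B_def)
      qed
      have "\<forall>\<^sub>F n in sequentially. B + 1 \<le> (\<Sum>k<n. \<tau> k)"
        using diverges unfolding filterlim_at_top by blast
      then obtain n where "B + 1 \<le> (\<Sum>k<n. \<tau> k)" by (auto simp: eventually_sequentially)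
      then show False using le_B[of n] by linarith
    qed
    \<comment> \<open>The indices chosen below satisfy only \<open>m k \<ge> k\<close> and need not
      increase, but they still tend to infinity.\<close>
    have subseq_lim: "(\<lambda>k. E (U (m k))) \<longlonglongrightarrow> Einf" if "\<And>k. m k \<ge> k" for m
    proof -
      have "filterlim m at_top sequentially"
        using that by (intro filterlim_at_top_mono[OF filterlim_ident]) auto
      then show ?thesis using filterlim_compose[OF Einf] by blast
    qed
    have Einf_eq: "Einf = E Ustar"
    proof -
      have "\<exists>m\<ge>k. D (U m) < 1 / real (Suc k)" for k by (rule small_D) simp
      then obtain m where m: "\<And>k. m k \<ge> k" "\<And>k. D (U (m k)) < 1 / real (Suc k)" by metis
      obtain W s where W: "strict_mono (s :: nat \<Rightarrow> nat)" "W \<in> tuples V" "gram W W = mat 1" "d W \<le> \<rho>"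
        "(\<lambda>n. d (U (m (s n)))) \<longlonglongrightarrow> d W" "(\<lambda>n. E (U (m (s n)))) \<longlonglongrightarrow> E W" "(\<lambda>n. D (U (m (s n)))) \<longlonglongrightarrow> D W"
        by (rule compactness[of "\<lambda>k. U (m k)", OF U(1,2) dU \<rho>(2)])
      have "(\<lambda>k. D (U (m k))) \<longlonglongrightarrow> 0"
        using m(2) U(1) by (intro tendsto_sandwich[OF _ _ tendsto_const LIMSEQ_Suc[OF lim_1_over_n]] always_eventually allI)
          (auto simp: grad_G_def intro: less_imp_le)
      then have "(\<lambda>n. D (U (m (s n)))) \<longlonglongrightarrow> 0"
        using LIMSEQ_subseq_LIMSEQ[OF _ W(1)] by (fastforce simp: o_def)
      then have "D W = 0" using W(7) LIMSEQ_unique by blast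
      then have "grad_G V E W = 0" using W(2) by (simp add: T.nrm_eq_0_iff grad_G_def)
      then have "W \<in> orbit Ustar" using W \<rho>(3) by (intro critical_imp_orbit) auto
      then have "E W = E Ustar" by (rule orbit_Ustar)
      moreover have "(\<lambda>n. E (U (m (s n)))) \<longlonglongrightarrow> Einf"
        using LIMSEQ_subseq_LIMSEQ[OF subseq_lim[OF m(1)] W(1)] by (simp add: o_def)
      ultimately show ?thesis using W(6) LIMSEQ_unique by metis
    qed
    \<comment> \<open>By \<open>below\<close>, both quantities vanish at every limit point, since
      its energy is that of \<open>Ustar\<close>; one argument by contradiction serves both.\<close>
    have key: "f \<longlonglongrightarrow> 0" if f: "\<And>n. f n \<ge> 0" "f = (\<lambda>n. d (U n)) \<or> f = (\<lambda>n. D (U n))" for f :: "nat \<Rightarrow> real"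
    proof (rule ccontr)
      assume "\<not> f \<longlonglongrightarrow> 0"
      then obtain e where e: "e > 0" "\<And>N. \<exists>n\<ge>N. e \<le> f n"
        using f(1) unfolding LIMSEQ_iff by (auto simp: not_less)
      then obtain m where m: "\<And>k. m k \<ge> k" "\<And>k. e \<le> f (m k)" by metis
      obtain W s where W: "strict_mono (s :: nat \<Rightarrow> nat)" "W \<in> tuples V" "gram W W = mat 1" "d W \<le> \<rho>"
        "(\<lambda>n. d (U (m (s n)))) \<longlonglongrightarrow> d W" "(\<lambda>n. E (U (m (s n)))) \<longlonglongrightarrow> E W" "(\<lambda>n. D (U (m (s n)))) \<longlonglongrightarrow> D W"
        by (rule compactness[of "\<lambda>k. U (m k)", OF U(1,2) dU \<rho>(2)])
      have "(\<lambda>n. E (U (m (s n)))) \<longlonglongrightarrow> E Ustar"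
        using LIMSEQ_subseq_LIMSEQ[OF subseq_lim[OF m(1)] W(1)] by (simp add: o_def Einf_eq)
      then have "E W = E Ustar" using W(6) LIMSEQ_unique by blast
      then have "D W = 0" "d W = 0" using below W by auto
      then have "(\<lambda>n. f (m (s n))) \<longlonglongrightarrow> 0" using f(2) W(5,7) by auto
      then have "e \<le> 0" using m(2) by (intro LIMSEQ_le_const) auto
      then show False using e(1) by simp
    qed
    have "(\<lambda>n. D (U n)) \<longlonglongrightarrow> 0" by (rule key) (use U(1) in \<open>auto simp: grad_G_def\<close>)
    moreover have "(\<lambda>n. d (U n)) \<longlonglongrightarrow> 0" by (rule key) (use U(1) Ustar orbit_dist_nonneg in auto)
    ultimately show "let U = iterate V E \<tau> p U\<^sub>0 in
        (\<lambda>n. tnorm (grad_G V E (U n))) \<longlonglongrightarrow> 0 \<and>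
        (\<lambda>n. E (U n)) \<longlonglongrightarrow> E Ustar \<and>
        (\<lambda>n. orbit_dist (U n) Ustar) \<longlonglongrightarrow> 0"
      using Einf Einf_eq by (simp add: Let_def U_def)
  qed
qed

end

theorem theorem5p7:
  fixes V :: "(real^3 \<Rightarrow> real) set" and Ng :: nat
    and Vext :: "real^3 \<Rightarrow> real" and exc vxc :: density_map
    and E :: "('n::finite) tuple \<Rightarrow> real"
    and Ustar :: "'n tuple"
    and \<delta>\<^sub>1 \<delta>\<^sub>a \<delta>\<^sub>b \<delta>\<^sub>c \<delta>star \<delta>\<^sub>L L :: real
  defines "E \<equiv> ks_energy Vext exc"
  assumes V: "fin_dim_H1_space Ng V"
    and energy: "energy_well_defined TYPE('n) Vext exc"
    and bounded_below: "bdd_below (E ` stiefel)"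
    and xc: "xc_differentiable TYPE('n) V exc vxc"
    and Ustar: "Ustar \<in> tuples V \<inter> stiefel"
    and lipschitz1: "\<delta>\<^sub>1 > 0" "\<exists>L\<^sub>1. lipschitz_grad V E L\<^sub>1 (tball V Ustar \<delta>\<^sub>1)"
    and g: "\<delta>\<^sub>a > 0" "\<delta>\<^sub>b > 0" "\<delta>star > 0"
      "\<exists>!g. g \<in> (tball V Ustar \<delta>\<^sub>a \<times> {-\<delta>star..\<delta>star}) \<rightarrow>\<^sub>E tball V Ustar \<delta>\<^sub>b \<and>
         (\<forall>U \<in> tball V Ustar \<delta>\<^sub>a. \<forall>s \<in> {-\<delta>star..\<delta>star}.
            g (U, s) - U = - (s *\<^sub>R grad_G V E ((1/2) *\<^sub>R (g (U, s) + U))))"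
    and lipschitz2: "\<delta>\<^sub>L > max \<delta>\<^sub>a \<delta>\<^sub>b" "lipschitz_grad V E L (tball V Ustar \<delta>\<^sub>L)"
    and minimizer: "local_minimizer V E Ustar"
    and critical: "0 < \<delta>\<^sub>c" "\<delta>\<^sub>c \<le> \<delta>\<^sub>1" "unique_critical_in_ball V E Ustar \<delta>\<^sub>c"
  shows "\<exists>\<delta>\<^sub>e>0. \<exists>\<delta>\<^sub>T>0. \<forall>U\<^sub>0 \<in> tuples V \<inter> stiefel. \<forall>\<tau> :: nat \<Rightarrow> real. \<forall>p :: nat \<Rightarrow> nat.
      orbit U\<^sub>0 \<in> orbit_ball V Ustar \<delta>\<^sub>e \<and>
      (\<forall>n. \<tau> n > 0) \<and>
      filterlim (\<lambda>n. \<Sum>k<n. \<tau> k) at_top sequentially \<and>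
      bdd_above (range \<tau>) \<and> (SUP n. \<tau> n) \<le> \<delta>\<^sub>T \<and>
      (\<forall>n. p n \<ge> 1) \<longrightarrow>
      (let U = iterate V E \<tau> p U\<^sub>0 in
        (\<lambda>n. tnorm (grad_G V E (U n))) \<longlonglongrightarrow> 0 \<and>
        (\<lambda>n. E (U n)) \<longlonglongrightarrow> E Ustar \<and>
        (\<lambda>n. orbit_dist (U n) Ustar) \<longlonglongrightarrow> 0)"
proof -
  have sub: "V \<subseteq> H1" using V by (simp add: fin_dim_H1_space_def)
  obtain B where B: "finite B" "independent B" "span B = V"
    using V unfolding fin_dim_H1_space_def by blast
  interpret H1_space V
  proof
    show "subspace V" using B(3) by (metis subspace_span)
    show "square_integrable v" if "v \<in> V" for v using that sub by (auto simp: H1_def)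
    show "v = 0" if "v \<in> V" "AE x in lborel. v x = 0" for v
      using V that unfolding fin_dim_H1_space_def by blast
    show "\<exists>B. finite B \<and> B \<subseteq> V \<and> V \<subseteq> span B"
      using B span_superset by (intro exI[of _ B]) blast
    show "V \<subseteq> H1" by (rule sub)
  qed
  interpret energy_space V E
    unfolding E_def by (rule ks_energy_space[OF energy xc])
  obtain L\<^sub>1 where L1: "lipschitz_grad V E L\<^sub>1 (tball V Ustar \<delta>\<^sub>1)" using lipschitz1(2) by blast
  \<comment> \<open>The descent estimates use a nonnegative constant, and \<open>L\<^sub>1\<close>
    comes without a sign.\<close>
  have lip: "lipschitz_grad V E (max 0 L\<^sub>1) (tball V Ustar \<delta>\<^sub>1)"
    unfolding lipschitz_grad_def
  proof (intro ballI)
    fix X Y assume XY: "X \<in> tball V Ustar \<delta>\<^sub>1" "Y \<in> tball V Ustar \<delta>\<^sub>1"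
    then have "tnorm (grad V E X - grad V E Y) \<le> L\<^sub>1 * tnorm (X - Y)"
      using L1 unfolding lipschitz_grad_def by blast
    also have "\<dots> \<le> max 0 L\<^sub>1 * tnorm (X - Y)"
      using XY by (intro mult_right_mono) (auto simp: tball_def)
    finally show "tnorm (grad V E X - grad V E Y) \<le> max 0 L\<^sub>1 * tnorm (X - Y)" .
  qed
  interpret isolated_minimizer V E Ustar \<delta>\<^sub>1 \<delta>\<^sub>c "max 0 L\<^sub>1"
    using Ustar tuples_stiefel_iff[of Ustar] lipschitz1(1) lip minimizer critical(1,3)
    by unfold_locales auto
  show ?thesis by (rule convergence)
qed

end
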